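(* The set of algebraic extensions $K\subseteq\overline{\mathbb{Q}}$ of $\mathbb{Q}$ for which the ring of algebraic integers $\mathcal{O}_K$ is existentially definable in $K$ or universally definable in $K$ is a meager subset of $\operatorname{Sub}(\overline{\mathbb{Q}})$.
   Context: $\operatorname{Sub}(\overline{\mathbb{Q}})$ is the set of all subfields of a fixed algebraic closure $\overline{\mathbb{Q}}$ of $\mathbb{Q}$. It is regarded as a subset of the power set $2^{\overline{\mathbb{Q}}}$ (identifying subsets with characteristic functions) and carries the topology inherited from the product topology; a basis is given by the sets $U_{\vec a,\vec b}=\{L : a_1,\dots,a_n\in L,\ b_1,\dots,b_k\notin L\}$ for finite tuples $\vec a,\vec b$ from $\overline{\mathbb{Q}}$. A set is meager if it is a countable union of nowhere dense sets. $\mathcal{O}_K$ is the set of elements of $K$ integral over $\mathbb{Z}$. Definability: a subset $C\subseteq L$ is universally (resp. existentially) definable in the field $L$ if it is the set of $x\in L$ satisfying in $L$ a formula $\forall \vec Y\,\phi(X,\vec Y)$ (resp. $\exists\vec Y\,\phi(X,\vec Y)$), where $\phi$ is a quantifier-free formula in the language of rings with parameters from $L$. *)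

theory Defs
  imports "HOL-Analysis.Analysis" "HOL-Computational_Algebra.Polynomial"
begin

section \<open>Definability by formulas in the language of rings\<close>

datatype (rterm_params: 'a) rterm =
    Var nat
  | Param 'a
  | Zero
  | One
  | Plus "'a rterm" "'a rterm"
  | Minus "'a rterm"
  | Times "'a rterm" "'a rterm"

datatype (qf_params: 'a) qf_formula =
    Eq "'a rterm" "'a rterm"
  | Neg "'a qf_formula"
  | Conj "'a qf_formula" "'a qf_formula"
  | Disj "'a qf_formula" "'a qf_formula"

primrec rterm_vars :: "'a rterm \<Rightarrow> nat set" where
  "rterm_vars (Var i) = {i}"
| "rterm_vars (Param a) = {}"
| "rterm_vars Zero = {}"
| "rterm_vars One = {}"
| "rterm_vars (Plus s t) = rterm_vars s \<union> rterm_vars t"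
| "rterm_vars (Minus t) = rterm_vars t"
| "rterm_vars (Times s t) = rterm_vars s \<union> rterm_vars t"

primrec qf_vars :: "'a qf_formula \<Rightarrow> nat set" where
  "qf_vars (Eq s t) = rterm_vars s \<union> rterm_vars t"
| "qf_vars (Neg \<phi>) = qf_vars \<phi>"
| "qf_vars (Conj \<phi> \<psi>) = qf_vars \<phi> \<union> qf_vars \<psi>"
| "qf_vars (Disj \<phi> \<psi>) = qf_vars \<phi> \<union> qf_vars \<psi>"

primrec rterm_val :: "(nat \<Rightarrow> 'a::comm_ring_1) \<Rightarrow> 'a rterm \<Rightarrow> 'a" where
  "rterm_val v (Var i) = v i"
| "rterm_val v (Param a) = a"
| "rterm_val v Zero = 0"
| "rterm_val v One = 1"
| "rterm_val v (Plus s t) = rterm_val v s + rterm_val v t"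
| "rterm_val v (Minus t) = - rterm_val v t"
| "rterm_val v (Times s t) = rterm_val v s * rterm_val v t"

primrec qf_sat :: "(nat \<Rightarrow> 'a::comm_ring_1) \<Rightarrow> 'a qf_formula \<Rightarrow> bool" where
  "qf_sat v (Eq s t) \<longleftrightarrow> rterm_val v s = rterm_val v t"
| "qf_sat v (Neg \<phi>) \<longleftrightarrow> \<not> qf_sat v \<phi>"
| "qf_sat v (Conj \<phi> \<psi>) \<longleftrightarrow> qf_sat v \<phi> \<and> qf_sat v \<psi>"
| "qf_sat v (Disj \<phi> \<psi>) \<longleftrightarrow> qf_sat v \<phi> \<or> qf_sat v \<psi>"

text \<open>
  In the next two definitions \<open>L\<close> is a subfield of the ambient field \<open>'a\<close>. Variable \<open>0\<close> plays the
  role of \<open>X\<close> and variables \<open>1, \<dots>, m\<close> that of the tuple \<open>Y\<close>. Quantifiers and parameters range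
  over \<open>L\<close> only; since \<open>L\<close> is closed under the ring operations, evaluating a quantifier-free
  formula at points of \<open>L\<close> gives the same result in \<open>'a\<close> as in \<open>L\<close>.
\<close>

definition existentially_definable :: "'a::field set \<Rightarrow> 'a set \<Rightarrow> bool" where
  "existentially_definable L C \<longleftrightarrow>
     (\<exists>m \<phi>. qf_params \<phi> \<subseteq> L \<and> qf_vars \<phi> \<subseteq> {..m} \<and>
        C = {x \<in> L. \<exists>ys. length ys = m \<and> set ys \<subseteq> L \<and> qf_sat (nth (x # ys)) \<phi>})"

definition universally_definable :: "'a::field set \<Rightarrow> 'a set \<Rightarrow> bool" where
  "universally_definable L C \<longleftrightarrow>
     (\<exists>m \<phi>. qf_params \<phi> \<subseteq> L \<and> qf_vars \<phi> \<subseteq> {..m} \<and>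
        C = {x \<in> L. \<forall>ys. length ys = m \<and> set ys \<subseteq> L \<longrightarrow> qf_sat (nth (x # ys)) \<phi>})"


section \<open>Meager sets\<close>

definition nowhere_dense_in :: "'a topology \<Rightarrow> 'a set \<Rightarrow> bool" where
  "nowhere_dense_in X S \<longleftrightarrow> S \<subseteq> topspace X \<and> X interior_of (X closure_of S) = {}"

definition meager_in :: "'a topology \<Rightarrow> 'a set \<Rightarrow> bool" where
  "meager_in X S \<longleftrightarrow> (\<exists>\<A>. countable \<A> \<and> (\<forall>A\<in>\<A>. nowhere_dense_in X A) \<and> S = \<Union>\<A>)"


section \<open>The space of subfields of the algebraic closure of the rationals\<close>

text \<open>The fixed algebraic closure is the field of algebraic complex numbers.\<close>

definition Qbar :: "complex set" where
  "Qbar = {z. algebraic z}"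

definition is_subfield :: "'a::field set \<Rightarrow> bool" where
  "is_subfield K \<longleftrightarrow>
     0 \<in> K \<and> 1 \<in> K \<and>
     (\<forall>x\<in>K. \<forall>y\<in>K. x + y \<in> K \<and> x * y \<in> K) \<and>
     (\<forall>x\<in>K. - x \<in> K \<and> inverse x \<in> K)"

definition Sub_Qbar :: "complex set set" where
  "Sub_Qbar = {K. K \<subseteq> Qbar \<and> is_subfield K}"

text \<open>
  The product topology on the power set of \<open>A\<close>: the topology transported from the product of copies
  of the discrete space \<open>bool\<close> along the bijection of \<open>Pow A\<close> with \<open>A \<rightarrow>\<^sub>E UNIV\<close> that sends a
  subset to its characteristic function.
\<close>

definition powerset_topology :: "'a set \<Rightarrow> 'a set topology" where
  "powerset_topology A =
     pullback_topology (Pow A) (\<lambda>S. \<lambda>x\<in>A. x \<in> S)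
       (product_topology (\<lambda>_. discrete_topology (UNIV :: bool set)) A)"

definition Sub_Qbar_topology :: "complex set topology" where
  "Sub_Qbar_topology = subtopology (powerset_topology Qbar) Sub_Qbar"

definition ring_of_integers :: "'a::field set \<Rightarrow> 'a set" where
  "ring_of_integers K = {x \<in> K. algebraic_int x}"

lemma topspace_powerset_topology [simp]: "topspace (powerset_topology A) = Pow A"
  by (auto simp: powerset_topology_def topspace_pullback_topology)

lemma topspace_Sub_Qbar_topology [simp]: "topspace Sub_Qbar_topology = Sub_Qbar"
  by (auto simp: Sub_Qbar_topology_def Sub_Qbar_def)

lemma openin_powerset_topology_iff:
  "openin (powerset_topology A) U \<longleftrightarrow>
     U \<subseteq> Pow A \<and>
     (\<forall>S\<in>U. \<exists>P N. finite P \<and> finite N \<and> P \<subseteq> A \<and> N \<subseteq> A \<and> P \<subseteq> S \<and> N \<inter> S = {} \<and>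
        {T. T \<subseteq> A \<and> P \<subseteq> T \<and> N \<inter> T = {}} \<subseteq> U)"
    (is "?L \<longleftrightarrow> ?R")
proof
  let ?f = "\<lambda>S. \<lambda>x\<in>A. x \<in> S"
  let ?X = "product_topology (\<lambda>_. discrete_topology (UNIV :: bool set)) A"
  assume L: ?L
  then obtain V where V: "openin ?X V" "U = ?f -` V \<inter> Pow A"
    unfolding powerset_topology_def openin_pullback_topology by blast
  show ?R
  proof (intro conjI ballI)
    show "U \<subseteq> Pow A" using V by blast
    fix S assume S: "S \<in> U"
    then have "?f S \<in> V" using V by blast
    then obtain B where B: "finite {i \<in> A. B i \<noteq> UNIV}" "?f S \<in> Pi\<^sub>E A B" "Pi\<^sub>E A B \<subseteq> V"
      using V(1) unfolding openin_product_topology_alt by force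
    define P where "P = {i \<in> A. B i \<noteq> UNIV} \<inter> S"
    define N where "N = {i \<in> A. B i \<noteq> UNIV} - S"
    have "T \<in> U" if T: "T \<subseteq> A" "P \<subseteq> T" "N \<inter> T = {}" for T
    proof -
      have "?f T \<in> Pi\<^sub>E A B"
      proof (rule PiE_I)
        fix i assume i: "i \<in> A"
        show "?f T i \<in> B i"
        proof (cases "B i = UNIV")
          case False
          then have "i \<in> T \<longleftrightarrow> i \<in> S" using T i unfolding P_def N_def by blast
          moreover have "?f S i \<in> B i" using B(2) i by (rule PiE_mem)
          ultimately show ?thesis using i by simp
        qed simp
      qed simp
      then show ?thesis using B V T by blast
    qed
    moreover have "finite P" "finite N" "P \<subseteq> A" "N \<subseteq> A" "P \<subseteq> S" "N \<inter> S = {}"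
      using B(1) unfolding P_def N_def by auto
    ultimately show "\<exists>P N. finite P \<and> finite N \<and> P \<subseteq> A \<and> N \<subseteq> A \<and> P \<subseteq> S \<and> N \<inter> S = {} \<and>
        {T. T \<subseteq> A \<and> P \<subseteq> T \<and> N \<inter> T = {}} \<subseteq> U"
      by (intro exI[of _ P] exI[of _ N] conjI) auto
  qed
next
  let ?f = "\<lambda>S. \<lambda>x\<in>A. x \<in> S"
  let ?X = "product_topology (\<lambda>_. discrete_topology (UNIV :: bool set)) A"
  assume R: ?R
  show ?L
  proof (rule openin_subopen[THEN iffD2], intro ballI)
    fix S assume S: "S \<in> U"
    then obtain P N where PN: "finite P" "finite N" "P \<subseteq> A" "N \<subseteq> A" "P \<subseteq> S" "N \<inter> S = {}"
      "{T. T \<subseteq> A \<and> P \<subseteq> T \<and> N \<inter> T = {}} \<subseteq> U"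
      using bspec[OF conjunct2[OF R] S] by auto
    have SA: "S \<subseteq> A" using R S by blast
    define B where "B i = (if i \<in> P then {True} else if i \<in> N then {False} else UNIV)" for i
    have "finite {i \<in> A. B i \<noteq> UNIV}"
      by (rule finite_subset[of _ "P \<union> N"]) (use PN in \<open>auto simp: B_def\<close>)
    then have "openin ?X (Pi\<^sub>E A B)"
      by (auto simp: openin_PiE_gen)
    moreover have "?f -` (Pi\<^sub>E A B) \<inter> Pow A = {T. T \<subseteq> A \<and> P \<subseteq> T \<and> N \<inter> T = {}}"
    proof (intro set_eqI)
      fix T
      show "T \<in> ?f -` (Pi\<^sub>E A B) \<inter> Pow A \<longleftrightarrow> T \<in> {T. T \<subseteq> A \<and> P \<subseteq> T \<and> N \<inter> T = {}}"
      proof -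
        have "?f T \<in> Pi\<^sub>E A B \<longleftrightarrow> (\<forall>i\<in>A. (i \<in> T) \<in> B i)"
          by (auto simp: PiE_iff)
        also have "\<dots> \<longleftrightarrow> (\<forall>i\<in>A. (i \<in> P \<longrightarrow> i \<in> T) \<and> (i \<in> N \<longrightarrow> i \<notin> T))"
          using PN(5,6) by (intro ball_cong refl) (auto simp: B_def)
        also have "\<dots> \<longleftrightarrow> P \<subseteq> T \<and> N \<inter> T = {}"
          using PN(3,4) by blast
        finally show ?thesis by auto
      qed
    qed
    ultimately have "openin (powerset_topology A) {T. T \<subseteq> A \<and> P \<subseteq> T \<and> N \<inter> T = {}}"
      unfolding powerset_topology_def openin_pullback_topology by (intro exI[of _ "Pi\<^sub>E A B"]) auto
    then show "\<exists>T. openin (powerset_topology A) T \<and> S \<in> T \<and> T \<subseteq> U"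
      using PN SA by (intro exI[of _ "{T. T \<subseteq> A \<and> P \<subseteq> T \<and> N \<inter> T = {}}"]) auto
  qed
qed

end

theory Submission
  imports Defs "Jordan_Normal_Form.Char_Poly" "HOL-Computational_Algebra.Computational_Algebra"
begin

hide_const (open) Module.smult

text \<open>
  Suppose that one formula defines the ring of integers in a field \<open>K0\<close> and consider a basic neighbourhood
  of \<open>K0\<close>, given by a finite set \<open>a\<close> inside \<open>K0\<close> and a finite set \<open>b\<close> outside. The quantifier-free
  formula, or its negation in the universal case, has solutions \<open>(\<sigma> n + \<kappa>, ys n)\<close> in \<open>K0\<close> for infinitely
  many rational \<open>\<sigma> n\<close>, where \<open>\<kappa> = 1/2\<close> and the \<open>\<sigma> n + \<kappa>\<close> are integers in the existential case, and
  \<open>\<kappa> = 0\<close> and the \<open>\<sigma> n\<close> are half-integers in the universal case. In an ultrapower of \<open>K0\<close> they yield a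
  solution whose first coordinate is transcendental over \<open>K0\<close>. By an exchange argument and Hensel's lemma it
  can be moved into the field of Laurent series over \<open>K0\<close>, with first coordinate \<open>S + \<kappa>\<close> for
  \<open>S = \<sigma> n + t\<close> and the remaining ones algebraic over \<open>K0(S)\<close>. No element of \<open>b\<close> is a Laurent series
  over \<open>K0\<close>, so Hilbert irreducibility, used for specializations of \<open>S\<close> to the root \<open>s = p\<^sup>1\<^sup>/\<^sup>N\<close> of a prime,
  produces a number field \<open>E\<close> containing \<open>a\<close> and the parameters, disjoint from \<open>b\<close>, with a solution whose first
  coordinate is \<open>s + \<kappa>\<close>. For \<open>\<kappa> = 1/2\<close> this is not integral although the existential formula
  holds; for \<open>\<kappa> = 0\<close> it is integral although the universal formula fails. Only finitely many elements
  of \<open>E\<close> witness this, so the same happens on an open set that meets the given neighbourhood.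
\<close>

section \<open>Subrings, subfields and integral elements\<close>

text \<open>The given solutions lie in \<open>K0\<close>, but their degrees over the rationals are
  unbounded in general, so no single curve over a number field carries them. The ultrapower supplies
  the curve: over enlarged constants all coordinates become algebraic over one transcendental, and
  their relation can be read back over \<open>K0\<close> at a single index. From then on the
  elements of \<open>b\<close> are kept out by degrees. Each \<beta> in \<open>b\<close> properly
  enlarges the function field of the solution, since that field consists of Laurent series over
  \<open>K0\<close>. A generator of the enlarged field therefore has a minimal relation of larger
  degree, and if this relation stays irreducible under specialization, \<beta> cannot fall into the
  small field \<open>E\<close>. The relation of the smaller field may become reducible without harm.

  For the conclusion \<open>s\<close> only has to be integral. Roots of primes are taken because
  \<rat>(s) has a degree N as large as desired: a polynomial identity of degree below N in
  \<open>s\<close> that holds at \<open>s\<close> holds identically. Size and integrality of the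
  conjugates bound the degrees in \<open>s\<close> of the coefficients of a factor independently of
  N, so an elementary argument replaces the usual proof of Hilbert's theorem.\<close>

definition is_subring :: "'a::comm_ring_1 set \<Rightarrow> bool" where
  "is_subring A \<longleftrightarrow> 0 \<in> A \<and> 1 \<in> A \<and> (\<forall>x\<in>A. \<forall>y\<in>A. x + y \<in> A \<and> x * y \<in> A) \<and> (\<forall>x\<in>A. - x \<in> A)"

lemma is_subringD:
  assumes "is_subring A"
  shows "0 \<in> A" "1 \<in> A" "x \<in> A \<Longrightarrow> y \<in> A \<Longrightarrow> x + y \<in> A" "x \<in> A \<Longrightarrow> y \<in> A \<Longrightarrow> x * y \<in> A"
    "x \<in> A \<Longrightarrow> - x \<in> A"
  using assms by (auto simp: is_subring_def)

lemma subring_diff: "is_subring A \<Longrightarrow> x \<in> A \<Longrightarrow> y \<in> A \<Longrightarrow> x - y \<in> A"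
  by (metis diff_conv_add_uminus is_subringD(3,5))

lemma subring_power: "is_subring A \<Longrightarrow> x \<in> A \<Longrightarrow> x ^ n \<in> A"
  by (induction n) (auto simp: is_subringD)

lemma subring_sum: "is_subring A \<Longrightarrow> (\<And>i. i \<in> I \<Longrightarrow> f i \<in> A) \<Longrightarrow> sum f I \<in> A"
  by (induction I rule: infinite_finite_induct) (auto simp: is_subringD)

lemma subring_prod: "is_subring A \<Longrightarrow> (\<And>i. i \<in> I \<Longrightarrow> f i \<in> A) \<Longrightarrow> prod f I \<in> A"
  by (induction I rule: infinite_finite_induct) (auto simp: is_subringD)

lemma subring_of_nat: "is_subring A \<Longrightarrow> of_nat n \<in> A"
  by (induction n) (auto simp: is_subringD)

lemma subring_of_int: "is_subring A \<Longrightarrow> of_int n \<in> A"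
  by (cases n) (auto simp: subring_of_nat intro!: is_subringD(2) is_subringD(5)[of A "1 + of_nat _", simplified] is_subringD(3) subring_diff)

lemma is_subfieldD:
  assumes "is_subfield K"
  shows "0 \<in> K" "1 \<in> K" "x \<in> K \<Longrightarrow> y \<in> K \<Longrightarrow> x + y \<in> K" "x \<in> K \<Longrightarrow> y \<in> K \<Longrightarrow> x * y \<in> K"
    "x \<in> K \<Longrightarrow> - x \<in> K" "x \<in> K \<Longrightarrow> inverse x \<in> K"
  using assms by (auto simp: is_subfield_def)

lemma subfield_imp_subring: "is_subfield K \<Longrightarrow> is_subring K"
  by (auto simp: is_subring_def is_subfield_def)

lemma subfield_divide: "is_subfield K \<Longrightarrow> x \<in> K \<Longrightarrow> y \<in> K \<Longrightarrow> x / y \<in> K"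
  by (simp add: divide_inverse is_subfieldD)

lemma is_subring_Ints: "is_subring \<int>"
  by (auto simp: is_subring_def)

lemma is_subfield_Rats: "is_subfield (\<rat> :: 'a::field_char_0 set)"
  by (auto simp: is_subfield_def)

section \<open>Polynomials with coefficients in a subring; pseudo-division\<close>

definition polys_over :: "'a::zero set \<Rightarrow> 'a poly set" where
  "polys_over A = {p. \<forall>i. coeff p i \<in> A}"

lemma coeff_polys_over: "p \<in> polys_over A \<Longrightarrow> coeff p i \<in> A"
  by (simp add: polys_over_def)

lemma is_subring_polys_over: "is_subring A \<Longrightarrow> is_subring (polys_over A)"
  by (subst is_subring_def) (auto simp: polys_over_def coeff_mult is_subringD coeff_1 intro!: subring_sum)

lemma polys_over_pCons:
  "is_subring A \<Longrightarrow> pCons a p \<in> polys_over A \<longleftrightarrow> a \<in> A \<and> p \<in> polys_over A"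
proof
  assume "pCons a p \<in> polys_over A"
  then have *: "coeff (pCons a p) i \<in> A" for i by (simp add: polys_over_def)
  show "a \<in> A \<and> p \<in> polys_over A" using *[of 0] *[of "Suc _"] by (auto simp: polys_over_def)
qed (auto simp: polys_over_def coeff_pCons split: nat.split)

lemma polys_over_monom: "is_subring A \<Longrightarrow> a \<in> A \<Longrightarrow> monom a n \<in> polys_over A"
  by (auto simp: polys_over_def is_subringD)

lemma polys_over_smult: "is_subring A \<Longrightarrow> a \<in> A \<Longrightarrow> p \<in> polys_over A \<Longrightarrow> smult a p \<in> polys_over A"
  by (auto simp: polys_over_def is_subringD)

lemma polys_over_pderiv:
  fixes A :: "'a::idom set"
  shows "is_subring A \<Longrightarrow> p \<in> polys_over A \<Longrightarrow> pderiv p \<in> polys_over A"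
  by (auto simp: polys_over_def coeff_pderiv intro!: is_subringD(4) subring_of_nat)
   (metis subring_of_nat of_nat_Suc)

lemma polys_over_mono: "A \<subseteq> B \<Longrightarrow> polys_over A \<subseteq> polys_over B"
  by (auto simp: polys_over_def)

lemma poly_in_subring:
  assumes "is_subring A" "p \<in> polys_over A" "x \<in> A"
  shows "poly p x \<in> A"
  unfolding poly_altdef
  by (intro subring_sum assms is_subringD(4) subring_power coeff_polys_over)

lemma pseudo_division:
  fixes A :: "'a::idom set"
  assumes A: "is_subring A" and g: "g \<in> polys_over A" "g \<noteq> 0" and p: "p \<in> polys_over A"
  shows "\<exists>e q r. q \<in> polys_over A \<and> r \<in> polys_over A \<and> smult (lead_coeff g ^ e) p = g * q + r \<and>
    (r = 0 \<or> degree r < degree g)"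
  using p
proof (induction "degree p" arbitrary: p rule: less_induct)
  case less
  note P = is_subring_polys_over[OF A]
  show ?case
  proof (cases "p = 0 \<or> degree p < degree g")
    case True
    then show ?thesis
      by (intro exI[of _ 0] exI[of _ "0::'a poly"] exI[of _ p]) (use less P in \<open>auto simp: is_subringD\<close>)
  next
    case False
    define l where "l = lead_coeff g"
    have l: "l \<in> A" "l \<noteq> 0" using g by (auto simp: l_def coeff_polys_over)
    define m where "m = monom (lead_coeff p) (degree p - degree g)"
    have m: "m \<in> polys_over A" unfolding m_def
      by (intro polys_over_monom A coeff_polys_over less.prems)
    define p' where "p' = smult l p - g * m"
    have p': "p' \<in> polys_over A" unfolding p'_def
      by (intro subring_diff P polys_over_smult A l less.prems is_subringD(4)[OF P] g m)
    have dm1: "degree (g * m) = degree p"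
      using False g by (auto simp: m_def degree_mult_eq degree_monom_eq)
    have "lead_coeff (g * m) = l * lead_coeff p"
      unfolding lead_coeff_mult m_def lead_coeff_monom l_def ..
    with dm1 have dm: "degree (g * m) = degree p" "coeff (g * m) (degree p) = l * lead_coeff p"
      by simp_all
    have ex: "\<exists>e q r. q \<in> polys_over A \<and> r \<in> polys_over A \<and> smult (l ^ e) p' = g * q + r \<and>
        (r = 0 \<or> degree r < degree g)"
    proof (cases "degree p' < degree p")
      case True
      then show ?thesis using less.hyps[OF True p'] by (simp add: l_def)
    next
      \<comment> \<open>Only constants get here: the coefficient at \<open>degree p\<close>
        vanishes, so without a drop in degree \<open>p'\<close> is zero.\<close>
      case nl: False
      have "degree p' \<le> degree p" unfolding p'_def
        by (intro degree_diff_le) (use dm l in auto)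
      then have "degree p' = degree p" using nl by simp
      moreover have "coeff p' (degree p) = 0"
        using dm by (simp add: p'_def)
      ultimately have "p' = 0" by (metis leading_coeff_0_iff)
      then show ?thesis
        by (intro exI[of _ 0] exI[of _ "0::'a poly"] exI[of _ "0::'a poly"]) (use P in \<open>auto simp: is_subringD\<close>)
    qed
    then obtain e q r where *: "q \<in> polys_over A" "r \<in> polys_over A" "smult (l ^ e) p' = g * q + r"
        "r = 0 \<or> degree r < degree g" by blast
    have "smult (l ^ Suc e) p = g * (q + smult (l ^ e) m) + r"
      using *(3) by (simp add: p'_def algebra_simps smult_diff_right)
    moreover have "q + smult (l ^ e) m \<in> polys_over A"
      by (intro is_subringD(3)[OF P] * polys_over_smult A subring_power l m)
    ultimately show ?thesis using * unfolding l_def by blast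
  qed
qed

section \<open>Linear spans and the determinant trick\<close>

definition lspan :: "'a::comm_ring_1 set \<Rightarrow> 'a set \<Rightarrow> 'a set" where
  "lspan A B = {x. \<exists>c. (\<forall>b. c b \<in> A) \<and> x = (\<Sum>b\<in>B. c b * b)}"

lemma lspan_0: "is_subring A \<Longrightarrow> 0 \<in> lspan A B"
  unfolding lspan_def by (intro CollectI exI[of _ "\<lambda>_. 0"]) (auto simp: is_subringD)

lemma lspan_add: "is_subring A \<Longrightarrow> x \<in> lspan A B \<Longrightarrow> y \<in> lspan A B \<Longrightarrow> x + y \<in> lspan A B"
  unfolding lspan_def mem_Collect_eq
  apply (elim exE conjE)
  subgoal for c d
    by (intro exI[of _ "\<lambda>b. c b + d b"]) (auto simp: is_subringD sum.distrib algebra_simps)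
  done

lemma lspan_scale: "is_subring A \<Longrightarrow> a \<in> A \<Longrightarrow> x \<in> lspan A B \<Longrightarrow> a * x \<in> lspan A B"
  unfolding lspan_def mem_Collect_eq
  apply (elim exE conjE)
  subgoal for c
    by (intro exI[of _ "\<lambda>b. a * c b"]) (auto simp: is_subringD sum_distrib_left algebra_simps)
  done

lemma lspan_base: "is_subring A \<Longrightarrow> finite B \<Longrightarrow> b \<in> B \<Longrightarrow> b \<in> lspan A B"
  unfolding lspan_def
  by (intro CollectI exI[of _ "\<lambda>x. if x = b then 1 else 0"])
     (auto simp: is_subringD if_distrib[of "\<lambda>x. x * _"] sum.delta cong: if_cong)

lemma lspan_sum: "is_subring A \<Longrightarrow> (\<And>i. i \<in> I \<Longrightarrow> f i \<in> lspan A B) \<Longrightarrow> sum f I \<in> lspan A B"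
  by (induction I rule: infinite_finite_induct) (auto simp: lspan_0 lspan_add)

text \<open>The determinant trick: \<open>z\<close> is an eigenvalue of the matrix of multiplication by \<open>z\<close>.\<close>

lemma integral_of_stable_span:
  fixes z :: "'a::idom"
  assumes A: "is_subring A" and B: "finite B" "b0 \<in> B" "b0 \<noteq> 0"
    and st: "\<And>b. b \<in> B \<Longrightarrow> z * b \<in> lspan A B"
  shows "\<exists>p\<in>polys_over A. degree p = card B \<and> lead_coeff p = 1 \<and> poly p z = 0"
proof -
  define n where "n = card B"
  obtain e where e: "bij_betw e {0..<n} B" using ex_bij_betw_nat_finite[OF B(1)] n_def by blast
  have eB: "e i \<in> B" if "i < n" for i using e that by (auto simp: bij_betw_def)
  have "\<forall>b\<in>B. \<exists>c. (\<forall>b'. c b' \<in> A) \<and> z * b = (\<Sum>b'\<in>B. c b' * b')"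
    using st by (auto simp: lspan_def)
  then obtain c where c: "\<And>b b'. b \<in> B \<Longrightarrow> c b b' \<in> A" "\<And>b. b \<in> B \<Longrightarrow> z * b = (\<Sum>b'\<in>B. c b b' * b')"
    by metis
  define M where "M = mat n n (\<lambda>(i,j). c (e i) (e j))"
  have M: "M \<in> carrier_mat n n" by (simp add: M_def)
  define N where "N = mat n n (\<lambda>(i,j). (if i = j then z else 0) - c (e i) (e j))"
  have N: "N \<in> carrier_mat n n" by (simp add: N_def)
  define v where "v = vec n e"
  have v: "v \<in> carrier_vec n" by (simp add: v_def)
  have Nv: "N *\<^sub>v v = 0\<^sub>v n"
  proof (rule eq_vecI)
    fix i assume "i < dim_vec (0\<^sub>v n :: 'a vec)"
    then have i: "i < n" by simp
    have "(N *\<^sub>v v) $ i = (\<Sum>j=0..<n. ((if i = j then z else 0) - c (e i) (e j)) * e j)"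
      using i by (simp add: N_def v_def scalar_prod_def)
    also have "\<dots> = (\<Sum>j=0..<n. (if i = j then z * e j else 0)) - (\<Sum>j=0..<n. c (e i) (e j) * e j)"
      unfolding sum_subtractf[symmetric] by (intro sum.cong) (auto simp: algebra_simps)
    also have "(\<Sum>j=0..<n. (if i = j then z * e j else 0)) = z * e i"
      using i by (subst sum.delta') auto
    also have "(\<Sum>j=0..<n. c (e i) (e j) * e j) = (\<Sum>b\<in>B. c (e i) b * b)"
      using sum.reindex_bij_betw[OF e] .
    also have "z * e i - \<dots> = 0" using c(2)[OF eB[OF i]] by simp
    finally show "(N *\<^sub>v v) $ i = 0\<^sub>v n $ i" using i by simp
  qed (use N in auto)
  obtain i0 where i0: "i0 < n" "e i0 = b0" using e B(2) by (auto simp: bij_betw_def)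
  \<comment> \<open>\<open>v\<close> is a kernel vector of \<open>N\<close>; the adjugate turns this
    into \<open>det N\<close> times \<open>v\<close>, whose entry \<open>b0\<close> is
    nonzero.\<close>
  have "det N = 0"
  proof -
    have "0\<^sub>v n = adj_mat N *\<^sub>v (N *\<^sub>v v)" using adj_mat(1)[OF N] Nv by auto
    also have "\<dots> = (adj_mat N * N) *\<^sub>v v" using adj_mat(1)[OF N] N v by (metis assoc_mult_mat_vec)
    also have "\<dots> = (det N \<cdot>\<^sub>m 1\<^sub>m n) *\<^sub>v v" using adj_mat[OF N] by simp
    also have "\<dots> = det N \<cdot>\<^sub>v v" using v by auto
    finally have "0 = det N * e i0" using i0 by (metis v_def index_smult_vec(1) index_vec index_zero_vec(1) dim_vec)
    then show ?thesis using i0 B by auto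
  qed
  have CM: "char_poly_matrix M \<in> carrier_mat n n" using M by simp
  have "poly (char_poly M) z = det N" unfolding char_poly_def
    by (rule poly_det_cong[OF N CM]) (auto simp: char_poly_matrix_def M_def N_def)
  moreover have "char_poly M \<in> polys_over A"
  proof -
    note P = is_subring_polys_over[OF A]
    have "signof p \<in> polys_over A" for p :: "nat \<Rightarrow> nat"
      by (cases p rule: sign_cases) (use P in \<open>auto simp: is_subringD\<close>)
    moreover have "char_poly_matrix M $$ (i, j) \<in> polys_over A" if "i < n" "j < n" for i j
      using that A c(1)[OF eB[OF that(1)]]
      by (auto simp: char_poly_matrix_def M_def polys_over_pCons is_subringD P)
    ultimately show ?thesis
      unfolding char_poly_def det_def'[OF CM]
      by (intro subring_sum P is_subringD(4)[OF P] subring_prod) auto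
  qed
  ultimately show ?thesis using degree_monic_char_poly[OF M] \<open>det N = 0\<close>
    by (intro bexI[of _ "char_poly M"]) (auto simp: n_def)
qed

section \<open>Integral elements\<close>

definition integral_over :: "'a::idom set \<Rightarrow> 'a \<Rightarrow> bool" where
  "integral_over A z \<longleftrightarrow> (\<exists>p\<in>polys_over A. lead_coeff p = 1 \<and> poly p z = 0)"

text \<open>A subring that is finitely generated as an \<open>A\<close>-module. Such a ring
  certifies the integrality of all its elements at once, so sums and products need no explicit
  equations.\<close>

definition finite_subring :: "'a::comm_ring_1 set \<Rightarrow> 'a set \<Rightarrow> bool" where
  "finite_subring A R \<longleftrightarrow> is_subring R \<and> A \<subseteq> R \<and> (\<exists>B. finite B \<and> B \<subseteq> R \<and> R \<subseteq> lspan A B)"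

lemma finite_subring_refl: "is_subring A \<Longrightarrow> finite_subring A A"
proof -
  assume A: "is_subring A"
  have "A \<subseteq> lspan A {1}"
    using lspan_scale[OF A _ lspan_base[OF A, of "{1}" 1]] by fastforce
  then show ?thesis unfolding finite_subring_def
    using A by (intro conjI exI[of _ "{1}"]) (auto simp: is_subringD)
qed

lemma finite_subring_integral:
  fixes z :: "'a::idom"
  assumes A: "is_subring A" and R: "finite_subring A R" and z: "z \<in> R"
  shows "integral_over A z"
proof -
  obtain B where B: "finite B" "B \<subseteq> R" "R \<subseteq> lspan A B" and sR: "is_subring R"
    using R by (auto simp: finite_subring_def)
  have "1 \<in> lspan A B" using B sR is_subringD(2) by blast
  then obtain c where "1 = (\<Sum>b\<in>B. c b * b)" by (auto simp: lspan_def)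
  then have "\<exists>b\<in>B. b \<noteq> 0" by (metis mult_zero_right sum.neutral zero_neq_one)
  then obtain b0 where "b0 \<in> B" "b0 \<noteq> 0" by blast
  moreover have "z * b \<in> lspan A B" if "b \<in> B" for b
    using that B z is_subringD(4)[OF sR] by blast
  ultimately show ?thesis
    using integral_of_stable_span[OF A B(1)] unfolding integral_over_def by blast
qed

lemma lspan_mult_right:
  assumes "is_subring A" "x \<in> lspan A B" "\<And>b. b \<in> B \<Longrightarrow> b * y \<in> lspan A B'"
  shows "x * y \<in> lspan A B'"
proof -
  obtain c where c: "\<And>b. c b \<in> A" "x = (\<Sum>b\<in>B. c b * b)" using assms(2) by (auto simp: lspan_def)
  have "x * y = (\<Sum>b\<in>B. c b * (b * y))" by (simp add: c(2) sum_distrib_right mult.assoc)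
  then show ?thesis
    by (simp only:) (intro lspan_sum lspan_scale assms c)
qed

text \<open>Division by the monic \<open>p\<close> leaves the powers of \<open>z\<close> below
  \<open>degree p\<close> as generators of \<open>R[z]\<close> over \<open>R\<close>; their products
  with generators of \<open>R\<close> over \<open>A\<close> generate \<open>R[z]\<close> over
  \<open>A\<close>.\<close>

lemma finite_subring_adjoin:
  fixes z :: "'a::idom"
  assumes A: "is_subring A" and R: "finite_subring A R"
    and p: "p \<in> polys_over R" "lead_coeff p = 1" "poly p z = 0"
  shows "\<exists>R'. finite_subring A R' \<and> R \<subseteq> R' \<and> z \<in> R'"
proof -
  obtain B where B: "finite B" "B \<subseteq> R" "R \<subseteq> lspan A B" and sR: "is_subring R" and AR: "A \<subseteq> R"
    using R by (auto simp: finite_subring_def)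
  note P = is_subring_polys_over[OF sR]
  define R' where "R' = (\<lambda>q. poly q z) ` polys_over R"
  define B' where "B' = (\<lambda>(b, i). b * z ^ i) ` (B \<times> {..<degree p})"
  have RR': "R \<subseteq> R'"
  proof
    fix r assume "r \<in> R"
    then have "[:r:] \<in> polys_over R" using sR P by (simp add: polys_over_pCons is_subringD)
    then show "r \<in> R'" unfolding R'_def by (intro image_eqI[of _ _ "[:r:]"]) auto
  qed
  have zR': "z \<in> R'" unfolding R'_def
    by (intro image_eqI[of _ _ "[:0, 1:]"]) (use sR P in \<open>auto simp: polys_over_pCons is_subringD\<close>)
  have sR': "is_subring R'"
    unfolding is_subring_def
  proof (intro conjI ballI)
    show "0 \<in> R'" "1 \<in> R'" using RR' is_subringD[OF sR] by auto
  next
    fix x y assume "x \<in> R'" "y \<in> R'"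
    then obtain q r where q: "x = poly q z" "q \<in> polys_over R" and r: "y = poly r z" "r \<in> polys_over R"
      by (auto simp: R'_def)
    show "x + y \<in> R'" unfolding R'_def q r poly_add[symmetric]
      by (intro imageI is_subringD(3)[OF P] q r)
    show "x * y \<in> R'" unfolding R'_def q r poly_mult[symmetric]
      by (intro imageI is_subringD(4)[OF P] q r)
  next
    fix x assume "x \<in> R'"
    then obtain q where q: "x = poly q z" "q \<in> polys_over R" by (auto simp: R'_def)
    show "- x \<in> R'" unfolding R'_def q poly_minus[symmetric]
      by (intro imageI is_subringD(5)[OF P] q)
  qed
  have fB': "finite B'" unfolding B'_def using B by auto
  have "B' \<subseteq> R'" unfolding B'_def
    using B RR' zR' sR' by (auto intro!: is_subringD(4)[OF sR'] subring_power)
  moreover have "R' \<subseteq> lspan A B'"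
  proof
    fix x assume "x \<in> R'"
    then obtain q where q: "x = poly q z" "q \<in> polys_over R" by (auto simp: R'_def)
    have "p \<noteq> 0" using p by auto
    from pseudo_division[OF sR p(1) this q(2)] obtain u r where
      r: "r \<in> polys_over R" "q = p * u + r" "r = 0 \<or> degree r < degree p" using p(2) by auto
    have "x = poly r z" using q r p by simp
    also have "\<dots> = (\<Sum>i\<le>degree r. coeff r i * z ^ i)" by (rule poly_altdef)
    also have "\<dots> \<in> lspan A B'"
    proof (cases "r = 0")
      case False
      show ?thesis
      proof (rule lspan_sum[OF A], rule lspan_mult_right[OF A, of _ B])
        fix i b assume i: "i \<in> {..degree r}"
        show "coeff r i \<in> lspan A B" using r(1) B by (auto dest: coeff_polys_over)
        assume "b \<in> B"
        then show "b * z ^ i \<in> lspan A B'"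
          using i r(3) False fB' by (intro lspan_base[OF A]) (auto simp: B'_def)
      qed
    qed (simp add: lspan_0 A)
    finally show "x \<in> lspan A B'" .
  qed
  ultimately have "finite_subring A R'"
    using fB' sR' AR RR' unfolding finite_subring_def by blast
  then show ?thesis using RR' zR' by blast
qed

lemma integral_over_mono: "A \<subseteq> B \<Longrightarrow> integral_over A z \<Longrightarrow> integral_over B z"
  using polys_over_mono[of A B] unfolding integral_over_def by blast

lemma finite_subring_of_integral:
  fixes Z :: "'a::idom set"
  assumes A: "is_subring A" and Z: "finite Z" "\<And>z. z \<in> Z \<Longrightarrow> integral_over A z"
  shows "\<exists>R. finite_subring A R \<and> Z \<subseteq> R"
  using Z
proof (induction Z)
  case empty
  then show ?case using finite_subring_refl[OF A] by blast
next
  case (insert z Z)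
  then obtain R where R: "finite_subring A R" "Z \<subseteq> R" by auto
  have "integral_over R z"
    using insert.prems[of z] R(1) integral_over_mono[of A R z] by (auto simp: finite_subring_def)
  then obtain p where "p \<in> polys_over R" "lead_coeff p = 1" "poly p z = 0"
    by (auto simp: integral_over_def)
  from finite_subring_adjoin[OF A R(1) this] R(2) show ?case by blast
qed

text \<open>Any two integral elements share a module-finite subring, and all of its elements are
  integral.\<close>

lemma is_subring_integral:
  fixes A :: "'a::idom set"
  assumes A: "is_subring A"
  shows "is_subring {z. integral_over A z}"
proof -
  have *: "x + y \<in> {z. integral_over A z} \<and> x * y \<in> {z. integral_over A z} \<and> - x \<in> {z. integral_over A z}"
    if "integral_over A x" "integral_over A y" for x y
  proof -
    obtain R where R: "finite_subring A R" "{x, y} \<subseteq> R"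
      using finite_subring_of_integral[OF A, of "{x, y}"] \<open>integral_over A x\<close> \<open>integral_over A y\<close> by auto
    have "is_subring R" using R by (simp add: finite_subring_def)
    with R is_subringD[of R] finite_subring_integral[OF A R(1)] show ?thesis by auto
  qed
  moreover have "integral_over A a" if "a \<in> A" for a
    using finite_subring_integral[OF A finite_subring_refl[OF A]] that .
  ultimately show ?thesis
    unfolding is_subring_def using is_subringD(1,2)[OF A] by blast
qed

lemma base_integral: "is_subring A \<Longrightarrow> a \<in> A \<Longrightarrow> integral_over A a"
  using finite_subring_integral finite_subring_refl by blast

text \<open>The finitely many coefficients of \<open>p\<close> lie in one module-finite subring, to
  which \<open>z\<close> can then be adjoined.\<close>

lemma integral_trans:
  fixes A :: "'a::idom set"
  assumes A: "is_subring A" and p: "p \<in> polys_over {z. integral_over A z}" "lead_coeff p = 1" "poly p z = 0"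
  shows "integral_over A z"
proof -
  have "integral_over A c" if "c \<in> set (coeffs p)" for c
    using that p(1) by (auto simp: polys_over_def coeffs_def split: if_splits)
  then obtain R where R: "finite_subring A R" "set (coeffs p) \<subseteq> R"
    using finite_subring_of_integral[OF A, of "set (coeffs p)"] by blast
  have "is_subring R" using R by (simp add: finite_subring_def)
  have "coeff p i \<in> R" for i
    using R(2) coeff_in_coeffs[of p i] is_subringD(1)[OF \<open>is_subring R\<close>] le_degree[of p i]
    by (cases "coeff p i = 0"; cases "p = 0") auto
  then have "p \<in> polys_over R" by (simp add: polys_over_def)
  from finite_subring_adjoin[OF A R(1) this p(2,3)] obtain R' where "finite_subring A R'" "z \<in> R'" by blast
  then show ?thesis using finite_subring_integral[OF A] by blast
qed

lemma algebraic_int_iff_integral: "algebraic_int z \<longleftrightarrow> integral_over \<int> z"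
  by (auto simp: integral_over_def polys_over_def algebraic_int.simps)

lemma is_subring_algebraic_int: "is_subring {z :: 'a::field. algebraic_int z}"
  unfolding algebraic_int_iff_integral by (rule is_subring_integral[OF is_subring_Ints])

lemma algebraic_int_monic_root:
  fixes z :: "'a::field"
  assumes "\<And>i. algebraic_int (coeff p i)" "lead_coeff p = 1" "poly p z = 0"
  shows "algebraic_int z"
  using assms integral_trans[OF is_subring_Ints, of p z]
  unfolding algebraic_int_iff_integral by (auto simp: polys_over_def)

section \<open>Algebraic elements and simple extensions\<close>

definition alg_over :: "'a::field set \<Rightarrow> 'a \<Rightarrow> bool" where
  "alg_over k z \<longleftrightarrow> (\<exists>p\<in>polys_over k. p \<noteq> 0 \<and> poly p z = 0)"

lemma alg_over_iff_integral:
  assumes k: "is_subfield k"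
  shows "alg_over k z \<longleftrightarrow> integral_over k z"
proof
  assume "alg_over k z"
  then obtain p where p: "p \<in> polys_over k" "p \<noteq> 0" "poly p z = 0" by (auto simp: alg_over_def)
  have "smult (inverse (lead_coeff p)) p \<in> polys_over k"
    by (intro polys_over_smult subfield_imp_subring k is_subfieldD(6)[OF k] coeff_polys_over p)
  then show "integral_over k z" using p unfolding integral_over_def
    by (intro bexI[of _ "smult (inverse (lead_coeff p)) p"]) auto
next
  assume "integral_over k z"
  then obtain p where "p \<in> polys_over k" "lead_coeff p = 1" "poly p z = 0" by (auto simp: integral_over_def)
  moreover from this have "p \<noteq> 0" by auto
  ultimately show "alg_over k z" unfolding alg_over_def by blast
qed

text \<open>Once \<open>z\<close> is cancelled from a relation until the constant term
  \<open>a\<close> is nonzero, \<open>a + z * p(z) = 0\<close> exhibits the inverse as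
  \<open>- p(z) / a\<close>.\<close>

lemma inverse_polynomial_of_alg:
  fixes z :: "'a::field"
  assumes k: "is_subfield k" and "alg_over k z" "z \<noteq> 0"
  shows "\<exists>q\<in>polys_over k. inverse z = poly q z"
proof -
  note sk = subfield_imp_subring[OF k]
  obtain p where "p \<in> polys_over k" "p \<noteq> 0" "poly p z = 0" using assms by (auto simp: alg_over_def)
  then show ?thesis
  proof (induction p)
    case (pCons a p)
    show ?case
    proof (cases "a = 0")
      case True
      then show ?thesis using pCons \<open>z \<noteq> 0\<close> sk by (auto simp: polys_over_pCons)
    next
      case False
      have "a + z * poly p z = 0" using pCons.prems by simp
      then have "inverse z = poly (smult (- inverse a) p) z"
        using False \<open>z \<noteq> 0\<close> by (simp add: field_simps add_eq_0_iff)
      moreover have "smult (- inverse a) p \<in> polys_over k"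
        by (intro polys_over_smult sk is_subfieldD(5,6)[OF k])
           (use pCons.prems sk in \<open>auto simp: polys_over_pCons\<close>)
      ultimately show ?thesis by blast
    qed
  qed auto
qed

lemma is_subfield_alg:
  assumes k: "is_subfield k"
  shows "is_subfield {z. alg_over k z}"
proof -
  have s: "is_subring {z. alg_over k z}"
    unfolding alg_over_iff_integral[OF k] by (rule is_subring_integral[OF subfield_imp_subring[OF k]])
  have kz: "k \<subseteq> {z. alg_over k z}"
    unfolding alg_over_iff_integral[OF k] using base_integral[OF subfield_imp_subring[OF k]] by auto
  have "inverse z \<in> {z. alg_over k z}" if z: "alg_over k z" for z
  proof (cases "z = 0")
    case False
    then obtain q where q: "q \<in> polys_over k" "inverse z = poly q z"
      using inverse_polynomial_of_alg[OF k z] by blast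
    show ?thesis unfolding q(2)
      by (rule poly_in_subring[OF s]) (use q polys_over_mono[OF kz] z in auto)
  qed (use is_subringD(1)[OF s] in auto)
  then show ?thesis using s by (auto simp: is_subring_def is_subfield_def)
qed

lemma base_alg: "is_subfield k \<Longrightarrow> a \<in> k \<Longrightarrow> alg_over k a"
  by (simp add: alg_over_iff_integral base_integral subfield_imp_subring)

lemma alg_trans:
  assumes k: "is_subfield k" and "alg_over {z. alg_over k z} z"
  shows "alg_over k z"
proof -
  have "integral_over {z. alg_over k z} z"
    using assms alg_over_iff_integral[OF is_subfield_alg[OF k]] by blast
  then obtain p where "p \<in> polys_over {z. integral_over k z}" "lead_coeff p = 1" "poly p z = 0"
    unfolding alg_over_iff_integral[OF k] integral_over_def[of "{z. integral_over k z}"] by blast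
  then show ?thesis
    using integral_trans[OF subfield_imp_subring[OF k]] alg_over_iff_integral[OF k] by blast
qed

lemma alg_over_mono: "k \<subseteq> l \<Longrightarrow> alg_over k z \<Longrightarrow> alg_over l z"
  using polys_over_mono[of k l] unfolding alg_over_def by blast

section \<open>Simple extensions and linear dependence\<close>

definition adjoin :: "'a::field set \<Rightarrow> 'a \<Rightarrow> 'a set" where
  "adjoin k w = {poly p w / poly q w | p q. p \<in> polys_over k \<and> q \<in> polys_over k}"

lemma adjoinE:
  assumes "is_subring k" "z \<in> adjoin k w"
  obtains p q where "p \<in> polys_over k" "q \<in> polys_over k" "poly q w \<noteq> 0" "z = poly p w / poly q w"
proof -
  note P = is_subring_polys_over[OF assms(1)]
  obtain p q where "p \<in> polys_over k" "q \<in> polys_over k" "z = poly p w / poly q w"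
    using assms(2) by (auto simp: adjoin_def)
  \<comment> \<open>Division by zero gives 0, so a vanishing denominator only contributes the
    element 0 = 0 / 1.\<close>
  then show ?thesis using that[of p q] that[of 0 1] is_subringD(1,2)[OF P] by (cases "poly q w = 0") auto
qed

lemma adjoinI: "p \<in> polys_over k \<Longrightarrow> q \<in> polys_over k \<Longrightarrow> poly p w / poly q w \<in> adjoin k w"
  by (auto simp: adjoin_def)

lemma poly_in_adjoin: "is_subring k \<Longrightarrow> p \<in> polys_over k \<Longrightarrow> poly p w \<in> adjoin k w"
  using adjoinI[of p k 1 w] is_subring_polys_over[of k] by (auto simp: is_subringD)

lemma base_in_adjoin: "is_subring k \<Longrightarrow> a \<in> k \<Longrightarrow> a \<in> adjoin k w"
  using poly_in_adjoin[of k "[:a:]" w] is_subring_polys_over[of k] by (auto simp: polys_over_pCons is_subringD)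

lemma gen_in_adjoin: "is_subring k \<Longrightarrow> w \<in> adjoin k w"
  using poly_in_adjoin[of k "[:0,1:]" w] is_subring_polys_over[of k] by (auto simp: polys_over_pCons is_subringD)

lemma is_subfield_adjoin:
  assumes k: "is_subring k"
  shows "is_subfield (adjoin k w)"
  unfolding is_subfield_def
proof (intro conjI ballI)
  note P = is_subring_polys_over[OF k]
  show "0 \<in> adjoin k w" "1 \<in> adjoin k w" using k by (auto intro!: base_in_adjoin simp: is_subringD)
  fix x assume x: "x \<in> adjoin k w"
  obtain p q where x: "p \<in> polys_over k" "q \<in> polys_over k" "poly q w \<noteq> 0" "x = poly p w / poly q w"
    using adjoinE[OF k x] .
  show "- x \<in> adjoin k w"
    using adjoinI[of "- p" k q w] is_subringD(5)[OF P] x by simp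
  show "inverse x \<in> adjoin k w"
    using adjoinI[of q k p w] x by simp
  fix y assume y: "y \<in> adjoin k w"
  obtain p' q' where y: "p' \<in> polys_over k" "q' \<in> polys_over k" "poly q' w \<noteq> 0" "y = poly p' w / poly q' w"
    using adjoinE[OF k y] .
  have "x + y = poly (p * q' + p' * q) w / poly (q * q') w"
    unfolding x(4) y(4) poly_add poly_mult by (rule add_frac_eq[OF x(3) y(3)])
  then show "x + y \<in> adjoin k w"
    using adjoinI[of "p * q' + p' * q" k "q * q'" w] is_subringD(3,4)[OF P] x(1,2) y(1,2) by simp
  have "x * y = poly (p * p') w / poly (q * q') w"
    unfolding x(4) y(4) poly_mult by simp
  then show "x * y \<in> adjoin k w"
    using adjoinI[of "p * p'" k "q * q'" w] is_subringD(4)[OF P] x(1,2) y(1,2) by simp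
qed

lemma adjoin_subset:
  assumes "is_subfield E" "k \<subseteq> E" "w \<in> E"
  shows "adjoin k w \<subseteq> E"
proof -
  have "poly p w \<in> E" if "p \<in> polys_over k" for p
    using poly_in_subring[OF subfield_imp_subring[OF assms(1)]] polys_over_mono[OF assms(2)] assms(3) that by blast
  then show ?thesis using subfield_divide[OF assms(1)] by (auto simp: adjoin_def)
qed

text \<open>The inverse of the denominator \<open>q(w)\<close> is a polynomial in
  \<open>q(w)\<close>, hence in \<open>w\<close>; reduction modulo \<open>g\<close> then bounds the
  degree.\<close>

lemma adjoin_alg:
  assumes k: "is_subfield k" and g: "g \<in> polys_over k" "g \<noteq> 0" "poly g w = 0" and z: "z \<in> adjoin k w"
  shows "\<exists>p\<in>polys_over k. (p = 0 \<or> degree p < degree g) \<and> z = poly p w"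
proof -
  note sk = subfield_imp_subring[OF k]
  note P = is_subring_polys_over[OF sk]
  have al: "alg_over k w" using g by (auto simp: alg_over_def)
  obtain p q where pq: "p \<in> polys_over k" "q \<in> polys_over k" "poly q w \<noteq> 0" "z = poly p w / poly q w"
    using adjoinE[OF sk z] .
  have "alg_over k (poly q w)"
    using poly_in_subring[OF subfield_imp_subring[OF is_subfield_alg[OF k]], of q w] al pq
      polys_over_mono[of k "{z. alg_over k z}"] base_alg[OF k] by auto
  then obtain i where i: "i \<in> polys_over k" "inverse (poly q w) = poly i (poly q w)"
    using inverse_polynomial_of_alg[OF k _ pq(3)] by blast
  define h where "h = p * pcompose i q"
  have pc: "pcompose i q \<in> polys_over k"
  proof -
    \<comment> \<open>Composition is evaluation at \<open>q\<close> of \<open>i\<close> with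
      constant polynomials as coefficients, so closure of the ring \<open>polys_over k\<close> under
      evaluation applies.\<close>
    have "map_poly (\<lambda>c. [:c:]) i \<in> polys_over (polys_over k)"
      using i(1) P sk by (auto simp: polys_over_def coeff_map_poly is_subringD coeff_pCons split: nat.split)
    then have "poly (map_poly (\<lambda>c. [:c:]) i) q \<in> polys_over k"
      by (intro poly_in_subring P pq)
    then show ?thesis by (simp add: pcompose_altdef)
  qed
  have h: "h \<in> polys_over k" unfolding h_def by (intro is_subringD(4)[OF P] pq pc)
  have zh: "z = poly h w" using pq i by (simp add: h_def poly_pcompose divide_inverse)
  obtain e u r where r: "r \<in> polys_over k" "smult (lead_coeff g ^ e) h = g * u + r" "r = 0 \<or> degree r < degree g"
    using pseudo_division[OF sk g(1,2) h] by blast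
  have l: "lead_coeff g ^ e \<noteq> 0" "lead_coeff g ^ e \<in> k"
    using g sk by (auto intro!: subring_power coeff_polys_over)
  have "lead_coeff g ^ e * z = poly r w"
    unfolding zh poly_smult[symmetric] r(2) using g by simp
  then have "z = poly (smult (inverse (lead_coeff g ^ e)) r) w" using l by (simp add: field_simps)
  moreover have "smult (inverse (lead_coeff g ^ e)) r \<in> polys_over k"
    by (intro polys_over_smult sk is_subfieldD(6)[OF k] l r)
  ultimately show ?thesis using r(3) l by (intro bexI[of _ "smult (inverse (lead_coeff g ^ e)) r"]) auto
qed

lemma poly_in_lspan_powers:
  assumes k: "is_subring k" and p: "p \<in> polys_over k" "p = 0 \<or> degree p < d"
  shows "poly p w \<in> lspan k ((\<lambda>i. w ^ i) ` {..<d})"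
proof (cases "p = 0")
  case False
  show ?thesis unfolding poly_altdef
    using False p by (intro lspan_sum lspan_scale lspan_base k coeff_polys_over) auto
qed (simp add: lspan_0 k)

text \<open>Multiplication by \<open>z\<close> maps the span of the powers of \<open>w\<close> below
  \<open>degree g\<close> into itself, and the determinant trick bounds the degree by their number.
  The powers may be dependent: \<open>g\<close> is any annihilating polynomial.\<close>

lemma degree_bound_adjoin:
  assumes k: "is_subfield k" and g: "g \<in> polys_over k" "g \<noteq> 0" "poly g w = 0" and z: "z \<in> adjoin k w"
  shows "\<exists>p\<in>polys_over k. p \<noteq> 0 \<and> degree p \<le> degree g \<and> poly p z = 0"
proof -
  note sk = subfield_imp_subring[OF k]
  have d: "degree g > 0"
  proof (rule ccontr)
    assume "\<not> degree g > 0"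
    then obtain c where "g = [:c:]" by (metis degree_eq_zeroE gr0I)
    then show False using g by simp
  qed
  define B where "B = (\<lambda>i. w ^ i) ` {..<degree g}"
  have B: "finite B" "1 \<in> B" using d by (auto simp: B_def intro!: image_eqI[of _ _ 0])
  have "z * b \<in> lspan k B" if "b \<in> B" for b
  proof -
    have "b \<in> adjoin k w" using that is_subfield_adjoin[OF sk, of w] gen_in_adjoin[OF sk]
      by (auto simp: B_def intro!: subring_power subfield_imp_subring)
    then have "z * b \<in> adjoin k w" using z is_subfieldD(4)[OF is_subfield_adjoin[OF sk]] by blast
    from adjoin_alg[OF k g this] obtain p where "p \<in> polys_over k" "p = 0 \<or> degree p < degree g" "z * b = poly p w"
      by blast
    then show ?thesis unfolding B_def using poly_in_lspan_powers[OF sk, of p "degree g" w] by simp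
  qed
  from integral_of_stable_span[OF sk B _ this]
  obtain p where "p \<in> polys_over k" "degree p = card B" "lead_coeff p = 1" "poly p z = 0" by auto
  moreover have "card B \<le> degree g" unfolding B_def using card_image_le[of "{..<degree g}"] by auto
  ultimately show ?thesis by (intro bexI[of _ p]) auto
qed

text \<open>Elimination: a vector \<open>u m\<close> that involves the generator \<open>b\<close>
  clears \<open>b\<close> from the others, at the cost of one vector and one generator. Indexing by
  \<open>I\<close> lets equal vectors count as dependent.\<close>

lemma linear_dependence:
  fixes u :: "'i \<Rightarrow> 'a::field"
  assumes k: "is_subfield k" and "finite B" "finite I" "\<And>i. i \<in> I \<Longrightarrow> u i \<in> lspan k B" "card B < card I"
  shows "\<exists>c. (\<forall>i. c i \<in> k) \<and> (\<exists>i\<in>I. c i \<noteq> 0) \<and> (\<Sum>i\<in>I. c i * u i) = 0"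
  using assms(2-)
proof (induction B arbitrary: I u)
  case empty
  then have "I \<noteq> {}" by auto
  moreover have "u i = 0" if "i \<in> I" for i using empty(2)[OF that] by (auto simp: lspan_def)
  ultimately show ?case by (intro exI[of _ "\<lambda>_. 1"]) (auto simp: is_subfieldD[OF k])
next
  case (insert b B)
  note sk = subfield_imp_subring[OF k]
  have "\<forall>i\<in>I. \<exists>x r. x \<in> k \<and> r \<in> lspan k B \<and> u i = x * b + r"
  proof
    fix i assume "i \<in> I"
    then obtain c where c: "\<And>b. c b \<in> k" "u i = (\<Sum>b\<in>insert b B. c b * b)"
      using insert.prems(2) by (auto simp: lspan_def)
    then have "u i = c b * b + (\<Sum>b\<in>B. c b * b)" using insert.hyps by simp
    then show "\<exists>x r. x \<in> k \<and> r \<in> lspan k B \<and> u i = x * b + r" using c(1) by (auto simp: lspan_def)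
  qed
  then obtain x r where xr: "\<And>i. i \<in> I \<Longrightarrow> x i \<in> k" "\<And>i. i \<in> I \<Longrightarrow> r i \<in> lspan k B"
      "\<And>i. i \<in> I \<Longrightarrow> u i = x i * b + r i" by metis
  show ?case
  proof (cases "\<exists>m\<in>I. x m \<noteq> 0")
    case False
    then have "u i \<in> lspan k B" if "i \<in> I" for i using xr that by auto
    then show ?thesis using insert.IH[of I u] insert.prems insert.hyps by auto
  next
    case True
    then obtain m where m: "m \<in> I" "x m \<noteq> 0" by blast
    define u' where "u' i = u i - x i / x m * u m" for i
    have u': "u' i = r i + (- (x i / x m)) * r m" if "i \<in> I" for i
      using xr(3)[OF that] xr(3)[OF m(1)] m(2) unfolding u'_def by (simp add: field_simps)
    have "u' i \<in> lspan k B" if "i \<in> I - {m}" for i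
      using that u'[of i] m
      by (simp only: Diff_iff) (intro lspan_add lspan_scale sk is_subfieldD(5)[OF k] subfield_divide[OF k] xr; simp)
    moreover have "card B < card (I - {m})" using insert.prems insert.hyps m by simp
    ultimately obtain c where
      c: "\<And>i. c i \<in> k" "\<exists>i\<in>I-{m}. c i \<noteq> 0" "(\<Sum>i\<in>I-{m}. c i * u' i) = 0"
      using insert.IH[of "I - {m}" u'] insert.prems(1) by blast
    \<comment> \<open>The coefficient at \<open>m\<close> collects the multiples of
      \<open>u m\<close> that were subtracted in \<open>u'\<close>.\<close>
    define c' where "c' = c(m := - (\<Sum>i\<in>I-{m}. c i * (x i / x m)))"
    have "(\<Sum>i\<in>I. c' i * u i) = c' m * u m + (\<Sum>i\<in>I-{m}. c' i * u i)"
      using insert.prems(1) m(1) by (simp add: sum.remove)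
    also have "(\<Sum>i\<in>I-{m}. c' i * u i) = (\<Sum>i\<in>I-{m}. c i * u' i + c i * (x i / x m) * u m)"
      by (intro sum.cong) (auto simp: c'_def u'_def algebra_simps)
    also have "\<dots> = (\<Sum>i\<in>I-{m}. c i * (x i / x m)) * u m"
      unfolding sum.distrib c(3) by (simp add: sum_distrib_right)
    finally have "(\<Sum>i\<in>I. c' i * u i) = 0" by (simp add: c'_def)
    moreover have "c' i \<in> k" for i
      using c(1) xr(1) m by (auto simp: c'_def intro!: is_subfieldD(5)[OF k] subring_sum sk is_subfieldD(4)[OF k] subfield_divide[OF k])
    moreover have "\<exists>i\<in>I. c' i \<noteq> 0" using c(2) by (auto simp: c'_def)
    ultimately show ?thesis by blast
  qed
qed

text \<open>The powers of \<open>v\<close> below \<open>d\<close> are independent over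
  \<open>k\<close> and \<open>b\<close> lies outside their span, so \<open>adjoin k w\<close>, whose
  dimension is at most \<open>degree g\<close>, contains \<open>d + 1\<close> independent
  elements.\<close>

lemma degree_less_of_not_in_adjoin:
  assumes k: "is_subfield k" and g: "g \<in> polys_over k" "g \<noteq> 0" "poly g w = 0"
    and vb: "v \<in> adjoin k w" "b \<in> adjoin k w" "b \<notin> adjoin k v"
    and d: "\<And>p. p \<in> polys_over k \<Longrightarrow> p \<noteq> 0 \<Longrightarrow> degree p < d \<Longrightarrow> poly p v \<noteq> 0"
  shows "d < degree g"
proof (rule ccontr)
  assume nd: "\<not> d < degree g"
  note sk = subfield_imp_subring[OF k]
  define B where "B = (\<lambda>i. w ^ i) ` {..<degree g}"
  have B: "finite B" "card B \<le> degree g" using card_image_le[of "{..<degree g}"] by (auto simp: B_def)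
  define u where "u i = (if i = d then b else v ^ i)" for i
  have "u i \<in> lspan k B" if "i \<in> {..d}" for i
  proof -
    have "u i \<in> adjoin k w" using vb is_subfield_adjoin[OF sk, of w]
      by (auto simp: u_def intro!: subring_power subfield_imp_subring)
    from adjoin_alg[OF k g this] obtain p where "p \<in> polys_over k" "p = 0 \<or> degree p < degree g" "u i = poly p w"
      by blast
    then show ?thesis unfolding B_def using poly_in_lspan_powers[OF sk, of p "degree g" w] by simp
  qed
  moreover have "card B < card {..d}" using B nd by simp
  ultimately obtain c where
    c: "\<And>i. c i \<in> k" "\<exists>i\<in>{..d}. c i \<noteq> 0" "(\<Sum>i\<in>{..d}. c i * u i) = 0"
    using linear_dependence[OF k B(1), of "{..d}" u] by blast
  define p where "p = (\<Sum>i<d. monom (c i) i)"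
  have p: "p \<in> polys_over k" unfolding p_def
    by (intro subring_sum is_subring_polys_over sk polys_over_monom c)
  have cp: "coeff p i = (if i < d then c i else 0)" for i
    by (simp add: p_def coeff_sum)
  have pv: "poly p v = (\<Sum>i<d. c i * v ^ i)" by (simp add: p_def poly_sum poly_monom)
  have "(\<Sum>i\<in>{..d}. c i * u i) = c d * b + (\<Sum>i<d. c i * v ^ i)"
    by (simp add: lessThan_Suc_atMost[symmetric] u_def)
  then have rel: "c d * b + poly p v = 0" using c(3) pv by simp
  show False
  proof (cases "c d = 0")
    case True
    then have "p \<noteq> 0" using c(2) cp by (metis atMost_iff coeff_0 le_neq_implies_less)
    moreover then have "degree p < d"
      using cp by (metis leading_coeff_0_iff)
    ultimately show False using d[OF p] rel True by simp
  next
    case False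
    then have "b = poly (smult (- inverse (c d)) p) v" using rel
      by (simp add: field_simps add_eq_0_iff)
    moreover have "smult (- inverse (c d)) p \<in> polys_over k"
      by (intro polys_over_smult sk p is_subfieldD(5,6)[OF k] c)
    ultimately show False using vb(3) poly_in_adjoin[OF sk] by blast
  qed
qed

section \<open>Primitive elements\<close>

lemma poly_map_poly_const: "poly (map_poly (\<lambda>c. [:c:]) p) [:a:] = [:poly p a:]"
  by (induction p) (simp_all add: Polynomial.map_poly_pCons mult.commute)

lemma poly_poly_eval: "poly (poly H z) c = poly (map_poly (\<lambda>q. poly q c) H) (poly z c)"
  by (induction H) (simp_all add: Polynomial.map_poly_pCons)

text \<open>Chain rule for \<open>H(u, z(u))\<close>: the first summand differentiates the
  coefficients, the second the argument.\<close>

lemma pderiv_poly: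
  fixes H :: "'a::{comm_semiring_1,semiring_no_zero_divisors} poly poly"
  shows "pderiv (poly H z) = poly (map_poly pderiv H) z + poly (pderiv H) z * pderiv z"
  by (induction H) (simp_all add: Polynomial.map_poly_pCons pderiv_add pderiv_mult pderiv_pCons algebra_simps)

lemma map_poly_eval_over:
  assumes "is_subring k" "H \<in> polys_over (polys_over k)" "c \<in> k"
  shows "map_poly (\<lambda>q. poly q c) H \<in> polys_over k"
  using assms by (auto simp: polys_over_def[of k] coeff_map_poly intro!: poly_in_subring coeff_polys_over)

text \<open>
  With an indeterminate \<open>u\<close>, the element \<open>\<alpha> + u \<beta>\<close> is integral over \<open>k[u]\<close>. Differentiating
  a relation \<open>\<Phi>(u, \<alpha> + u \<beta>) = 0\<close> of minimal degree with respect to \<open>u\<close> expresses \<open>\<beta>\<close> rationally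
  in terms of \<open>\<alpha> + c \<beta>\<close> for almost all \<open>c\<close>.
\<close>

lemma primitive_element:
  fixes \<alpha> \<beta> :: "'a::field_char_0"
  assumes k: "is_subfield k" and al: "alg_over k \<alpha>" "alg_over k \<beta>"
  obtains c :: nat where "\<alpha> \<in> adjoin k (\<alpha> + of_nat c * \<beta>)" "\<beta> \<in> adjoin k (\<alpha> + of_nat c * \<beta>)"
proof -
  note sk = subfield_imp_subring[OF k]
  define A where "A = polys_over k"
  have A: "is_subring A" unfolding A_def by (rule is_subring_polys_over[OF sk])
  have I: "is_subring {z. integral_over A z}" by (rule is_subring_integral[OF A])
  have const: "integral_over A [:a:]" if "alg_over k a" for a
  proof -
    obtain p where p: "p \<in> polys_over k" "lead_coeff p = 1" "poly p a = 0"
      using \<open>alg_over k a\<close> unfolding alg_over_iff_integral[OF k] integral_over_def by blast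
    have "[:coeff p i:] \<in> A" for i
      unfolding A_def polys_over_pCons[OF sk]
      using p(1) is_subringD(1)[OF is_subring_polys_over[OF sk]] by (simp add: coeff_polys_over)
    then have "map_poly (\<lambda>c. [:c:]) p \<in> polys_over A"
      by (simp add: polys_over_def[of A] coeff_map_poly)
    moreover have "lead_coeff (map_poly (\<lambda>c. [:c:]) p) = 1"
      using p(2) by (subst lead_coeff_map_poly_nz) (auto simp: one_pCons)
    moreover have "poly (map_poly (\<lambda>c. [:c:]) p) [:a:] = 0"
      using p(3) by (simp add: poly_map_poly_const)
    ultimately show ?thesis unfolding integral_over_def by blast
  qed
  \<comment> \<open>The polynomial \<open>\<alpha> + u \<beta>\<close> in the indeterminate
    \<open>u\<close>; its derivative is \<beta>.\<close>
  define z where "z = [:\<alpha>, \<beta>:]"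
  have "[:0, 1:] \<in> A" unfolding A_def using sk is_subring_polys_over[OF sk]
    by (simp add: polys_over_pCons is_subringD)
  then have "[:\<alpha>:] + [:0, 1:] * [:\<beta>:] \<in> {z. integral_over A z}"
    using const[OF al(1)] const[OF al(2)] base_integral[OF A] by (intro is_subringD(3,4)[OF I]) auto
  then have "integral_over A z" by (simp add: z_def)
  then obtain \<Phi>0 where \<Phi>0: "\<Phi>0 \<in> polys_over A" "lead_coeff \<Phi>0 = 1" "poly \<Phi>0 z = 0"
    unfolding integral_over_def by blast
  define S where "S = {\<Phi> \<in> polys_over A. \<Phi> \<noteq> 0 \<and> poly \<Phi> z = 0}"
  have "\<Phi>0 \<in> S" using \<Phi>0 by (auto simp: S_def)
  then obtain \<Phi> where \<Phi>: "\<Phi> \<in> S" "\<And>\<Psi>. \<Psi> \<in> S \<Longrightarrow> degree \<Phi> \<le> degree \<Psi>"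
    using ex_has_least_nat[of "\<lambda>\<Phi>. \<Phi> \<in> S" \<Phi>0 degree] by blast
  have \<Phi>': "\<Phi> \<in> polys_over A" "\<Phi> \<noteq> 0" "poly \<Phi> z = 0" using \<Phi>(1) by (auto simp: S_def)
  have deg: "degree \<Phi> \<noteq> 0"
  proof
    assume "degree \<Phi> = 0"
    then obtain c where "\<Phi> = [:c:]" by (metis degree_eq_zeroE)
    then show False using \<Phi>' by simp
  qed
  have d\<Phi>: "pderiv \<Phi> \<in> polys_over A" by (intro polys_over_pderiv A \<Phi>')
  \<comment> \<open>In characteristic 0 the derivative is nonzero of smaller degree, so minimality
    of \<Phi> keeps it from vanishing at \<open>z\<close>.\<close>
  have "pderiv \<Phi> \<noteq> 0" using deg by (simp add: pderiv_eq_0_iff)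
  moreover have "degree (pderiv \<Phi>) < degree \<Phi>" using deg by (simp add: degree_pderiv)
  ultimately have P: "poly (pderiv \<Phi>) z \<noteq> 0" using \<Phi>(2)[of "pderiv \<Phi>"] d\<Phi> by (auto simp: S_def)
  have "finite {x. poly (poly (pderiv \<Phi>) z) x = 0}"
    using P by (simp add: poly_roots_finite)
  moreover have "infinite (range (of_nat :: nat \<Rightarrow> 'a))"
    by (intro range_inj_infinite) (simp add: inj_on_def)
  ultimately obtain c :: nat where c: "poly (poly (pderiv \<Phi>) z) (of_nat c) \<noteq> 0"
    by (metis (mono_tags, lifting) finite_subset mem_Collect_eq rangeE subsetI)
  define ev where "ev = (\<lambda>q. poly q (of_nat c :: 'a))"
  define w where "w = \<alpha> + of_nat c * \<beta>"
  have zw: "poly z (of_nat c) = w" by (simp add: z_def w_def)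
  have over: "map_poly ev H \<in> polys_over k" if "H \<in> polys_over A" for H
    unfolding ev_def using that by (intro map_poly_eval_over sk subring_of_nat) (simp add: A_def)
  have "0 = poly (pderiv (poly \<Phi> z)) (of_nat c)" using \<Phi>' by simp
  also have "\<dots> = poly (map_poly ev (map_poly pderiv \<Phi>)) w + poly (map_poly ev (pderiv \<Phi>)) w * \<beta>"
    unfolding pderiv_poly poly_add poly_mult poly_poly_eval zw ev_def[symmetric]
    by (simp add: z_def pderiv_pCons)
  finally have *: "poly (map_poly ev (pderiv \<Phi>)) w * \<beta> = - poly (map_poly ev (map_poly pderiv \<Phi>)) w"
    by (simp add: eq_neg_iff_add_eq_0 add.commute)
  have ne: "poly (map_poly ev (pderiv \<Phi>)) w \<noteq> 0"
    using c unfolding poly_poly_eval zw ev_def[symmetric] .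
  have o1: "map_poly pderiv \<Phi> \<in> polys_over A" using \<Phi>'(1) unfolding A_def
    by (auto simp: polys_over_def[of "polys_over k"] coeff_map_poly intro!: polys_over_pderiv sk)
  have F: "is_subfield (adjoin k w)" by (rule is_subfield_adjoin[OF sk])
  have "\<beta> = poly (- map_poly ev (map_poly pderiv \<Phi>)) w / poly (map_poly ev (pderiv \<Phi>)) w"
    using * ne by (simp add: field_simps)
  also have "\<dots> \<in> adjoin k w"
    by (intro adjoinI is_subringD(5)[OF is_subring_polys_over[OF sk]] over o1 d\<Phi>)
  finally have \<beta>: "\<beta> \<in> adjoin k w" .
  have "\<alpha> = w - of_nat c * \<beta>" by (simp add: w_def)
  also have "\<dots> \<in> adjoin k w"
    using \<beta> gen_in_adjoin[OF sk] subfield_imp_subring[OF F]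
    by (auto intro!: subring_diff is_subringD(4) subring_of_nat)
  finally show ?thesis using \<beta> that by (auto simp: w_def)
qed

text \<open>The generator is a combination of elements of \<open>Z\<close> with natural
  coefficients. The last conjunct records this; it later keeps the generator inside the internal
  field or among the Laurent series over \<open>K0\<close>.\<close>

lemma primitive_element_finite:
  fixes Z :: "'a::field_char_0 set"
  assumes k: "is_subfield k" and "finite Z" "\<And>z. z \<in> Z \<Longrightarrow> alg_over k z"
  shows "\<exists>w. alg_over k w \<and> Z \<subseteq> adjoin k w \<and> (\<forall>E. is_subring E \<and> Z \<subseteq> E \<longrightarrow> w \<in> E)"
  using assms(2,3)
proof (induction Z)
  case empty
  then show ?case using base_alg[OF k, of 0] is_subfieldD(1)[OF k] by (auto simp: is_subringD intro!: exI[of _ 0])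
next
  case (insert z Z)
  note sk = subfield_imp_subring[OF k]
  obtain w where w: "alg_over k w" "Z \<subseteq> adjoin k w" "\<And>E. is_subring E \<Longrightarrow> Z \<subseteq> E \<Longrightarrow> w \<in> E"
    using insert by auto
  have z: "alg_over k z" using insert by auto
  obtain c :: nat where c: "w \<in> adjoin k (w + of_nat c * z)" "z \<in> adjoin k (w + of_nat c * z)"
    using primitive_element[OF k w(1) z] .
  define w' where "w' = w + of_nat c * z"
  have F: "is_subfield (adjoin k w')" by (rule is_subfield_adjoin[OF sk])
  have "adjoin k w \<subseteq> adjoin k w'"
    by (intro adjoin_subset F) (use c base_in_adjoin[OF sk] in \<open>auto simp: w'_def\<close>)
  then have "insert z Z \<subseteq> adjoin k w'" using w(2) c(2) by (auto simp: w'_def)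
  moreover have "alg_over k w'"
  proof -
    note s = subfield_imp_subring[OF is_subfield_alg[OF k]]
    have "w' \<in> {z. alg_over k z}" unfolding w'_def
      using w(1) z by (intro is_subringD(3,4)[OF s] subring_of_nat[OF s]) auto
    then show ?thesis by simp
  qed
  moreover have "w' \<in> E" if "is_subring E" "insert z Z \<subseteq> E" for E
    unfolding w'_def using w(3)[of E] that by (auto intro!: is_subringD(3,4)[OF that(1)] subring_of_nat)
  ultimately show ?case by blast
qed

section \<open>Families of maps that are eventually homomorphisms\<close>

text \<open>Each identity holds eventually, though no single \<open>h n\<close> need be a
  homomorphism. This covers both choices of representatives in an ultrapower and specializations
  defined almost everywhere. The value at 0 is exact, because \<open>map_poly\<close> acts
  coefficientwise only for functions that fix 0.\<close>

definition eventually_hom :: "'n filter \<Rightarrow> 'a::comm_ring_1 set \<Rightarrow> ('n \<Rightarrow> 'a \<Rightarrow> 'b::comm_ring_1) \<Rightarrow> bool" where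
  "eventually_hom F K h \<longleftrightarrow> (\<forall>n. h n 0 = 0) \<and> (\<forall>\<^sub>F n in F. h n 1 = 1) \<and>
     (\<forall>a\<in>K. \<forall>b\<in>K. (\<forall>\<^sub>F n in F. h n (a + b) = h n a + h n b) \<and> (\<forall>\<^sub>F n in F. h n (a * b) = h n a * h n b))"

lemma eventually_homD:
  assumes "eventually_hom F K h"
  shows "h n 0 = 0" "\<forall>\<^sub>F n in F. h n 1 = 1"
    "a \<in> K \<Longrightarrow> b \<in> K \<Longrightarrow> \<forall>\<^sub>F n in F. h n (a + b) = h n a + h n b"
    "a \<in> K \<Longrightarrow> b \<in> K \<Longrightarrow> \<forall>\<^sub>F n in F. h n (a * b) = h n a * h n b"
  using assms unfolding eventually_hom_def by blast+

lemma eventually_hom_uminus: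
  assumes h: "eventually_hom F K h" and K: "is_subring K" and a: "a \<in> K"
  shows "\<forall>\<^sub>F n in F. h n (- a) = - h n a"
  using eventually_homD(3)[OF h a is_subringD(5)[OF K a]]
  by eventually_elim (use eventually_homD(1)[OF h] in \<open>simp add: eq_neg_iff_add_eq_0 add.commute\<close>)

lemma eventually_hom_nonzero:
  fixes h :: "'n \<Rightarrow> 'a::field \<Rightarrow> 'b::field"
  assumes h: "eventually_hom F K h" and K: "is_subfield K" and a: "a \<in> K" "a \<noteq> 0"
  shows "\<forall>\<^sub>F n in F. h n a \<noteq> 0"
  using eventually_homD(4)[OF h a(1) is_subfieldD(6)[OF K a(1)]] eventually_homD(2)[OF h]
  by eventually_elim (use a in auto)

lemma eventually_hom_inverse:
  fixes h :: "'n \<Rightarrow> 'a::field \<Rightarrow> 'b::field"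
  assumes h: "eventually_hom F K h" and K: "is_subfield K" and a: "a \<in> K"
  shows "\<forall>\<^sub>F n in F. h n (inverse a) = inverse (h n a)"
proof (cases "a = 0")
  case False
  from eventually_homD(4)[OF h a is_subfieldD(6)[OF K a]] eventually_homD(2)[OF h]
  show ?thesis
    by eventually_elim (metis False inverse_unique right_inverse)
qed (use eventually_homD(1)[OF h] in simp)

lemma eventually_hom_divide:
  fixes h :: "'n \<Rightarrow> 'a::field \<Rightarrow> 'b::field"
  assumes h: "eventually_hom F K h" and K: "is_subfield K" and a: "a \<in> K" "b \<in> K"
  shows "\<forall>\<^sub>F n in F. h n (a / b) = h n a / h n b"
  using eventually_homD(4)[OF h a(1) is_subfieldD(6)[OF K a(2)]] eventually_hom_inverse[OF h K a(2)]
  by eventually_elim (simp add: divide_inverse)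

lemma eventually_hom_of_nat:
  assumes h: "eventually_hom F K h" and K: "is_subring K"
  shows "\<forall>\<^sub>F n in F. h n (of_nat m) = of_nat m"
proof (induction m)
  case (Suc m)
  from eventually_homD(3)[OF h is_subringD(2)[OF K] subring_of_nat[OF K, of m]] eventually_homD(2)[OF h] Suc
  show ?case by eventually_elim simp
qed (use eventually_homD(1)[OF h] in simp)

lemma eventually_hom_of_int:
  assumes h: "eventually_hom F K h" and K: "is_subring K"
  shows "\<forall>\<^sub>F n in F. h n (of_int m) = of_int m"
proof (cases m rule: int_cases2)
  case (nonneg n)
  then show ?thesis using eventually_hom_of_nat[OF h K, of n] by simp
next
  case (nonpos m')
  from eventually_hom_of_nat[OF h K, of m'] eventually_hom_uminus[OF h K subring_of_nat[OF K, of m']]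
  show ?thesis by eventually_elim (simp add: nonpos)
qed

lemma eventually_hom_of_rat:
  fixes h :: "'n \<Rightarrow> 'a::field_char_0 \<Rightarrow> 'b::field_char_0"
  assumes h: "eventually_hom F K h" and K: "is_subfield K"
  shows "\<forall>\<^sub>F n in F. h n (of_rat q) = of_rat q"
proof (cases q)
  case (Fract a b)
  note sK = subfield_imp_subring[OF K]
  from eventually_hom_of_int[OF h sK, of a] eventually_hom_of_int[OF h sK, of b]
    eventually_hom_divide[OF h K subring_of_int[OF sK, of a] subring_of_int[OF sK, of b]]
  show ?thesis by eventually_elim (use Fract in \<open>simp add: of_rat_rat\<close>)
qed

lemma eventually_hom_poly:
  assumes h: "eventually_hom F K h" and K: "is_subring K" and p: "p \<in> polys_over K" and x: "x \<in> K"
  shows "\<forall>\<^sub>F n in F. h n (poly p x) = poly (map_poly (h n) p) (h n x)"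
  using p
proof (induction p)
  case 0
  then show ?case using eventually_homD(1)[OF h] by simp
next
  case (pCons a p)
  have *: "a \<in> K" "p \<in> polys_over K" using pCons.prems K by (auto simp: polys_over_pCons)
  have px: "poly p x \<in> K" by (intro poly_in_subring K * x)
  from eventually_homD(3)[OF h *(1) is_subringD(4)[OF K x px]] eventually_homD(4)[OF h x px] pCons.IH[OF *(2)]
  show ?case
    by eventually_elim (use eventually_homD(1)[OF h] in \<open>simp add: Polynomial.map_poly_pCons\<close>)
qed

text \<open>A polynomial has finitely many coefficients, so finitely many eventual identities in
  \<open>h\<close> suffice; iterating covers polynomials in two variables.\<close>

lemma eventually_hom_map_poly:
  assumes h: "eventually_hom F K h" and K: "is_subring K"
  shows "eventually_hom F (polys_over K) (\<lambda>n. map_poly (h n))"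
proof -
  note P = is_subring_polys_over[OF K]
  note h0 = eventually_homD(1)[OF h]
  have add: "\<forall>\<^sub>F n in F. map_poly (h n) (p + q) = map_poly (h n) p + map_poly (h n) q"
    if "p \<in> polys_over K" "q \<in> polys_over K" for p q
    using that
  proof (induction p q rule: poly_induct2)
    case (pCons a p b q)
    have *: "a \<in> K" "p \<in> polys_over K" "b \<in> K" "q \<in> polys_over K"
      using pCons.prems K by (auto simp: polys_over_pCons)
    from eventually_homD(3)[OF h *(1,3)] pCons.IH[OF *(2,4)]
    show ?case by eventually_elim (simp add: Polynomial.map_poly_pCons h0)
  qed simp
  have smult: "\<forall>\<^sub>F n in F. map_poly (h n) (smult a p) = smult (h n a) (map_poly (h n) p)"
    if "a \<in> K" "p \<in> polys_over K" for a p
    using that(2)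
  proof (induction p)
    case (pCons b p)
    have *: "b \<in> K" "p \<in> polys_over K" using pCons.prems K by (auto simp: polys_over_pCons)
    from eventually_homD(4)[OF h that(1) *(1)] pCons.IH[OF *(2)]
    show ?case by eventually_elim (simp add: Polynomial.map_poly_pCons h0)
  qed simp
  have mult: "\<forall>\<^sub>F n in F. map_poly (h n) (p * q) = map_poly (h n) p * map_poly (h n) q"
    if "p \<in> polys_over K" "q \<in> polys_over K" for p q
    using that(1)
  proof (induction p)
    case (pCons a p)
    have *: "a \<in> K" "p \<in> polys_over K" using pCons.prems K by (auto simp: polys_over_pCons)
    have pq: "pCons 0 (p * q) \<in> polys_over K"
      using is_subringD(4)[OF P *(2) that(2)] K by (simp add: polys_over_pCons is_subringD)
    from add[OF polys_over_smult[OF K *(1) that(2)] pq] smult[OF *(1) that(2)] pCons.IH[OF *(2)]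
    show ?case by eventually_elim (simp add: Polynomial.map_poly_pCons h0)
  qed simp
  have "\<forall>\<^sub>F n in F. map_poly (h n) 1 = 1"
    using eventually_homD(2)[OF h] by eventually_elim (simp add: one_pCons Polynomial.map_poly_pCons h0)
  then show ?thesis unfolding eventually_hom_def using add mult by auto
qed

text \<open>To know where elements of a generated field are sent, it is then enough to look at the
  generators.\<close>

lemma eventually_hom_preimage_subfield:
  fixes h :: "'n \<Rightarrow> 'a::field \<Rightarrow> 'b::field"
  assumes h: "eventually_hom F K h" and K: "is_subfield K" and E: "\<And>n. is_subfield (E n)"
  shows "is_subfield {a \<in> K. \<forall>\<^sub>F n in F. h n a \<in> E n}"
  unfolding is_subfield_def
proof (intro conjI ballI)
  let ?S = "{a \<in> K. \<forall>\<^sub>F n in F. h n a \<in> E n}"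
  show "0 \<in> ?S" using is_subfieldD(1)[OF K] is_subfieldD(1)[OF E] eventually_homD(1)[OF h] by simp
  have "\<forall>\<^sub>F n in F. h n 1 \<in> E n"
    using eventually_homD(2)[OF h] by eventually_elim (simp add: is_subfieldD(2)[OF E])
  then show "1 \<in> ?S" using is_subfieldD(2)[OF K] by simp
  fix x assume "x \<in> ?S"
  then have x: "x \<in> K" "\<forall>\<^sub>F n in F. h n x \<in> E n" by auto
  have "\<forall>\<^sub>F n in F. h n (- x) \<in> E n"
    using eventually_hom_uminus[OF h subfield_imp_subring[OF K] x(1)] x(2)
    by eventually_elim (simp add: is_subfieldD(5)[OF E])
  then show "- x \<in> ?S" using x is_subfieldD(5)[OF K] by simp
  have "\<forall>\<^sub>F n in F. h n (inverse x) \<in> E n"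
    using eventually_hom_inverse[OF h K x(1)] x(2)
    by eventually_elim (simp add: is_subfieldD(6)[OF E])
  then show "inverse x \<in> ?S" using x is_subfieldD(6)[OF K] by simp
  fix y assume "y \<in> ?S"
  then have y: "y \<in> K" "\<forall>\<^sub>F n in F. h n y \<in> E n" by auto
  have "\<forall>\<^sub>F n in F. h n (x + y) \<in> E n"
    using eventually_homD(3)[OF h x(1) y(1)] x(2) y(2)
    by eventually_elim (simp add: is_subfieldD(3)[OF E])
  then show "x + y \<in> ?S" using x y is_subfieldD(3)[OF K] by simp
  have "\<forall>\<^sub>F n in F. h n (x * y) \<in> E n"
    using eventually_homD(4)[OF h x(1) y(1)] x(2) y(2)
    by eventually_elim (simp add: is_subfieldD(4)[OF E])
  then show "x * y \<in> ?S" using x y is_subfieldD(4)[OF K] by simp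
qed

section \<open>Polynomials in two variables and minimal relations\<close>

definition bpoly :: "'a::comm_ring_1 poly poly \<Rightarrow> 'a \<Rightarrow> 'a \<Rightarrow> 'a" where
  "bpoly P x w = poly (poly P [:w:]) x"

lemma bpoly_simps [simp]:
  "bpoly 0 x w = 0" "bpoly 1 x w = 1" "bpoly (P + Q) x w = bpoly P x w + bpoly Q x w"
  "bpoly (P - Q) x w = bpoly P x w - bpoly Q x w" "bpoly (- P) x w = - bpoly P x w"
  "bpoly (P * Q) x w = bpoly P x w * bpoly Q x w" "bpoly (pCons q P) x w = poly q x + w * bpoly P x w"
  "bpoly (smult q P) x w = poly q x * bpoly P x w"
  by (simp_all add: bpoly_def)

lemma bpoly_altdef: "bpoly P x w = poly (map_poly (\<lambda>q. poly q x) P) w"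
  by (simp add: bpoly_def poly_poly_eval)

text \<open>A minimal polynomial of \<open>w\<close> over \<open>K(X)\<close> with denominators
  cleared: the inner variable stands for \<open>X\<close>, and the degree counts the outer one. It
  need not be monic, but its coefficients can be mapped by an eventual homomorphism.\<close>

definition min_rel :: "'a::field set \<Rightarrow> 'a \<Rightarrow> 'a \<Rightarrow> 'a poly poly \<Rightarrow> bool" where
  "min_rel K X w g \<longleftrightarrow> g \<in> polys_over (polys_over K) \<and> g \<noteq> 0 \<and> bpoly g X w = 0 \<and>
     (\<forall>H\<in>polys_over (polys_over K). H \<noteq> 0 \<longrightarrow> degree H < degree g \<longrightarrow> bpoly H X w \<noteq> 0)"

lemma clear_denominators:
  assumes K: "is_subring K" and p: "p \<in> polys_over (adjoin K X)"
  shows "\<exists>d\<in>polys_over K. \<exists>P\<in>polys_over (polys_over K). poly d X \<noteq> 0 \<and>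
    map_poly (\<lambda>q. poly q X) P = smult (poly d X) p"
  using p
proof (induction p)
  case 0
  show ?case using is_subringD(1,2)[OF is_subring_polys_over[OF K]]
    is_subringD(1)[OF is_subring_polys_over[OF is_subring_polys_over[OF K]]]
    by (intro bexI[of _ 1] bexI[of _ 0]) auto
next
  case (pCons a p)
  note P = is_subring_polys_over[OF K]
  have "a \<in> adjoin K X" "p \<in> polys_over (adjoin K X)"
    using pCons.prems subfield_imp_subring[OF is_subfield_adjoin[OF K]] by (auto simp: polys_over_pCons)
  from pCons.IH[OF this(2)] obtain d Q where
    d: "d \<in> polys_over K" "Q \<in> polys_over (polys_over K)" "poly d X \<noteq> 0"
       "map_poly (\<lambda>q. poly q X) Q = smult (poly d X) p" by blast
  obtain r s where a: "r \<in> polys_over K" "s \<in> polys_over K" "poly s X \<noteq> 0" "a = poly r X / poly s X"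
    using adjoinE[OF K \<open>a \<in> adjoin K X\<close>] .
  have "map_poly (\<lambda>q. poly q X) (smult s Q) = smult (poly s X) (map_poly (\<lambda>q. poly q X) Q)"
    by (intro poly_eqI) (simp add: coeff_map_poly)
  then have "map_poly (\<lambda>q. poly q X) (pCons (r * d) (smult s Q)) = smult (poly (d * s) X) (pCons a p)"
    using d a by (simp add: Polynomial.map_poly_pCons mult.commute)
  moreover have "pCons (r * d) (smult s Q) \<in> polys_over (polys_over K)"
    unfolding polys_over_pCons[OF P] by (intro conjI is_subringD(4)[OF P] polys_over_smult[OF P] a d)
  moreover have "d * s \<in> polys_over K" by (intro is_subringD(4)[OF P] a d)
  ultimately show ?case using a d by (intro bexI[of _ "d * s"] bexI) auto
qed

lemma min_rel_exists:
  assumes K: "is_subring K" and w: "alg_over (adjoin K X) w"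
  shows "\<exists>g. min_rel K X w g"
proof -
  obtain p where p: "p \<in> polys_over (adjoin K X)" "p \<noteq> 0" "poly p w = 0"
    using w by (auto simp: alg_over_def)
  obtain d P where d: "P \<in> polys_over (polys_over K)" "poly d X \<noteq> 0"
    "map_poly (\<lambda>q. poly q X) P = smult (poly d X) p" using clear_denominators[OF K p(1)] by blast
  define S where "S = {g \<in> polys_over (polys_over K). g \<noteq> 0 \<and> bpoly g X w = 0}"
  have "P \<in> S" using d p by (auto simp: S_def bpoly_altdef)
  then obtain g where "g \<in> S" "\<And>H. H \<in> S \<Longrightarrow> degree g \<le> degree H"
    using ex_has_least_nat[of "\<lambda>g. g \<in> S" P degree] by blast
  then show ?thesis unfolding min_rel_def S_def
    by (intro exI[of _ g]) (metis (mono_tags, lifting) leD mem_Collect_eq)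
qed

lemma map_poly_eval_nonzero:
  assumes X: "\<not> alg_over K X" and P: "P \<in> polys_over (polys_over K)" "P \<noteq> 0"
  shows "map_poly (\<lambda>q. poly q X) P \<noteq> 0"
proof -
  have "lead_coeff P \<in> polys_over K" "lead_coeff P \<noteq> 0" using P by (auto simp: coeff_polys_over)
  then have "poly (lead_coeff P) X \<noteq> 0" using X by (auto simp: alg_over_def)
  then have "coeff (map_poly (\<lambda>q. poly q X) P) (degree P) \<noteq> 0" by (simp add: coeff_map_poly)
  then show ?thesis by (metis coeff_0)
qed

lemma map_poly_eval_in_adjoin:
  assumes "is_subring K" "H \<in> polys_over (polys_over K)"
  shows "map_poly (\<lambda>q. poly q X) H \<in> polys_over (adjoin K X)"
proof -
  have "poly (coeff H i) X \<in> adjoin K X" for i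
    by (rule poly_in_adjoin[OF assms(1) coeff_polys_over[OF assms(2)]])
  then show ?thesis unfolding polys_over_def[of "adjoin K X"] by (simp add: coeff_map_poly)
qed

lemma min_rel_alg:
  assumes K: "is_subring K" and X: "\<not> alg_over K X" and g: "min_rel K X w g"
  shows "alg_over (adjoin K X) w"
  unfolding alg_over_def
proof (intro bexI conjI)
  show "map_poly (\<lambda>q. poly q X) g \<in> polys_over (adjoin K X)"
    using g map_poly_eval_in_adjoin[OF K] unfolding min_rel_def by blast
  show "map_poly (\<lambda>q. poly q X) g \<noteq> 0" using g map_poly_eval_nonzero[OF X] unfolding min_rel_def by blast
  show "poly (map_poly (\<lambda>q. poly q X) g) w = 0" using g by (simp add: min_rel_def bpoly_altdef)
qed

lemma min_rel_degree_pos: 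
  assumes X: "\<not> alg_over K X" and g: "min_rel K X w g"
  shows "degree g > 0"
proof (rule ccontr)
  assume "\<not> degree g > 0"
  then obtain c where c: "g = [:c:]" by (metis degree_eq_zeroE gr0I)
  have "c \<in> polys_over K" using g c coeff_polys_over[of g "polys_over K" 0] by (auto simp: min_rel_def)
  then show False using X g by (auto simp: alg_over_def min_rel_def c)
qed

text \<open>Separability: the derivative in the outer variable has smaller degree, so minimality
  forbids it to vanish at \<open>w\<close>. This provides the simple root that Hensel's lemma
  needs.\<close>

lemma min_rel_pderiv:
  fixes K :: "'a::field_char_0 set"
  assumes K: "is_subring K" and X: "\<not> alg_over K X" and g: "min_rel K X w g"
  shows "bpoly (pderiv g) X w \<noteq> 0"
proof -
  have "degree g > 0" by (rule min_rel_degree_pos[OF X g])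
  then have "pderiv g \<noteq> 0" "degree (pderiv g) < degree g" by (simp_all add: pderiv_eq_0_iff degree_pderiv)
  moreover have "pderiv g \<in> polys_over (polys_over K)"
    using g by (intro polys_over_pderiv is_subring_polys_over K) (simp add: min_rel_def)
  ultimately show ?thesis using g by (auto simp: min_rel_def)
qed

text \<open>
  A family of eventual homomorphisms extends to a simple algebraic extension of a simple
  transcendental one: \<open>X\<close> may go to anything eventually transcendental, \<open>w\<close> to a root of the
  image of its minimal relation.
\<close>

locale hom_extension =
  fixes F :: "'n filter" and K :: "'a::field_char_0 set" and h :: "'n \<Rightarrow> 'a \<Rightarrow> 'b::field"
    and X w :: 'a and g :: "'a poly poly" and X' w' :: "'n \<Rightarrow> 'b"
  assumes K: "is_subfield K" and h: "eventually_hom F K h" and X: "\<not> alg_over K X"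
    and g: "min_rel K X w g"
    and X': "\<And>p. p \<in> polys_over K \<Longrightarrow> p \<noteq> 0 \<Longrightarrow> \<forall>\<^sub>F n in F. poly (map_poly (h n) p) (X' n) \<noteq> 0"
    and w': "\<forall>\<^sub>F n in F. bpoly (map_poly (map_poly (h n)) g) (X' n) (w' n) = 0"
begin

lemmas K_subring = subfield_imp_subring[OF K]
lemmas KX_subring = is_subring_polys_over[OF K_subring]
lemmas KXW_subring = is_subring_polys_over[OF KX_subring]
lemmas hX = eventually_hom_map_poly[OF h K_subring]
lemmas hXW = eventually_hom_map_poly[OF hX KX_subring]

definition img :: "'n \<Rightarrow> 'a poly poly \<Rightarrow> 'b" where
  "img n P = bpoly (map_poly (map_poly (h n)) P) (X' n) (w' n)"

lemma img_const: "\<forall>\<^sub>F n in F. img n [:q:] = poly (map_poly (h n) q) (X' n)"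
  by (intro always_eventually allI)
     (simp add: img_def Polynomial.map_poly_pCons eventually_homD(1)[OF h])

lemma img_ring:
  assumes "P \<in> polys_over (polys_over K)" "Q \<in> polys_over (polys_over K)"
  shows "\<forall>\<^sub>F n in F. img n (P + Q) = img n P + img n Q"
    "\<forall>\<^sub>F n in F. img n (P * Q) = img n P * img n Q"
proof -
  from eventually_homD(3)[OF hXW assms] show "\<forall>\<^sub>F n in F. img n (P + Q) = img n P + img n Q"
    by eventually_elim (simp add: img_def)
  from eventually_homD(4)[OF hXW assms] show "\<forall>\<^sub>F n in F. img n (P * Q) = img n P * img n Q"
    by eventually_elim (simp add: img_def)
qed

text \<open>Pseudo-division by \<open>g\<close> leaves a remainder that vanishes at
  \<open>w\<close>, hence is zero: \<open>l * H = g * q\<close>. Eventually the image of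
  \<open>g\<close> vanishes and that of \<open>l\<close> does not.\<close>

lemma img_zero:
  assumes H: "H \<in> polys_over (polys_over K)" "bpoly H X w = 0"
  shows "\<forall>\<^sub>F n in F. img n H = 0"
proof -
  have g': "g \<in> polys_over (polys_over K)" "g \<noteq> 0" "bpoly g X w = 0" using g by (auto simp: min_rel_def)
  obtain e q r where r: "q \<in> polys_over (polys_over K)" "r \<in> polys_over (polys_over K)"
    "smult (lead_coeff g ^ e) H = g * q + r" "r = 0 \<or> degree r < degree g"
    using pseudo_division[OF KX_subring g'(1,2) H(1)] by blast
  define l where "l = lead_coeff g ^ e"
  have l: "l \<in> polys_over K" "l \<noteq> 0" unfolding l_def using g' by (auto intro!: subring_power KX_subring coeff_polys_over)
  have "bpoly (smult l H) X w = bpoly (g * q + r) X w" using r(3) by (simp add: l_def)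
  then have "bpoly r X w = 0" using H g' by simp
  then have "r = 0" using g r(2,4) by (auto simp: min_rel_def)
  then have eq: "[:l:] * H = g * q" using r(3) by (simp add: l_def)
  have L: "[:l:] \<in> polys_over (polys_over K)" using l is_subringD(1)[OF KXW_subring]
    by (simp add: polys_over_pCons KX_subring)
  from img_ring(2)[OF L H(1)] img_ring(2)[OF g'(1) r(1)] w' X'[OF l] img_const[of l]
  show ?thesis by eventually_elim (use eq in \<open>auto simp: img_def\<close>)
qed

lemma algw: "alg_over (adjoin K X) w"
  by (rule min_rel_alg[OF K_subring X g])

lemma bpoly_in_adjoin:
  assumes H: "H \<in> polys_over (polys_over K)"
  shows "bpoly H X w \<in> adjoin (adjoin K X) w"
  unfolding bpoly_altdef
  by (intro poly_in_adjoin subfield_imp_subring is_subfield_adjoin K_subring map_poly_eval_in_adjoin H)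

text \<open>The inverse of \<open>H(X, w)\<close> is a polynomial in \<open>w\<close> over
  \<open>K(X)\<close>, so some product \<open>H * P\<close> takes at \<open>(X, w)\<close> a nonzero
  value \<open>d(X)\<close> with \<open>d\<close> in \<open>K[X]\<close>, and the image of
  \<open>d\<close> is eventually nonzero.\<close>

lemma img_nonzero:
  assumes H: "H \<in> polys_over (polys_over K)" "bpoly H X w \<noteq> 0"
  shows "\<forall>\<^sub>F n in F. img n H \<noteq> 0"
proof -
  have KX: "is_subfield (adjoin K X)" by (rule is_subfield_adjoin[OF K_subring])
  have "inverse (bpoly H X w) \<in> adjoin (adjoin K X) w"
    using is_subfieldD(6)[OF is_subfield_adjoin[OF subfield_imp_subring[OF KX]]] bpoly_in_adjoin[OF H(1)] by blast
  then obtain p where p: "p \<in> polys_over (adjoin K X)" "inverse (bpoly H X w) = poly p w"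
    using adjoin_alg[OF KX] algw unfolding alg_over_def by blast
  obtain d P where d: "d \<in> polys_over K" "P \<in> polys_over (polys_over K)" "poly d X \<noteq> 0"
    "map_poly (\<lambda>q. poly q X) P = smult (poly d X) p" using clear_denominators[OF K_subring p(1)] by blast
  have "bpoly P X w = poly d X * inverse (bpoly H X w)" using d p by (simp add: bpoly_altdef)
  then have eq: "bpoly (H * P + [:-d:]) X w = 0" using H by simp
  have D: "[:-d:] \<in> polys_over (polys_over K)" using d is_subringD(1)[OF KXW_subring] is_subringD(5)[OF KX_subring]
    by (simp add: polys_over_pCons KX_subring)
  have HP: "H * P \<in> polys_over (polys_over K)" by (intro is_subringD(4)[OF KXW_subring] H d)
  have "-d \<in> polys_over K" "-d \<noteq> 0" using d is_subringD(5)[OF KX_subring] by auto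
  from img_zero[OF is_subringD(3)[OF KXW_subring HP D] eq] img_ring(1)[OF HP D] img_ring(2)[OF H(1) d(2)]
    img_const[of "-d"] X'[OF this]
  show ?thesis by eventually_elim auto
qed

lemma fraction_exists:
  assumes z: "z \<in> adjoin (adjoin K X) w"
  shows "\<exists>P\<in>polys_over (polys_over K). \<exists>Q\<in>polys_over (polys_over K).
    bpoly Q X w \<noteq> 0 \<and> z = bpoly P X w / bpoly Q X w"
proof -
  obtain p q where pq: "p \<in> polys_over (adjoin K X)" "q \<in> polys_over (adjoin K X)" "poly q w \<noteq> 0"
    "z = poly p w / poly q w" using adjoinE[OF subfield_imp_subring[OF is_subfield_adjoin[OF K_subring]] z] .
  obtain d P where d: "d \<in> polys_over K" "P \<in> polys_over (polys_over K)" "poly d X \<noteq> 0"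
    "map_poly (\<lambda>q. poly q X) P = smult (poly d X) p" using clear_denominators[OF K_subring pq(1)] by blast
  obtain e Q where e: "e \<in> polys_over K" "Q \<in> polys_over (polys_over K)" "poly e X \<noteq> 0"
    "map_poly (\<lambda>q. poly q X) Q = smult (poly e X) q" using clear_denominators[OF K_subring pq(2)] by blast
  have 1: "bpoly P X w = poly d X * poly p w" "bpoly Q X w = poly e X * poly q w"
    using d e by (auto simp: bpoly_altdef)
  show ?thesis
  proof (intro bexI conjI)
    show "bpoly (smult d Q) X w \<noteq> 0" using 1 d e pq by simp
    show "z = bpoly (smult e P) X w / bpoly (smult d Q) X w" using 1 d e pq by simp
    show "smult e P \<in> polys_over (polys_over K)" "smult d Q \<in> polys_over (polys_over K)"
      by (intro polys_over_smult KX_subring d e)+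
  qed
qed

text \<open>The last conjunct holds for every index, so it may be applied at an index that is chosen
  afterwards.\<close>

theorem extension:
  "\<exists>h'. eventually_hom F (adjoin (adjoin K X) w) h' \<and> (\<forall>a\<in>K. \<forall>\<^sub>F n in F. h' n a = h n a) \<and>
     (\<forall>\<^sub>F n in F. h' n X = X' n) \<and> (\<forall>\<^sub>F n in F. h' n w = w' n) \<and>
     (\<forall>n E. is_subfield E \<longrightarrow> h n ` K \<subseteq> E \<longrightarrow> X' n \<in> E \<longrightarrow> w' n \<in> E \<longrightarrow> h' n ` adjoin (adjoin K X) w \<subseteq> E)"
proof -
  let ?L = "adjoin (adjoin K X) w" and ?B = "polys_over (polys_over K)"
  obtain P Q where PQ: "\<And>z. z \<in> ?L \<Longrightarrow> P z \<in> ?B" "\<And>z. z \<in> ?L \<Longrightarrow> Q z \<in> ?B"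
    "\<And>z. z \<in> ?L \<Longrightarrow> bpoly (Q z) X w \<noteq> 0" "\<And>z. z \<in> ?L \<Longrightarrow> z = bpoly (P z) X w / bpoly (Q z) X w"
    using fraction_exists by metis
  \<comment> \<open>The case \<open>z = 0\<close> makes the value at 0 exact at every index, as
    \<open>eventually_hom\<close> demands.\<close>
  define h' where "h' n z = (if z = 0 then 0 else img n (P z) / img n (Q z))" for n z
  have L: "is_subfield ?L" by (intro is_subfield_adjoin subfield_imp_subring K_subring)
  \<comment> \<open>Eventually the value does not depend on the fraction representing
    \<open>z\<close>: cross-multiplication is a relation at \<open>(X, w)\<close>, which
    \<open>img_zero\<close> transports.\<close>
  have key: "\<forall>\<^sub>F n in F. h' n z = img n A / img n B"
    if z: "z = bpoly A X w / bpoly B X w" and AB: "A \<in> ?B" "B \<in> ?B" "bpoly B X w \<noteq> 0" for z A B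
  proof (cases "z = 0")
    case True
    then have "bpoly A X w = 0" using z AB by simp
    from img_zero[OF AB(1) this] show ?thesis by eventually_elim (simp add: h'_def True)
  next
    case False
    have zL: "z \<in> ?L" unfolding z by (intro subfield_divide L bpoly_in_adjoin AB)
    have A': "- A \<in> ?B" using AB is_subringD(5)[OF KXW_subring] by auto
    have m: "P z * B \<in> ?B" "(-A) * Q z \<in> ?B"
      by (intro is_subringD(4)[OF KXW_subring] PQ[OF zL] AB A')+
    have "bpoly (P z * B + (-A) * Q z) X w = 0"
    proof -
      have "bpoly (P z) X w / bpoly (Q z) X w = bpoly A X w / bpoly B X w"
        using z PQ(4)[OF zL] by metis
      then show ?thesis using frac_eq_eq[OF PQ(3)[OF zL] AB(3)] by simp
    qed
    from img_zero[OF is_subringD(3)[OF KXW_subring m] this] img_ring(1)[OF m]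
      img_ring(2)[OF PQ(1)[OF zL] AB(2)] img_ring(2)[OF A' PQ(2)[OF zL]]
      img_nonzero[OF PQ(2,3)[OF zL]] img_nonzero[OF AB(2,3)]
      img_ring(1)[OF AB(1) A']
    show ?thesis
    proof eventually_elim
      case (elim n)
      have "img n (A + - A) = 0" using eventually_homD(1)[OF hXW] by (simp add: img_def)
      then have "img n (- A) = - img n A" using elim(7)
        by (simp only: eq_neg_iff_add_eq_0 add.commute)
      then have "img n (P z) * img n B = img n A * img n (Q z)"
        using elim(1-4) by simp
      then show ?case using frac_eq_eq[OF elim(5,6)] False by (simp add: h'_def)
    qed
  qed
  have one: "1 \<in> ?B" using is_subringD(2)[OF KXW_subring] .
  have img1: "\<forall>\<^sub>F n in F. img n 1 = 1"
    using eventually_homD(2)[OF hXW] by eventually_elim (simp add: img_def)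
  have key1: "\<forall>\<^sub>F n in F. h' n (bpoly A X w) = img n A" if "A \<in> ?B" for A
    using key[of "bpoly A X w" A 1] that one img1 by (auto elim: eventually_elim2)
  have hom: "eventually_hom F ?L h'"
    unfolding eventually_hom_def
  proof (intro conjI ballI allI)
    show "h' n 0 = 0" for n by (simp add: h'_def)
    show "\<forall>\<^sub>F n in F. h' n 1 = 1" using key1[OF one] img1 by eventually_elim simp
    fix a b assume ab: "a \<in> ?L" "b \<in> ?L"
    note a = PQ[OF ab(1)] and b = PQ[OF ab(2)]
    have m: "P a * Q b \<in> ?B" "P b * Q a \<in> ?B" "Q a * Q b \<in> ?B" "P a * P b \<in> ?B"
      using a b is_subringD(4)[OF KXW_subring] by auto
    have s: "P a * Q b + P b * Q a \<in> ?B" using m is_subringD(3)[OF KXW_subring] by auto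
    have nz: "bpoly (Q a * Q b) X w \<noteq> 0" using a(3) b(3) by simp
    have "bpoly (P a * Q b + P b * Q a) X w / bpoly (Q a * Q b) X w
        = bpoly (P a) X w / bpoly (Q a) X w + bpoly (P b) X w / bpoly (Q b) X w"
      using a(3) b(3) by (simp add: add_frac_eq)
    then have "a + b = bpoly (P a * Q b + P b * Q a) X w / bpoly (Q a * Q b) X w"
      unfolding a(4)[symmetric] b(4)[symmetric] by (rule sym)
    from key[OF this s m(3) nz]
    have k: "\<forall>\<^sub>F n in F. h' n (a + b) = img n (P a * Q b + P b * Q a) / img n (Q a * Q b)" .
    have "bpoly (P a * P b) X w / bpoly (Q a * Q b) X w
        = bpoly (P a) X w / bpoly (Q a) X w * (bpoly (P b) X w / bpoly (Q b) X w)"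
      by simp
    then have "a * b = bpoly (P a * P b) X w / bpoly (Q a * Q b) X w"
      unfolding a(4)[symmetric] b(4)[symmetric] by (rule sym)
    from key[OF this m(4) m(3) nz]
    have k2: "\<forall>\<^sub>F n in F. h' n (a * b) = img n (P a * P b) / img n (Q a * Q b)" .
    note ka = key[OF a(4) a(1,2,3)] and kb = key[OF b(4) b(1,2,3)]
    note r = img_ring(2)[OF a(1) b(2)] img_ring(2)[OF b(1) a(2)] img_ring(2)[OF a(2) b(2)] img_ring(2)[OF a(1) b(1)]
      img_ring(1)[OF m(1,2)] img_nonzero[OF a(2,3)] img_nonzero[OF b(2,3)]
    from k ka kb r show "\<forall>\<^sub>F n in F. h' n (a + b) = h' n a + h' n b"
      by eventually_elim (simp add: add_frac_eq)
    from k2 ka kb r show "\<forall>\<^sub>F n in F. h' n (a * b) = h' n a * h' n b"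
      by eventually_elim simp
  qed
  moreover have "\<forall>\<^sub>F n in F. h' n a = h n a" if "a \<in> K" for a
  proof -
    have "[:[:a:]:] \<in> ?B"
      using that is_subringD(1)[OF KX_subring] is_subringD(1)[OF KXW_subring]
      by (simp add: polys_over_pCons KX_subring K_subring)
    from key1[OF this] img_const[of "[:a:]"] show ?thesis
      by eventually_elim (simp add: Polynomial.map_poly_pCons eventually_homD(1)[OF h])
  qed
  moreover have "\<forall>\<^sub>F n in F. h' n X = X' n"
  proof -
    have "[:[:0,1:]:] \<in> ?B"
      using is_subringD(1)[OF KX_subring] is_subringD(1)[OF KXW_subring] is_subringD(1,2)[OF K_subring]
      by (simp add: polys_over_pCons KX_subring K_subring)
    from key1[OF this] img_const[of "[:0,1:]"] eventually_homD(2)[OF h] show ?thesis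
      by eventually_elim (simp add: Polynomial.map_poly_pCons eventually_homD(1)[OF h])
  qed
  moreover have "\<forall>\<^sub>F n in F. h' n w = w' n"
  proof -
    have W: "[:0,1:] \<in> ?B"
      using is_subringD(1,2)[OF KX_subring] is_subringD(1)[OF KXW_subring]
      by (simp add: polys_over_pCons KX_subring K_subring)
    from key1[OF W] eventually_homD(2)[OF hX] show ?thesis
      by eventually_elim (simp add: img_def Polynomial.map_poly_pCons eventually_homD(1)[OF h])
  qed
  moreover have "h' n z \<in> E"
    if E: "is_subfield E" "h n ` K \<subseteq> E" "X' n \<in> E" "w' n \<in> E" and z: "z \<in> ?L" for n E z
  proof -
    note sE = subfield_imp_subring[OF E(1)]
    have "img n A \<in> E" if "A \<in> ?B" for A
    proof -
      have "map_poly (map_poly (h n)) A \<in> polys_over (polys_over E)"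
        using that E(2) is_subringD(1)[OF sE] eventually_homD(1)[OF h]
        by (auto simp: polys_over_def coeff_map_poly)
      then have "map_poly (\<lambda>q. poly q (X' n)) (map_poly (map_poly (h n)) A) \<in> polys_over E"
        by (intro map_poly_eval_over sE E)
      then show ?thesis unfolding img_def bpoly_altdef by (intro poly_in_subring sE E)
    qed
    then have "img n (P z) / img n (Q z) \<in> E" by (intro subfield_divide E(1)) (use PQ(1,2)[OF z] in auto)
    then show ?thesis using is_subringD(1)[OF sE] by (simp add: h'_def)
  qed
  ultimately show ?thesis by (intro exI[of _ h']) blast
qed

end

section \<open>Hilbert irreducibility at roots of primes\<close>

text \<open>Coefficients stay in \<open>rat\<close>, so that one polynomial can be evaluated both at
  complex numbers and at Laurent series.\<close>

definition rpoly :: "rat poly \<Rightarrow> 'a::field_char_0 \<Rightarrow> 'a" where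
  "rpoly B x = poly (map_poly of_rat B) x"

definition rbpoly :: "rat poly poly \<Rightarrow> 'a::field_char_0 \<Rightarrow> 'a \<Rightarrow> 'a" where
  "rbpoly G x w = poly (map_poly (\<lambda>B. rpoly B x) G) w"

lemma rpoly_pCons [simp]: "rpoly (pCons a B) x = of_rat a + x * rpoly B x"
  by (simp add: rpoly_def Polynomial.map_poly_pCons)

lemma rpoly_0 [simp]: "rpoly 0 x = 0" by (simp add: rpoly_def)

lemma rpoly_1 [simp]: "rpoly 1 x = 1" by (simp add: one_pCons)

lemma rpoly_add [simp]: "rpoly (A + B) x = rpoly A x + rpoly B x"
  by (induction A B rule: poly_induct2) (simp_all add: of_rat_add algebra_simps)

lemma rpoly_smult [simp]: "rpoly (smult c B) x = of_rat c * rpoly B x"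
  by (induction B) (simp_all add: of_rat_mult algebra_simps)

lemma rpoly_mult [simp]: "rpoly (A * B) x = rpoly A x * rpoly B x"
  by (induction A) (simp_all add: algebra_simps)

lemma rpoly_diff [simp]: "rpoly (A - B) x = rpoly A x - rpoly B x"
  using rpoly_add[of "A - B" B x] by simp

lemma rpoly_monom [simp]: "rpoly (monom c n) x = of_rat c * x ^ n"
  by (induction n) (simp_all add: monom_Suc monom_0)

lemma lead_coeff_map_rpoly:
  fixes x :: "'a::field_char_0"
  assumes "lead_coeff L = 1" shows "lead_coeff (map_poly (\<lambda>B. rpoly B x) L) = 1" "degree (map_poly (\<lambda>B. rpoly B x) L) = degree L"
proof -
  have "coeff (map_poly (\<lambda>B. rpoly B x) L) (degree L) = 1" using assms by (simp add: coeff_map_poly)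
  moreover have "degree (map_poly (\<lambda>B. rpoly B x) L) \<le> degree L" by (rule degree_map_poly_le)
  ultimately show "degree (map_poly (\<lambda>B. rpoly B x) L) = degree L" by (metis le_degree le_antisym zero_neq_one)
  with \<open>coeff (map_poly (\<lambda>B. rpoly B x) L) (degree L) = 1\<close> show "lead_coeff (map_poly (\<lambda>B. rpoly B x) L) = 1" by simp
qed

lemma rpoly_altdef: "rpoly B x = (\<Sum>i\<le>degree B. of_rat (coeff B i) * x ^ i)"
proof -
  have "rpoly (\<Sum>i\<le>n. monom (coeff B i) i) x = (\<Sum>i\<le>n. of_rat (coeff B i) * x ^ i)" for n
    by (induction n) simp_all
  then show ?thesis by (metis poly_as_sum_of_monoms)
qed

lemma comm_ring_hom_rpoly: "comm_ring_hom (\<lambda>B. rpoly B x)"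
  by unfold_locales simp_all

lemma map_poly_rpoly_ring:
  "map_poly (\<lambda>B. rpoly B x) (P * Q) = map_poly (\<lambda>B. rpoly B x) P * map_poly (\<lambda>B. rpoly B x) Q"
  "map_poly (\<lambda>B. rpoly B x) (P + Q) = map_poly (\<lambda>B. rpoly B x) P + map_poly (\<lambda>B. rpoly B x) Q"
  "map_poly (\<lambda>B. rpoly B x) (P - Q) = map_poly (\<lambda>B. rpoly B x) P - map_poly (\<lambda>B. rpoly B x) Q"
proof -
  interpret base: comm_ring_hom "\<lambda>B. rpoly B x" by (rule comm_ring_hom_rpoly)
  interpret map_poly_comm_ring_hom "\<lambda>B. rpoly B x" ..
  show "map_poly (\<lambda>B. rpoly B x) (P * Q) = map_poly (\<lambda>B. rpoly B x) P * map_poly (\<lambda>B. rpoly B x) Q"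
    by (rule hom_mult)
  show "map_poly (\<lambda>B. rpoly B x) (P + Q) = map_poly (\<lambda>B. rpoly B x) P + map_poly (\<lambda>B. rpoly B x) Q"
    by (rule hom_add)
  show "map_poly (\<lambda>B. rpoly B x) (P - Q) = map_poly (\<lambda>B. rpoly B x) P - map_poly (\<lambda>B. rpoly B x) Q"
    by (rule hom_minus)
qed

lemma map_poly_of_rat_over: "map_poly of_rat B \<in> polys_over (\<rat> :: 'a::field_char_0 set)"
  by (simp add: polys_over_def coeff_map_poly)

lemma rpoly_in_adjoin: "rpoly B x \<in> adjoin \<rat> x"
  unfolding rpoly_def
  by (intro poly_in_adjoin subfield_imp_subring is_subfield_Rats map_poly_of_rat_over)

lemma polys_over_Rats:
  assumes "p \<in> polys_over (\<rat> :: 'a::field_char_0 set)"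
  shows "\<exists>B. p = map_poly of_rat B \<and> degree B = degree p"
proof -
  have "\<forall>i. \<exists>r. coeff p i = of_rat r" using assms by (auto simp: polys_over_def elim: Rats_cases)
  then obtain r where r: "\<And>i. coeff p i = of_rat (r i)" by metis
  define B where "B = (\<Sum>i\<le>degree p. monom (r i) i)"
  have c: "coeff B i = (if i \<le> degree p then r i else 0)" for i by (simp add: B_def coeff_sum)
  have "r i = 0" if "\<not> i \<le> degree p" for i using r[of i] that by (simp add: coeff_eq_0)
  then have cB: "coeff B i = r i" for i using c by auto
  have "p = map_poly of_rat B" by (intro poly_eqI) (simp add: coeff_map_poly cB r)
  moreover from this have "degree B = degree p" by (simp add: degree_map_poly)
  ultimately show ?thesis by blast
qed

text \<open>For \<open>u = a / b\<close> in lowest terms \<open>b ^ N\<close> divides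
  \<open>p ^ i\<close>; a prime factor of \<open>b\<close> could only be \<open>p\<close>, and then
  \<open>p ^ N\<close> would divide \<open>p ^ i\<close> although \<open>i < N\<close>.\<close>

lemma rat_power_prime_int:
  fixes u :: rat
  assumes p: "prime p" and i: "i < N" and int: "u ^ N * of_nat p ^ i \<in> \<int>"
  shows "u \<in> \<int>"
proof (cases u)
  case (Fract a b)
  obtain m where m: "u ^ N * of_nat p ^ i = of_int m" using int by (auto elim: Ints_cases)
  have "u = of_int a / of_int b" using Fract by (simp add: Fract_of_int_quotient)
  then have "of_int a ^ N * of_nat p ^ i = of_int m * (of_int b :: rat) ^ N"
    using m Fract(2) by (simp only: power_divide) (simp add: field_simps)
  then have "a ^ N * int p ^ i = m * b ^ N"
    by (metis (mono_tags, lifting) of_int_eq_iff of_int_mult of_int_of_nat_eq of_int_power)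
  then have "b ^ N dvd a ^ N * int p ^ i" by simp
  moreover have "coprime (b ^ N) (a ^ N)" using Fract(3) by (simp add: coprime_commute)
  ultimately have dvd: "b ^ N dvd int p ^ i" by (simp add: coprime_dvd_mult_right_iff)
  have "is_unit b"
  proof (rule ccontr)
    assume "\<not> is_unit b"
    then obtain q where q: "prime q" "q dvd b" using Fract(2) prime_divisor_exists[of b] by auto
    have "b dvd b ^ N" using i by (intro dvd_power) auto
    then have "q dvd int p ^ i" using q dvd by (meson dvd_trans)
    then have "q dvd int p" using q prime_dvd_power by blast
    then have "q = int p" using q p by (simp add: primes_dvd_imp_eq)
    then have "int p ^ N dvd int p ^ i" using q(2) dvd by (meson dvd_power_same dvd_trans)
    then have "p ^ N dvd p ^ i" by (metis int_dvd_int_iff of_nat_power)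
    then have "N \<le> i" using power_dvd_imp_le prime_gt_1_nat[OF p] by blast
    then show False using i by simp
  qed
  then have "b = 1" using Fract(2) by simp
  then show ?thesis using Fract by (simp add: Fract_of_int_quotient)
qed

lemma common_denominator: "\<exists>d::int. d \<noteq> 0 \<and> (\<exists>Q::int poly. smult (of_int d) B = map_poly rat_of_int Q)"
proof (induction B)
  case 0
  show ?case by (intro exI[of _ 1] conjI exI[of _ 0]) auto
next
  case (pCons a B)
  then obtain d Q where dQ: "d \<noteq> 0" "smult (of_int d) B = map_poly rat_of_int Q" by blast
  obtain m n where mn: "a = Rat.Fract m n" "n > 0" by (cases a) auto
  have na: "of_int n * a = of_int m" using mn by (simp add: Fract_of_int_quotient)
  have "smult (of_int (d * n)) (pCons a B) = pCons (of_int d * (of_int n * a)) (smult (of_int n) (smult (of_int d) B))"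
    by (simp add: mult.commute mult.left_commute)
  also have "\<dots> = map_poly rat_of_int (pCons (d * m) (smult n Q))"
    unfolding na dQ by (simp add: Polynomial.map_poly_pCons) (intro poly_eqI, simp add: coeff_map_poly)
  finally show ?case using dQ mn by (intro exI[of _ "d * n"] conjI exI) auto
qed

locale prime_root =
  fixes p N :: nat and s :: complex
  assumes p: "prime p" and N: "N > 0" and s: "s = complex_of_real (root N (real p))"
begin

lemma s_power: "s ^ N = of_nat p"
  unfolding s of_real_power[symmetric] using N by (simp del: of_real_power)

lemma s_nz: "s \<noteq> 0" 
proof
  assume "s = 0"
  then show False using s_power p N by (simp add: power_0_left)
qed

lemma alg_int_root: "x ^ N = of_nat p \<Longrightarrow> algebraic_int (x :: complex)"
  using N by (intro algebraic_int_root[of "of_nat p" "monom 1 N" x])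
    (simp_all add: poly_monom degree_monom_eq int_imp_algebraic_int)

text \<open>Eisenstein's argument in the ring of algebraic integers: relative to the first
  coefficient of the primitive part that is prime to \<open>p\<close>, all other terms carry a
  higher power of \<open>s\<close>. So \<open>s\<close> divides this coefficient, and
  \<open>p\<close> divides its \<open>N\<close>th power.\<close>

lemma int_independent:
  fixes q :: "int poly"
  assumes q: "q \<noteq> 0" "degree q < N" shows "poly (map_poly of_int q) s \<noteq> 0"
proof
  assume z: "poly (map_poly of_int q) s = 0"
  define r where "r = primitive_part q"
  have q': "q = smult (content q) r" by (simp add: r_def)
  have "map_poly of_int q = smult (of_int (content q)) (map_poly complex_of_int r)"
    by (subst q') (intro poly_eqI, simp add: coeff_map_poly)
  moreover have "content q \<noteq> 0" using q by simp
  ultimately have zr: "poly (map_poly of_int r) s = 0" using z by simp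
  have dr: "degree r < N" using q by (simp add: r_def)
  have "content r = 1" using q by (simp add: r_def)
  moreover have "\<not> int p dvd 1" using prime_gt_1_nat[OF p] by auto
  ultimately have "\<not> [:int p:] dvd r" by (simp add: const_poly_dvd_iff_dvd_content)
  then have "\<exists>i. \<not> int p dvd coeff r i" by (simp only: const_poly_dvd_iff not_all)
  define i0 where "i0 = (LEAST i. \<not> int p dvd coeff r i)"
  have i0: "\<not> int p dvd coeff r i0" "\<And>i. i < i0 \<Longrightarrow> int p dvd coeff r i"
    using LeastI_ex[OF \<open>\<exists>i. \<not> int p dvd coeff r i\<close>] not_less_Least unfolding i0_def by blast+
  have "i0 \<le> degree r" using i0(1) by (metis coeff_eq_0 dvd_0_right not_le)
  have I: "is_subring {z::complex. algebraic_int z}" by (rule is_subring_algebraic_int)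
  have sI: "algebraic_int s" by (rule alg_int_root[OF s_power])
  \<comment> \<open>\<open>t i\<close> is the \<open>i\<close>th term divided by
    \<open>s ^ Suc i0\<close>. Below \<open>i0\<close> the factor \<open>p = s ^ N\<close> of the
    coefficient makes room for this; \<open>N - Suc i0\<close> is not truncated, since
    \<open>i0 < N\<close>.\<close>
  define t where "t i = (if i < i0 then of_int (coeff r i div int p) * s ^ (N - Suc i0 + i)
     else if i = i0 then 0 else of_int (coeff r i) * s ^ (i - Suc i0))" for i
  have tI: "algebraic_int (t i)" for i
  proof -
    note mult = is_subringD(4)[OF I] and pow = subring_power[OF I, of s]
    have "s \<in> {z. algebraic_int z}" using sI by simp
    then have "of_int a * s ^ n \<in> {z. algebraic_int z}" for a n
      by (intro mult subring_of_int[OF I] pow)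
    then have "t i \<in> {z. algebraic_int z}" unfolding t_def using is_subringD(1)[OF I] by simp
    then show ?thesis by simp
  qed
  have tm: "of_int (coeff r i) * s ^ i = (if i = i0 then of_int (coeff r i0) * s ^ i0 else 0) + s ^ Suc i0 * t i" for i
  proof (cases i i0 rule: linorder_cases)
    case less
    have "(of_int (coeff r i) :: complex) = of_int (coeff r i div int p) * of_nat p"
      using i0(2)[OF less] by (metis dvd_div_mult_self of_int_mult of_int_of_nat_eq)
    moreover have "(of_nat p :: complex) * s ^ i = s ^ Suc i0 * s ^ (N - Suc i0 + i)"
      using \<open>i0 \<le> degree r\<close> dr unfolding s_power[symmetric] power_add[symmetric] by simp
    ultimately have "of_int (coeff r i) * s ^ i
        = of_int (coeff r i div int p) * (s ^ Suc i0 * s ^ (N - Suc i0 + i))"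
      by (simp only: mult.assoc)
    then show ?thesis using less by (simp add: t_def mult_ac)
  next
    case greater
    then have "s ^ i = s ^ Suc i0 * s ^ (i - Suc i0)" by (simp flip: power_add del: power_Suc)
    then show ?thesis using greater by (simp add: t_def mult_ac del: power_Suc)
  qed (auto simp: t_def)
  have "poly (map_poly of_int r) s = (\<Sum>i\<le>degree r. of_int (coeff r i) * s ^ i)"
    unfolding poly_altdef by (simp add: degree_map_poly coeff_map_poly)
  then have "0 = (\<Sum>i\<le>degree r. of_int (coeff r i) * s ^ i)"
    using zr by simp
  also have "\<dots> = (\<Sum>i\<le>degree r. (if i = i0 then of_int (coeff r i0) * s ^ i0 else 0) + s ^ Suc i0 * t i)"
    by (intro sum.cong refl tm)
  also have "\<dots> = of_int (coeff r i0) * s ^ i0 + s ^ Suc i0 * (\<Sum>i\<le>degree r. t i)"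
    unfolding sum.distrib sum_distrib_left using \<open>i0 \<le> degree r\<close> by simp
  finally have "s ^ i0 * (of_int (coeff r i0) + s * (\<Sum>i\<le>degree r. t i)) = 0"
    by (simp add: algebra_simps)
  then have "of_int (coeff r i0) = - (s * (\<Sum>i\<le>degree r. t i))"
    using s_nz by (simp add: add_eq_0_iff2)
  \<comment> \<open>The \<open>N\<close>th power turns \<open>s\<close> into \<open>p\<close>, so
    the quotient by \<open>p\<close> is a rational algebraic integer, hence an integer.\<close>
  then have "(of_int (coeff r i0)) ^ N = of_nat p * (- (\<Sum>i\<le>degree r. t i)) ^ N"
    unfolding s_power[symmetric] power_mult_distrib[symmetric] by simp
  then have "(of_int (coeff r i0)) ^ N / of_nat p = (- (\<Sum>i\<le>degree r. t i)) ^ N"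
    using p by (simp add: field_simps)
  moreover have "(- (\<Sum>i\<le>degree r. t i)) ^ N \<in> {z. algebraic_int z}"
    by (intro subring_power I is_subringD(5)[OF I] subring_sum) (simp add: tI)
  ultimately have "algebraic_int ((of_int (coeff r i0)) ^ N / (of_nat p :: complex))" by simp
  moreover have "(of_int (coeff r i0)) ^ N / (of_nat p :: complex) \<in> \<rat>" by auto
  ultimately have "(of_int (coeff r i0)) ^ N / (of_nat p :: complex) \<in> \<int>" by (rule rational_algebraic_int_is_int)
  then obtain m where "(of_int (coeff r i0)) ^ N / (of_nat p :: complex) = of_int m" by (auto elim: Ints_cases)
  then have "of_int (coeff r i0) ^ N = (of_int m * of_nat p :: complex)" using p by (simp add: field_simps)
  then have "(of_int (coeff r i0 ^ N) :: complex) = of_int (m * int p)" by simp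
  then have "coeff r i0 ^ N = m * int p" by (metis of_int_eq_iff)
  then have "int p dvd coeff r i0 ^ N" by simp
  then have "int p dvd coeff r i0" using p prime_dvd_power[of "int p"] by simp
  then show False using i0(1) by simp
qed

lemma rat_independent:
  assumes "degree B < N" "rpoly B s = 0" shows "B = 0"
proof (rule ccontr)
  assume B: "B \<noteq> 0"
  obtain d Q where dQ: "d \<noteq> 0" "smult (of_int d) B = map_poly rat_of_int Q" using common_denominator by blast
  have "degree Q = degree B" using arg_cong[OF dQ(2), of degree] dQ(1) by (simp add: degree_map_poly)
  moreover have "Q \<noteq> 0" using dQ B by auto
  moreover have "map_poly of_rat (smult (of_int d) B) = map_poly complex_of_int Q"
    unfolding dQ(2) by (simp add: map_poly_map_poly o_def)
  then have "poly (map_poly complex_of_int Q) s = rpoly (smult (of_int d) B) s" by (simp add: rpoly_def)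
  then have "poly (map_poly complex_of_int Q) s = 0" using assms by simp
  ultimately show False using int_independent[of Q] assms by simp
qed

definition "xp = (monom 1 N - [:of_nat p:] :: rat poly)"

lemma xp: "degree xp = N" "rpoly xp x = x ^ N - of_nat p"
proof -
  have "degree (monom 1 N + - [:of_nat p:] :: rat poly) = degree (monom 1 N :: rat poly)"
    using N by (intro degree_add_eq_left) (simp add: degree_monom_eq)
  then show "degree xp = N" unfolding xp_def diff_conv_add_uminus by (simp only: degree_monom_eq[OF one_neq_zero])
qed (simp add: xp_def)

text \<open>By \<open>rat_independent\<close>, \<open>xp\<close> is a minimal polynomial of
  \<open>s\<close>, so it divides every rational polynomial with root \<open>s\<close>.\<close>

lemma conjugate_root:
  fixes x :: complex
  assumes "rpoly B s = 0" "x ^ N = of_nat p" shows "rpoly B x = 0"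
proof -
  have e: "B = xp * (B div xp) + B mod xp" by simp
  have ev: "rpoly B y = (y ^ N - of_nat p) * rpoly (B div xp) y + rpoly (B mod xp) y" for y :: complex
    by (subst e) (simp only: rpoly_add rpoly_mult xp)
  have "xp \<noteq> 0" using xp(1) N by auto
  then have "degree (B mod xp) < N" using degree_mod_less[of xp B] xp(1) N by auto
  moreover have "rpoly (B mod xp) s = 0" using ev[of s] assms s_power by simp
  ultimately have "B mod xp = 0" by (intro rat_independent)
  then show ?thesis using ev[of x] assms by simp
qed

lemma adjoin_rep:
  assumes "z \<in> adjoin \<rat> s"
  shows "\<exists>B. degree B < N \<and> z = rpoly B s"
proof -
  have "map_poly of_rat xp \<in> polys_over (\<rat>::complex set)" by (rule map_poly_of_rat_over)
  moreover have "degree (map_poly of_rat xp :: complex poly) = N" by (simp add: degree_map_poly xp)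
  moreover then have "map_poly of_rat xp \<noteq> (0 :: complex poly)" using N by auto
  moreover have "poly (map_poly of_rat xp) s = 0" using xp(2)[of s] s_power by (simp add: rpoly_def)
  ultimately obtain q where q: "q \<in> polys_over \<rat>" "q = 0 \<or> degree q < N" "z = poly q s"
    using adjoin_alg[OF is_subfield_Rats _ _ _ assms] by metis
  from polys_over_Rats[OF q(1)] obtain B where "q = map_poly of_rat B" "degree B = degree q" by blast
  then show ?thesis using q N by (intro exI[of _ B]) (auto simp: rpoly_def)
qed

text \<open>Discrete Fourier inversion over the conjugates \<open>\<zeta> ^ l * s\<close>; the
  exponent \<open>N - i\<close> stands for \<open>- i\<close>, as
  \<open>\<zeta> ^ N = 1\<close>.\<close>

lemma coeff_via_conjugates:
  assumes "degree B < N" "i < N"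
  defines "\<zeta> \<equiv> cis (2 * pi / N)"
  shows "of_nat N * of_rat (coeff B i) * s ^ i = (\<Sum>l<N. \<zeta> ^ (l * (N - i)) * rpoly B (\<zeta> ^ l * s))"
proof -
  have "\<zeta> ^ N = cis (real N * (2 * pi / N))" unfolding \<zeta>_def by (rule Complex.DeMoivre)
  then have z1: "\<zeta> ^ N = 1" using N by simp
  have orth: "(\<Sum>l<N. (\<zeta> ^ (N - i + j)) ^ l) = (if i = j then of_nat N else 0)" if "j < N" for j
  proof (cases "i = j")
    case True
    then show ?thesis using assms z1 by simp
  next
    case False
    have "\<zeta> ^ (N - i + j) \<noteq> 1"
    proof
      assume "\<zeta> ^ (N - i + j) = 1"
      then have "cis (real (N - i + j) * (2 * pi / N)) = 1" by (simp only: \<zeta>_def Complex.DeMoivre)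
      then obtain k :: int where "real (N - i + j) * (2 * pi / N) = 2 * pi * k"
        by (auto simp: complex_eq_iff cos_one_2pi_int)
      then have "real (N - i + j) * (2 * pi / N) * (N / (2 * pi)) = 2 * pi * k * (N / (2 * pi))" by simp
      then have "real (N - i + j) = real N * k" using N by simp
      then have "int (N - i + j) = int N * k" by (metis of_int_eq_iff of_int_mult of_int_of_nat_eq)
      then have "N dvd N - i + j" by (metis dvd_triv_left int_dvd_int_iff)
      then obtain m where m: "N - i + j = N * m" by blast
      \<comment> \<open>The exponent lies strictly between 0 and \<open>2 * N\<close>, so
        divisibility by \<open>N\<close> leaves only \<open>i = j\<close>.\<close>
      have "0 < N - i + j" "N - i + j < 2 * N" using assms that by auto
      then have "m \<noteq> 0" "m < 2" using m by (auto intro!: Nat.gr0I simp: mult.commute[of N])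
      then have "m = 1" by simp
      then show False using m False assms by auto
    qed
    then show ?thesis using False z1 sum_gp_strict[of "\<zeta> ^ (N - i + j)" N]
      by (simp flip: power_mult) (simp add: mult.commute power_mult)
  qed
  have B: "rpoly B x = (\<Sum>j<N. of_rat (coeff B j) * x ^ j)" for x :: complex
    unfolding rpoly_altdef using assms(1)
    by (intro sum.mono_neutral_left) (auto simp: coeff_eq_0)
  have "(\<Sum>l<N. \<zeta> ^ (l * (N - i)) * rpoly B (\<zeta> ^ l * s)) =
      (\<Sum>l<N. \<Sum>j<N. of_rat (coeff B j) * s ^ j * (\<zeta> ^ (N - i + j)) ^ l)"
    unfolding B sum_distrib_left
    by (intro sum.cong refl) (simp add: power_mult_distrib power_add power_mult[symmetric] mult.commute algebra_simps)
  also have "\<dots> = (\<Sum>j<N. of_rat (coeff B j) * s ^ j * (\<Sum>l<N. (\<zeta> ^ (N - i + j)) ^ l))"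
    by (subst sum.swap) (simp add: sum_distrib_left)
  also have "\<dots> = (\<Sum>j<N. if j = i then of_rat (coeff B j) * s ^ j * of_nat N else 0)"
    by (intro sum.cong refl) (auto simp: orth)
  also have "\<dots> = of_nat N * of_rat (coeff B i) * s ^ i"
    using assms(2) by (subst sum.delta) (auto simp: mult_ac)
  finally show ?thesis by simp
qed

end

lemma monic_roots_factorization:
  fixes A :: "complex poly"
  assumes "lead_coeff A = 1"
  shows "\<exists>as. A = (\<Prod>a\<leftarrow>as. [:- a, 1:]) \<and> length as = degree A \<and> (\<forall>a\<in>set as. poly A a = 0)"
proof -
  obtain as where as: "A = (\<Prod>a\<leftarrow>as. [:- a, 1:])" "length as = degree A"
    using fundamental_theorem_algebra_factorized[of A] assms by auto
  have "poly (\<Prod>a\<leftarrow>bs. [:- a, 1:]) a = 0" if "a \<in> set bs" for a :: complex and bs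
    using that by (induction bs) auto
  then have "poly A a = 0" if "a \<in> set as" for a using that as(1) by simp
  then show ?thesis using as by (intro exI[of _ as] conjI ballI)
qed

lemma monic_coeffs_in_subring:
  fixes A :: "complex poly"
  assumes S: "is_subring S" and A: "lead_coeff A = 1" and r: "\<And>w. poly A w = 0 \<Longrightarrow> w \<in> S"
  shows "A \<in> polys_over S"
proof -
  obtain as where as: "A = (\<Prod>a\<leftarrow>as. [:- a, 1:])" "length as = degree A" "\<forall>a\<in>set as. poly A a = 0"
    using monic_roots_factorization[OF A] by (elim exE conjE)
  have P: "is_subring (polys_over S)" by (rule is_subring_polys_over[OF S])
  have "set as \<subseteq> S" using as(3) r by blast
  then have "(\<Prod>a\<leftarrow>as. [:- a, 1:]) \<in> polys_over S"
  proof (induction as)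
    case (Cons a as)
    have "[:- a, 1:] \<in> polys_over S"
      using Cons.prems S is_subringD(1)[OF P] by (simp add: polys_over_pCons is_subringD)
    moreover have "(\<Prod>a\<leftarrow>as. [:- a, 1:]) \<in> polys_over S" using Cons by simp
    ultimately show ?case using is_subringD(4)[OF P] by (simp only: list.map prod_list.Cons)
  qed (use is_subringD(2)[OF P] in simp)
  then show ?thesis using as(1) by simp
qed

text \<open>Each factor with a root of norm at most \<open>R\<close> enlarges the bound on the
  coefficients by the factor \<open>1 + R\<close>.\<close>

lemma monic_coeffs_bound:
  fixes A :: "complex poly"
  assumes A: "lead_coeff A = 1" and r: "\<And>w. poly A w = 0 \<Longrightarrow> norm w \<le> R" and R: "R \<ge> 0"
  shows "norm (coeff A i) \<le> (1 + R) ^ degree A"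
proof -
  obtain as where as: "A = (\<Prod>a\<leftarrow>as. [:- a, 1:])" "length as = degree A" "\<forall>a\<in>set as. poly A a = 0"
    using monic_roots_factorization[OF A] by (elim exE conjE)
  have "\<forall>a\<in>set as. norm a \<le> R" using as(3) r by blast
  then have "norm (coeff (\<Prod>a\<leftarrow>as. [:- a, 1:]) i) \<le> (1 + R) ^ length as"
  proof (induction as arbitrary: i)
    case Nil
    then show ?case by (simp add: coeff_1)
  next
    case (Cons a as)
    let ?Q = "\<Prod>a\<leftarrow>as. [:- a, 1:]"
    have IH: "norm (coeff ?Q j) \<le> (1 + R) ^ length as" for j using Cons by auto
    have "coeff (\<Prod>a\<leftarrow>a # as. [:- a, 1:]) i = - a * coeff ?Q i + (case i of 0 \<Rightarrow> 0 | Suc j \<Rightarrow> coeff ?Q j)"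
      by (simp add: coeff_pCons)
    also have "norm \<dots> \<le> norm a * norm (coeff ?Q i) + norm (case i of 0 \<Rightarrow> 0 | Suc j \<Rightarrow> coeff ?Q j)"
      by (rule order_trans[OF norm_triangle_ineq]) (simp add: norm_mult)
    also have "norm a * norm (coeff ?Q i) \<le> R * (1 + R) ^ length as"
      using Cons.prems IH R by (intro mult_mono) auto
    also have "norm (case i of 0 \<Rightarrow> 0 | Suc j \<Rightarrow> coeff ?Q j) \<le> (1 + R) ^ length as"
      using IH R by (auto split: nat.split)
    finally show ?case by (simp add: algebra_simps)
  qed
  then show ?thesis using as by simp
qed

text \<open>Cauchy's bound, obtained outside the unit disc by dividing the equation by
  \<open>w ^ (d - 1)\<close>.\<close>

lemma monic_root_bound:
  fixes P :: "complex poly"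
  assumes P: "lead_coeff P = 1" and w: "poly P w = 0"
  shows "norm w \<le> 1 + (\<Sum>j<degree P. norm (coeff P j))"
proof (cases "norm w \<le> 1")
  case False
  define d where "d = degree P"
  have "d \<noteq> 0"
  proof
    assume "d = 0"
    then obtain c where "P = [:c:]" unfolding d_def by (metis degree_eq_zeroE)
    then show False using P w by simp
  qed
  then obtain e where e: "d = Suc e" by (cases d) auto
  have "w ^ d = - (\<Sum>j<d. coeff P j * w ^ j)"
    using w P unfolding poly_altdef d_def[symmetric]
    by (simp add: lessThan_Suc_atMost[symmetric] eq_neg_iff_add_eq_0 add.commute)
  then have "norm w ^ d = norm (\<Sum>j<d. coeff P j * w ^ j)" by (metis norm_minus_cancel norm_power)
  also have "\<dots> \<le> (\<Sum>j<d. norm (coeff P j) * norm w ^ e)"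
  proof (rule sum_norm_le)
    fix j assume "j \<in> {..<d}"
    then have "norm w ^ j \<le> norm w ^ e" using False e by (intro power_increasing) auto
    then show "norm (coeff P j * w ^ j) \<le> norm (coeff P j) * norm w ^ e"
      by (simp add: norm_mult norm_power mult_left_mono)
  qed
  also have "\<dots> = (\<Sum>j<d. norm (coeff P j)) * norm w ^ e" by (simp add: sum_distrib_right)
  finally have "norm w * norm w ^ e \<le> (\<Sum>j<d. norm (coeff P j)) * norm w ^ e" by (simp add: e)
  moreover have "norm w ^ e > 0" using False by (intro zero_less_power) auto
  ultimately have "norm w \<le> (\<Sum>j<d. norm (coeff P j))" by (simp add: mult_le_cancel_right)
  then show ?thesis by (simp add: d_def)
qed (use sum_nonneg[of "{..<degree P}" "\<lambda>j. norm (coeff P j)"] in auto)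

context prime_root
begin

abbreviation "ev x \<equiv> map_poly (\<lambda>B. rpoly B (x::complex))"

lemma lift_monic:
  assumes A: "A \<in> polys_over (adjoin \<rat> s)" "lead_coeff A = 1"
  shows "\<exists>L. lead_coeff L = 1 \<and> degree L = degree A \<and> (\<forall>j. degree (coeff L j) < N) \<and> ev s L = A"
proof -
  have "\<forall>j. \<exists>B. degree B < N \<and> coeff A j = rpoly B s"
    using A(1) adjoin_rep coeff_polys_over by blast
  then obtain f where f: "\<And>j. degree (f j) < N" "\<And>j. coeff A j = rpoly (f j) s" by metis
  define n where "n = degree A"
  \<comment> \<open>The leading coefficient must be 1 as a polynomial and everything above it 0, so
    that \<open>L\<close> is monic of degree \<open>n\<close>.\<close>
  define g where "g j = (if j < n then f j else if j = n then 1 else 0)" for j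
  define L where "L = (\<Sum>j\<le>n. monom (g j) j)"
  have cL: "coeff L j = g j" for j by (auto simp: L_def coeff_sum g_def)
  have "degree L \<le> n" by (intro degree_le) (simp add: cL g_def)
  moreover have "coeff L n = 1" by (simp add: cL g_def)
  ultimately have dL: "degree L = n" by (metis le_degree le_antisym zero_neq_one)
  have "rpoly (g j) s = coeff A j" for j
    using A(2) by (cases j n rule: linorder_cases) (auto simp: g_def f(2)[symmetric] n_def coeff_eq_0)
  then have "ev s L = A" by (intro poly_eqI) (simp add: coeff_map_poly cL)
  then show ?thesis using dL f(1) N by (intro exI[of _ L]) (auto simp: cL g_def n_def)
qed

lemma ev_conjugate:
  assumes "ev s D = 0" "x ^ N = of_nat p"
  shows "ev x D = 0"
proof (rule poly_eqI)
  fix j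
  have "rpoly (coeff D j) s = 0" using arg_cong[OF assms(1), of "\<lambda>P. coeff P j"] by (simp add: coeff_map_poly)
  then show "coeff (ev x D) j = coeff 0 j" using conjugate_root[OF _ assms(2)] by (simp add: coeff_map_poly)
qed

end

text \<open>
  A monic factor of \<open>G\<close> over \<open>\<rat>(s)\<close>, where \<open>s\<^sup>N = p\<close>, has coefficients \<open>\<Sum>i<N. u i * s ^ i\<close> with rational \<open>u i\<close>.
  Each of the \<open>N\<close> conjugates of such a coefficient is integral and of size \<open>O(\<bar>s\<bar>\<^sup>c)\<close> for some \<open>c\<close> depending
  only on \<open>G\<close>. Hence \<open>N * u i\<close> is an integer of size \<open>O(\<bar>s\<bar> powr (c - i))\<close>, which vanishes for \<open>i > c\<close>
  and large \<open>p\<close>. If \<open>N\<close> is large compared to \<open>c\<close>, a factorization with such coefficients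
  lifts to polynomials in an indeterminate \<open>s\<close>.
\<close>

theorem hilbert_irreducibility_root:
  fixes G :: "rat poly poly"
  assumes G: "lead_coeff G = 1" "G \<in> polys_over (polys_over \<int>)"
    and irr: "\<And>A A'. lead_coeff A = 1 \<Longrightarrow> lead_coeff A' = 1 \<Longrightarrow> G = A * A' \<Longrightarrow> degree A = 0 \<or> degree A' = 0"
  shows "\<exists>N0. \<forall>N\<ge>N0. \<exists>P0. \<forall>p\<ge>P0. prime p \<longrightarrow>
     (let s = complex_of_real (root N (real p)) in
      \<forall>w. rbpoly G s w = 0 \<longrightarrow> (\<forall>H\<in>polys_over (adjoin \<rat> s). H \<noteq> 0 \<longrightarrow> degree H < degree G \<longrightarrow> poly H w \<noteq> 0))"
proof -
  \<comment> \<open>\<open>c1\<close> bounds the degrees in \<open>s\<close> of the coefficients of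
    \<open>G\<close>, and \<open>C\<close> their size. At points of norm \<rho> the roots of
    \<open>G\<close> then have norm at most \<open>(1 + C) * \<rho> ^ c1\<close>, which gives
    \<open>K * \<rho> ^ c\<close> as a bound for the coefficients of a monic factor.\<close>
  define c1 where "c1 = (MAX j\<in>{..degree G}. degree (coeff G j))"
  have c1: "degree (coeff G j) \<le> c1" for j
  proof (cases "j \<le> degree G")
    case True
    then show ?thesis unfolding c1_def by (intro Max_ge) auto
  qed (simp add: coeff_eq_0)
  define C where "C = (\<Sum>j<degree G. \<Sum>i\<le>degree (coeff G j). norm (of_rat (coeff (coeff G j) i) :: complex))"
  have C0: "C \<ge> 0" unfolding C_def by (intro sum_nonneg) auto
  define c where "c = c1 * degree G"
  define K where "K = (2 + C) ^ degree G"
  have K0: "K > 0" using C0 by (simp add: K_def)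
  show ?thesis
  \<comment> \<open>Coefficients of \<open>L * M\<close> will have degree at most
    \<open>2 * c\<close>, those of \<open>G\<close> at most \<open>c1\<close>; so \<open>N\<close>
    exceeds the degrees occurring in \<open>G - L * M\<close>.\<close>
  proof (rule exI[of _ "Suc (2 * c + c1)"], intro allI impI)
    fix N assume Nl: "Suc (2 * c + c1) \<le> N"
    show "\<exists>P0. \<forall>p\<ge>P0. prime p \<longrightarrow>
     (let s = complex_of_real (root N (real p)) in
      \<forall>w. rbpoly G s w = 0 \<longrightarrow> (\<forall>H\<in>polys_over (adjoin \<rat> s). H \<noteq> 0 \<longrightarrow> degree H < degree G \<longrightarrow> poly H w \<noteq> 0))"
    proof -
      \<comment> \<open>The bound on \<open>p\<close> is chosen to make
        \<open>N * K < root N p\<close>.\<close>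
      have False if pl: "Suc (nat \<lceil>(N * K) ^ N\<rceil>) \<le> p" and p: "prime p"
        and w: "rbpoly G (complex_of_real (root N (real p))) w = 0"
        and H: "H \<in> polys_over (adjoin \<rat> (complex_of_real (root N (real p))))" "H \<noteq> 0" "degree H < degree G" "poly H w = 0"
        for p w H
      proof -
        define \<rho> where "\<rho> = root N (real p)"
        define s where "s = complex_of_real \<rho>"
        note w = w[folded \<rho>_def, folded s_def] and H = H[folded \<rho>_def, folded s_def]
        have Np: "N > 0" using Nl by simp
        interpret prime_root p N s by unfold_locales (use p Np in \<open>auto simp: s_def \<rho>_def\<close>)
        have "(N * K) ^ N < real p" using pl by linarith
        then have "root N ((N * K) ^ N) < \<rho>" unfolding \<rho>_def using Np by (intro real_root_less_mono)
        then have \<rho>NK: "N * K < \<rho>" using Np K0 by (simp add: real_root_power_cancel)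
        have \<rho>1: "\<rho> \<ge> 1" unfolding \<rho>_def using Np p prime_ge_1_nat[OF p] by simp
        define k where "k = adjoin \<rat> s"
        have k: "is_subfield k" unfolding k_def by (intro is_subfield_adjoin subfield_imp_subring is_subfield_Rats)
        note sk = subfield_imp_subring[OF k]
        note PK = is_subring_polys_over[OF sk]
        have evk: "ev s L \<in> polys_over k" for L
          by (simp add: k_def polys_over_def coeff_map_poly rpoly_in_adjoin)
        \<comment> \<open>A monic polynomial of least degree with root \<open>w\<close> divides
          \<open>ev s G\<close>; by the assumed \<open>H\<close> its degree is smaller than that of
          \<open>G\<close>.\<close>
        define S where "S = {A \<in> polys_over k. A \<noteq> 0 \<and> poly A w = 0}"
        have "H \<in> S" using H by (auto simp: S_def k_def)
        then obtain A0 where A0: "A0 \<in> S" "\<And>B. B \<in> S \<Longrightarrow> degree A0 \<le> degree B"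
          using ex_has_least_nat[of "\<lambda>A. A \<in> S" H degree] by blast
        define A where "A = smult (inverse (lead_coeff A0)) A0"
        have A: "A \<in> polys_over k" "lead_coeff A = 1" "poly A w = 0" "degree A = degree A0"
        proof -
          have a: "A0 \<in> polys_over k" "A0 \<noteq> 0" "poly A0 w = 0" using A0(1) by (simp_all add: S_def)
          show "A \<in> polys_over k" unfolding A_def
            by (intro polys_over_smult sk is_subfieldD(6)[OF k] coeff_polys_over a)
          show "lead_coeff A = 1" "poly A w = 0" "degree A = degree A0" using a by (simp_all add: A_def)
        qed
        have "A \<noteq> 0" using A by auto
        have dA: "degree A < degree G" using A0(2)[OF \<open>H \<in> S\<close>] A(4) H by simp
        have dA0: "degree A \<noteq> 0"
        proof
          assume "degree A = 0"
          then obtain c where "A = [:c:]" by (metis degree_eq_zeroE)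
          then show False using A by simp
        qed
        obtain e Q r where Q: "Q \<in> polys_over k" "r \<in> polys_over k" "ev s G = A * Q + r" "r = 0 \<or> degree r < degree A"
          using pseudo_division[OF sk A(1) \<open>A \<noteq> 0\<close> evk[of G]] A(2) by auto
        have "poly r w = 0" using arg_cong[OF Q(3), of "\<lambda>P. poly P w"] A(3) w by (simp add: rbpoly_def)
        then have "r = 0" using Q(2,4) A0(2)[of r] A(4) by (cases "r = 0") (simp_all add: S_def)
        then have GAQ: "ev s G = A * Q" using Q(3) by simp
        have Q1: "lead_coeff Q = 1" using lead_coeff_map_rpoly(1)[OF G(1), of s] A(2) unfolding GAQ lead_coeff_mult by simp
        then have "Q \<noteq> 0" by auto
        have "degree (ev s G) = degree G" by (rule lead_coeff_map_rpoly(2)[OF G(1)])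
        then have dQ: "degree A + degree Q = degree G" unfolding GAQ using \<open>A \<noteq> 0\<close> \<open>Q \<noteq> 0\<close> by (simp add: degree_mult_eq)
        obtain L where L: "lead_coeff L = 1" "degree L = degree A" "\<And>j. degree (coeff L j) < N" "ev s L = A"
          using lift_monic A(1,2) unfolding k_def by blast
        obtain M where M: "lead_coeff M = 1" "degree M = degree Q" "\<And>j. degree (coeff M j) < N" "ev s M = Q"
          using lift_monic Q(1) Q1 unfolding k_def by blast
        \<comment> \<open>A relation with rational coefficients at \<open>s\<close> passes to every
          root of \<open>x ^ N = p\<close>. So the conjugates of the factors divide those of
          \<open>G\<close>, which makes their roots integral and bounded.\<close>
        have "ev s (G - L * M) = 0" by (simp add: map_poly_rpoly_ring GAQ L M)
        then have conj: "ev x G = ev x L * ev x M" if "x ^ N = of_nat p" for x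
          using ev_conjugate[of "G - L * M" x] that by (simp add: map_poly_rpoly_ring)
        have small: "degree (coeff T j) \<le> c"
          if T: "lead_coeff T = 1" "degree T \<le> degree G" "\<And>j. degree (coeff T j) < N"
            and dvd: "\<And>x w. x ^ N = of_nat p \<Longrightarrow> poly (ev x T) w = 0 \<Longrightarrow> poly (ev x G) w = 0" for T j
        proof (rule degree_le, intro allI impI)
          fix i assume i: "c < i"
          show "coeff (coeff T j) i = 0"
          proof (cases "i < N")
            case False
            then show ?thesis using T(3)[of j] by (simp add: coeff_eq_0)
          next
            case True
            define B where "B = coeff T j"
            define \<zeta> where "\<zeta> = cis (2 * pi / N)"
            have "\<zeta> ^ N = cis (real N * (2 * pi / N))" unfolding \<zeta>_def by (rule Complex.DeMoivre)
            then have z1: "\<zeta> ^ N = 1" using Np by simp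
            have xN: "(\<zeta> ^ l * s) ^ N = of_nat p" for l
            proof -
              have "(\<zeta> ^ l) ^ N = (\<zeta> ^ N) ^ l" by (simp only: power_mult[symmetric] mult.commute)
              then show ?thesis by (simp add: power_mult_distrib s_power z1)
            qed
            have nx: "norm (\<zeta> ^ l * s) = \<rho>" for l
              using \<rho>1 by (simp add: \<zeta>_def norm_mult norm_power s_def)
            have I: "is_subring {z::complex. algebraic_int z}" by (rule is_subring_algebraic_int)
            have rI: "algebraic_int (rpoly B' x)" if "B' \<in> polys_over \<int>" "algebraic_int x" for B' and x :: complex
            proof -
              have "of_rat (coeff B' i) \<in> {z::complex. algebraic_int z}" for i
                using coeff_polys_over[OF that(1), of i] by (auto elim!: Ints_cases)
              then have "map_poly of_rat B' \<in> polys_over {z::complex. algebraic_int z}"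
                by (simp add: polys_over_def coeff_map_poly)
              then show ?thesis unfolding rpoly_def using poly_in_subring[OF I] that(2) by blast
            qed
            have rootI: "algebraic_int v" if x: "x ^ N = of_nat p" and v: "poly (ev x G) v = 0" for x v
            proof (rule algebraic_int_monic_root)
              show "algebraic_int (coeff (ev x G) i)" for i
                using rI[OF coeff_polys_over[OF G(2)] alg_int_root[OF x]] by (simp add: coeff_map_poly)
            qed (use lead_coeff_map_rpoly(1)[OF G(1)] v in auto)
            have rootR: "norm v \<le> (1 + C) * \<rho> ^ c1" if x: "norm x = \<rho>" and v: "poly (ev x G) v = 0" for x v
            proof -
              have "norm v \<le> 1 + (\<Sum>j<degree G. norm (rpoly (coeff G j) x))"
                using monic_root_bound[OF lead_coeff_map_rpoly(1)[OF G(1)] v] lead_coeff_map_rpoly(2)[OF G(1), of x] by (simp add: coeff_map_poly)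
              also have "(\<Sum>j<degree G. norm (rpoly (coeff G j) x)) \<le>
                  (\<Sum>j<degree G. \<Sum>i\<le>degree (coeff G j). norm (of_rat (coeff (coeff G j) i) :: complex) * \<rho> ^ c1)"
              proof (rule sum_mono)
                fix j
                show "norm (rpoly (coeff G j) x) \<le> (\<Sum>i\<le>degree (coeff G j). norm (of_rat (coeff (coeff G j) i) :: complex) * \<rho> ^ c1)"
                  unfolding rpoly_altdef
                proof (rule sum_norm_le)
                  fix i assume "i \<in> {..degree (coeff G j)}"
                  then have "\<rho> ^ i \<le> \<rho> ^ c1" using \<rho>1 c1[of j] by (intro power_increasing) auto
                  then show "norm (of_rat (coeff (coeff G j) i) * x ^ i) \<le> norm (of_rat (coeff (coeff G j) i) :: complex) * \<rho> ^ c1"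
                    unfolding norm_mult norm_power x by (intro mult_left_mono) auto
                qed
              qed
              also have "\<dots> = C * \<rho> ^ c1" by (simp add: C_def sum_distrib_right)
              also have "1 + C * \<rho> ^ c1 \<le> (1 + C) * \<rho> ^ c1" using one_le_power[OF \<rho>1, of c1] by (simp add: algebra_simps)
              finally show ?thesis by simp
            qed
            have TI: "algebraic_int (rpoly B (\<zeta> ^ l * s))" for l
            proof -
              have "ev (\<zeta> ^ l * s) T \<in> polys_over {z. algebraic_int z}"
                using rootI[OF xN] dvd[OF xN] by (intro monic_coeffs_in_subring I lead_coeff_map_rpoly(1)[OF T(1)]) auto
              from coeff_polys_over[OF this, of j] show ?thesis by (simp add: coeff_map_poly B_def)
            qed
            have TR: "norm (rpoly B (\<zeta> ^ l * s)) \<le> K * \<rho> ^ c" for l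
            proof -
              have "norm (coeff (ev (\<zeta> ^ l * s) T) j) \<le> (1 + (1 + C) * \<rho> ^ c1) ^ degree (ev (\<zeta> ^ l * s) T)"
                using rootR[OF nx] dvd[OF xN] C0 \<rho>1 by (intro monic_coeffs_bound lead_coeff_map_rpoly(1)[OF T(1)]) auto
              also have "\<dots> \<le> ((2 + C) * \<rho> ^ c1) ^ degree (ev (\<zeta> ^ l * s) T)"
                using one_le_power[OF \<rho>1, of c1] C0 by (intro power_mono) (auto simp: algebra_simps)
              also have "\<dots> \<le> ((2 + C) * \<rho> ^ c1) ^ degree G"
              proof (rule power_increasing)
                show "degree (ev (\<zeta> ^ l * s) T) \<le> degree G" using lead_coeff_map_rpoly(2)[OF T(1), of "\<zeta> ^ l * s"] T(2) by simp
                show "1 \<le> (2 + C) * \<rho> ^ c1" using mult_mono[of 1 "2 + C" 1 "\<rho> ^ c1"] one_le_power[OF \<rho>1, of c1] C0 by simp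
              qed
              also have "\<dots> = K * \<rho> ^ c" by (simp add: K_def c_def power_mult_distrib power_mult)
              finally show ?thesis by (simp add: coeff_map_poly B_def)
            qed
            \<comment> \<open>Multiplying by \<open>N\<close> clears the denominator in the Fourier
              formula: \<open>u * s ^ i\<close> is a sum of algebraic integers.\<close>
            define u where "u = of_nat N * coeff B i"
            have us: "of_rat u * s ^ i = (\<Sum>l<N. \<zeta> ^ (l * (N - i)) * rpoly B (\<zeta> ^ l * s))"
              using coeff_via_conjugates[of B i] T(3)[of j] True by (simp add: u_def B_def \<zeta>_def of_rat_mult)
            have "(\<Sum>l<N. \<zeta> ^ (l * (N - i)) * rpoly B (\<zeta> ^ l * s)) \<in> {z. algebraic_int z}"
            proof (intro subring_sum I is_subringD(4)[OF I] subring_power)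
              show "\<zeta> \<in> {z. algebraic_int z}"
                using z1 Np by (auto intro!: algebraic_int_root[of 1 "monom 1 N" \<zeta>] simp: poly_monom degree_monom_eq)
            qed (simp add: TI)
            then have "of_rat u * s ^ i \<in> {z. algebraic_int z}" using us by simp
            then have "(of_rat u * s ^ i) ^ N \<in> {z. algebraic_int z}" by (intro subring_power I)
            moreover have "(of_rat u * s ^ i) ^ N = of_rat (u ^ N * of_nat p ^ i)"
              by (simp add: power_mult_distrib of_rat_mult of_rat_power s_power[symmetric] power_mult[symmetric] mult.commute)
            ultimately have "algebraic_int (of_rat (u ^ N * of_nat p ^ i) :: complex)" by simp
            then have "of_rat (u ^ N * of_nat p ^ i) \<in> (\<int> :: complex set)"
              by (rule rational_algebraic_int_is_int) (rule Rats_of_rat)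
            then obtain m where "of_rat (u ^ N * of_nat p ^ i) = (of_int m :: complex)" by (elim Ints_cases)
            also have "\<dots> = of_rat (of_int m)" by simp
            finally have "u ^ N * of_nat p ^ i = of_int m" by (simp only: of_rat_eq_iff)
            then have "u ^ N * of_nat p ^ i \<in> \<int>" by simp
            then have uI: "u \<in> \<int>" using rat_power_prime_int[OF p True] by blast
            \<comment> \<open>As \<open>N * K < \<rho>\<close> and \<open>c < i\<close>, this size
              estimate forces the integer \<open>u\<close> to have absolute value below 1.\<close>
            have "norm (of_rat u :: complex) * \<rho> ^ i = norm (of_rat u * s ^ i)"
              using \<rho>1 by (simp add: norm_mult norm_power s_def)
            also have "\<dots> \<le> (\<Sum>l<N. K * \<rho> ^ c)"
              unfolding us using TR by (intro sum_norm_le) (simp add: norm_mult norm_power \<zeta>_def)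
            also have "\<dots> = N * K * \<rho> ^ c" by simp
            also have "\<dots> < \<rho> * \<rho> ^ c" using \<rho>NK \<rho>1 by (intro mult_strict_right_mono) auto
            also have "\<dots> \<le> \<rho> ^ i" using power_increasing[of "Suc c" i \<rho>] i \<rho>1 by simp
            finally have "norm (of_rat u :: complex) < 1" using \<rho>1 by (simp add: mult_less_cancel_right2)
            moreover obtain m where m: "u = of_int m" using uI by (elim Ints_cases)
            ultimately have "\<bar>real_of_int m\<bar> < 1" by (simp only: m of_rat_of_int_eq norm_of_int)
            then have "m = 0" by linarith
            then have "u = 0" using m by simp
            then show ?thesis using Np by (simp add: u_def B_def)
          qed
        qed
        have sL: "degree (coeff L j) \<le> c" for j
          by (rule small[OF L(1) _ L(3)]) (use L(2) dA in simp, use conj in simp)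
        have sM: "degree (coeff M j) \<le> c" for j
          by (rule small[OF M(1) _ M(3)]) (use M(2) dQ in simp, use conj in simp)
        \<comment> \<open>Degree below \<open>N\<close> and a zero at \<open>s\<close>: the
          factorization now holds identically and contradicts \<open>irr\<close>.\<close>
        have "coeff (G - L * M) j = 0" for j
        proof (rule rat_independent)
          have "degree (coeff (L * M) j) \<le> 2 * c"
            unfolding coeff_mult
          proof (rule degree_sum_le)
            fix i assume "i \<in> {..j}"
            have "degree (coeff L i * coeff M (j - i)) \<le> degree (coeff L i) + degree (coeff M (j - i))" by (rule degree_mult_le)
            also have "\<dots> \<le> 2 * c" using sL[of i] sM[of "j - i"] by simp
            finally show "degree (coeff L i * coeff M (j - i)) \<le> 2 * c" .
          qed simp
          then have "degree (coeff (G - L * M) j) \<le> 2 * c + c1"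
            using c1[of j] by (simp add: degree_diff_le)
          then show "degree (coeff (G - L * M) j) < N" using Nl by simp
          show "rpoly (coeff (G - L * M) j) s = 0"
            using arg_cong[OF \<open>ev s (G - L * M) = 0\<close>, of "\<lambda>P. coeff P j"] by (simp add: coeff_map_poly)
        qed
        then have "G = L * M" by (metis eq_iff_diff_eq_0 leading_coeff_0_iff)
        from irr[OF L(1) M(1) this] show False using L(2) M(2) dA0 dA dQ by simp
      qed
      then show ?thesis unfolding Let_def by blast
    qed
  qed
qed

section \<open>Power series solutions\<close>

lemma poly_taylor1: "\<exists>R. poly P (f + h) = poly P f + h * (R :: 'a::comm_ring_1)"
proof (induction P)
  case (pCons a P)
  then obtain R where R: "poly P (f + h) = poly P f + h * R" by blast
  have "poly (pCons a P) (f + h) = poly (pCons a P) f + h * (poly P f + (f + h) * R)"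
    by (simp add: R algebra_simps)
  then show ?case by blast
qed (auto intro: exI[of _ 0])

lemma poly_taylor2: "\<exists>R. poly P (f + h) = poly P f + h * poly (pderiv P) f + h ^ 2 * (R :: 'a::idom)"
proof (induction P)
  case (pCons a P)
  then obtain R where R: "poly P (f + h) = poly P f + h * poly (pderiv P) f + h ^ 2 * R" by blast
  have "poly (pCons a P) (f + h) = poly (pCons a P) f + h * poly (pderiv (pCons a P)) f
      + h ^ 2 * (poly (pderiv P) f + (f + h) * R)"
    by (simp add: R pderiv_pCons algebra_simps power2_eq_square)
  then show ?case by blast
qed (auto intro: exI[of _ 0])

lemma fps_poly_nth_0: "fps_nth (poly P f) 0 = poly (map_poly (\<lambda>q. fps_nth q 0) P) (fps_nth f 0)"
  by (induction P) (simp_all add: Polynomial.map_poly_pCons)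

lemma is_subring_fps: "is_subring K \<Longrightarrow> is_subring {f. \<forall>n. fps_nth f n \<in> K}"
  by (subst is_subring_def) (auto simp: is_subringD fps_mult_nth intro!: subring_sum)

text \<open>Coefficients are found one at a time: the derivative at \<open>w0\<close> has nonzero
  constant term \<open>d\<close>, by which the current error is divided. Only field operations on
  the data occur, so one root serves all subfields \<open>K\<close> containing them.\<close>

lemma fps_hensel:
  fixes P :: "'a::field fps poly"
  assumes z: "fps_nth (poly P (fps_const w0)) 0 = 0" and nz: "fps_nth (poly (pderiv P) (fps_const w0)) 0 \<noteq> 0"
  shows "\<exists>f. poly P f = 0 \<and> (\<forall>K. is_subfield K \<longrightarrow> w0 \<in> K \<longrightarrow>
    P \<in> polys_over {f. \<forall>n. fps_nth f n \<in> K} \<longrightarrow> (\<forall>n. fps_nth f n \<in> K))"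
proof -
  define d where "d = fps_nth (poly (pderiv P) (fps_const w0)) 0"
  define a where "a = rec_nat (fps_const w0)
    (\<lambda>n f. f + fps_const (- fps_nth (poly P f) (Suc n) / d) * fps_X ^ Suc n)"
  have a0: "a 0 = fps_const w0" by (simp add: a_def)
  have aS: "a (Suc n) = a n + fps_const (- fps_nth (poly P (a n)) (Suc n) / d) * fps_X ^ Suc n" for n
    by (simp add: a_def)
  have nthS: "fps_nth (a (Suc n)) i = (if i = Suc n then fps_nth (a n) i - fps_nth (poly P (a n)) (Suc n) / d
      else fps_nth (a n) i)" for n i
    unfolding aS by (auto simp: fps_X_power_mult_right_nth simp del: power_Suc)
  have an0: "fps_nth (a n) 0 = w0" for n
    by (induction n) (simp_all add: a0 nthS)
  have dn: "fps_nth (poly (pderiv P) (a n)) 0 = d" for n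
    by (simp add: d_def fps_poly_nth_0 an0)
  have inv: "\<forall>i\<le>n. fps_nth (poly P (a n)) i = 0" for n
  proof (induction n)
    case 0
    then show ?case using z by (simp add: a0)
  next
    case (Suc n)
    define c where "c = - fps_nth (poly P (a n)) (Suc n) / d"
    define h where "h = fps_const c * fps_X ^ Suc n"
    obtain R where R: "poly P (a n + h) = poly P (a n) + h * poly (pderiv P) (a n) + h ^ 2 * R"
      using poly_taylor2 by blast
    \<comment> \<open>The quadratic Taylor term starts at order \<open>2 * (n + 1)\<close> and
      cannot disturb the coefficient at \<open>n + 1\<close>.\<close>
    have h2: "h ^ 2 * R = fps_const (c ^ 2) * (R * fps_X ^ (Suc n + Suc n))"
      by (simp only: h_def power2_eq_square power_add fps_const_mult[symmetric] mult_ac)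
    have h1: "h * poly (pderiv P) (a n) = fps_const c * (poly (pderiv P) (a n) * fps_X ^ Suc n)"
      by (simp add: h_def mult_ac del: power_Suc)
    have aSn: "a (Suc n) = a n + h" unfolding aS h_def c_def ..
    have "fps_nth (poly P (a (Suc n))) i = fps_nth (poly P (a n)) i +
        (if i < Suc n then 0 else c * fps_nth (poly (pderiv P) (a n)) (i - Suc n)) +
        (if i < Suc n + Suc n then 0 else c ^ 2 * fps_nth R (i - (Suc n + Suc n)))" for i
      unfolding aSn R h1 h2 by (simp add: fps_X_power_mult_right_nth del: power_Suc)
    moreover have "c * d = - fps_nth (poly P (a n)) (Suc n)" using nz by (simp add: c_def d_def)
    ultimately show ?case using Suc dn by (auto simp: le_Suc_eq)
  qed
  define f where "f = Abs_fps (\<lambda>n. fps_nth (a n) n)"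
  have stable: "fps_nth (a (i + k)) i = fps_nth (a i) i" for i k
    by (induction k) (simp_all add: nthS)
  have agree: "fps_nth (a n) i = fps_nth f i" if "i \<le> n" for n i
    using stable[of i "n - i"] that by (simp add: f_def)
  \<comment> \<open>\<open>f\<close> agrees with \<open>a n\<close> up to order \<open>n\<close>,
    and so do the values of \<open>P\<close>.\<close>
  have "fps_nth (poly P f) n = 0" for n
  proof -
    obtain R where R: "poly P (a n + (f - a n)) = poly P (a n) + (f - a n) * R"
      using poly_taylor1 by blast
    have "fps_nth ((f - a n) * R) n = 0"
      unfolding fps_mult_nth by (intro sum.neutral) (simp add: agree)
    then show ?thesis using R inv[of n] by simp
  qed
  then have "poly P f = 0" by (intro fps_ext) simp
  moreover have "fps_nth f n \<in> K"
    if K: "is_subfield K" "w0 \<in> K" and P: "P \<in> polys_over {f. \<forall>n. fps_nth f n \<in> K}" for K n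
  proof -
    note sK = subfield_imp_subring[OF K(1)]
    note F = is_subring_fps[OF sK]
    have "\<forall>i. fps_nth (a n) i \<in> K" for n
    proof (induction n)
      case 0
      then show ?case using K is_subringD(1)[OF sK] by (simp add: a0)
    next
      case (Suc n)
      have pn: "fps_nth (poly P (a n)) i \<in> K" for i using poly_in_subring[OF F P, of "a n"] Suc by simp
      have "fps_nth (poly (pderiv P) (fps_const w0)) 0 \<in> K"
        using poly_in_subring[OF F polys_over_pderiv[OF F P], of "fps_const w0"] K(2) is_subringD(1)[OF sK] by simp
      then have "d \<in> K" by (simp add: d_def)
      then show ?case unfolding nthS using Suc pn
        by (auto intro!: subring_diff[OF sK] subfield_divide[OF K(1)])
    qed
    then show ?thesis by (simp add: f_def)
  qed
  ultimately show ?thesis by blast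
qed

section \<open>Laurent series over a subfield\<close>

definition laurent :: "'a::field set \<Rightarrow> 'a fls set" where
  "laurent K = {z. \<forall>n. fls_nth z n \<in> K}"

lemma is_subfield_laurent:
  fixes K :: "'a::field set"
  assumes K: "is_subfield K"
  shows "is_subfield (laurent K)"
  unfolding is_subfield_def
proof (intro conjI ballI)
  note sK = subfield_imp_subring[OF K]
  show "0 \<in> laurent K" "1 \<in> laurent K" using is_subringD(1,2)[OF sK] by (auto simp: laurent_def)
  fix x assume x: "x \<in> laurent K"
  then have xn: "fls_nth x n \<in> K" for n by (simp add: laurent_def)
  show "- x \<in> laurent K" using xn is_subringD(5)[OF sK] by (simp add: laurent_def)
  show "inverse x \<in> laurent K"
  proof (cases "x = 0")
    case False
    define m where "m = fls_subdegree x"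
    define u where "u = inverse x"
    have sd: "fls_subdegree u = - m" by (simp add: u_def m_def)
    have xm: "fls_nth x m \<noteq> 0" using False by (simp add: m_def)
    \<comment> \<open>Comparing coefficients in \<open>x * u = 1\<close> gives a recursion whose
      only division is by the leading coefficient of \<open>x\<close>.\<close>
    have "fls_nth u (- m + int j) \<in> K" for j
    proof (induction j rule: less_induct)
      case (less j)
      have "x * u = 1" using False by (simp add: u_def)
      then have "(if j = 0 then 1 else 0) = fls_nth (x * u) (int j)" by simp
      also have "\<dots> = (\<Sum>i=m..m + int j. fls_nth x i * fls_nth u (int j - i))"
        unfolding fls_times_nth(2) m_def[symmetric] sd by (simp add: add.commute)
      also have "\<dots> = fls_nth x m * fls_nth u (int j - m) + (\<Sum>i\<in>{m..m + int j} - {m}. fls_nth x i * fls_nth u (int j - i))"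
        by (subst sum.remove[of _ m]) auto
      finally have eq: "fls_nth x m * fls_nth u (int j - m) =
          (if j = 0 then 1 else 0) - (\<Sum>i\<in>{m..m + int j} - {m}. fls_nth x i * fls_nth u (int j - i))"
        by (simp add: algebra_simps)
      have "fls_nth x i * fls_nth u (int j - i) \<in> K" if i: "i \<in> {m..m + int j} - {m}" for i
      proof -
        define l where "l = nat (int j - (i - m))"
        have "l < j" "int j - i = - m + int l" using i by (auto simp: l_def)
        then show ?thesis using less.IH[of l] xn is_subringD(4)[OF sK] by simp
      qed
      then have "fls_nth x m * fls_nth u (int j - m) \<in> K" unfolding eq
        by (intro subring_diff[OF sK] subring_sum[OF sK]) (use is_subringD(1,2)[OF sK] in auto)
      then have "fls_nth x m * fls_nth u (int j - m) / fls_nth x m \<in> K"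
        using xn by (intro subfield_divide[OF K])
      then show ?case using xm by (simp add: add.commute)
    qed
    moreover have "fls_nth u n = 0" if "n < - m" for n using that sd by simp
    ultimately have "fls_nth u n \<in> K" for n
      using is_subringD(1)[OF sK] \<open>\<And>j. fls_nth u (- m + int j) \<in> K\<close>[of "nat (n + m)"]
      by (cases "n < - m") auto
    then show ?thesis by (simp add: laurent_def u_def)
  qed (use is_subringD(1)[OF sK] in \<open>simp add: laurent_def\<close>)
  fix y assume "y \<in> laurent K"
  then have yn: "fls_nth y n \<in> K" for n by (simp add: laurent_def)
  show "x + y \<in> laurent K" using xn yn is_subringD(3)[OF sK] by (simp add: laurent_def)
  show "x * y \<in> laurent K" unfolding laurent_def mem_Collect_eq fls_times_nth(2)
    using xn yn by (intro allI subring_sum sK is_subringD(4)[OF sK])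
qed

lemma fls_const_in_laurent: "is_subfield K \<Longrightarrow> fls_const a \<in> laurent K \<longleftrightarrow> a \<in> K"
  using is_subfieldD(1)[of K] by (auto simp: laurent_def dest: spec[of _ 0])

lemma fls_X_in_laurent: "is_subfield K \<Longrightarrow> fls_X \<in> laurent K"
  using is_subfieldD(1,2)[of K] by (auto simp: laurent_def)

lemma fps_to_fls_poly: "fps_to_fls (poly P f) = poly (map_poly fps_to_fls P) (fps_to_fls f)"
  by (induction P) (simp_all add: Polynomial.map_poly_pCons fls_times_fps_to_fls)

lemma poly_shifted_X:
  fixes q :: "'a::field poly"
  shows "poly (map_poly fls_const q) (fls_const c + fls_X) = fps_to_fls (fps_of_poly (pcompose q [:c, 1:]))"
proof (induction q)
  case (pCons a q)
  have *: "fps_of_poly [:c, 1:] = fps_const c + fps_X"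
    by (simp add: fps_of_poly_pCons)
  have "poly (map_poly fls_const (pCons a q)) (fls_const c + fls_X)
      = fls_const a + (fls_const c + fls_X) * poly (map_poly fls_const q) (fls_const c + fls_X)"
    by (simp add: Polynomial.map_poly_pCons)
  also have "\<dots> = fps_to_fls (fps_const a + (fps_const c + fps_X) * fps_of_poly (pcompose q [:c, 1:]))"
    unfolding pCons.IH by (simp only: fps_to_fls_plus fls_times_fps_to_fls fps_const_to_fls fps_X_to_fls)
  also have "fps_const a + (fps_const c + fps_X) * fps_of_poly (pcompose q [:c, 1:])
      = fps_of_poly (pcompose (pCons a q) [:c, 1:])"
    by (simp only: pcompose_pCons fps_of_poly_add fps_of_poly_mult fps_of_poly_const *)
  finally show ?case .
qed simp

lemma poly_shifted_X_nonzero: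
  fixes q :: "'a::field poly"
  assumes "q \<noteq> 0" shows "poly (map_poly fls_const q) (fls_const c + fls_X) \<noteq> 0"
proof -
  have "pcompose q [:c, 1:] \<noteq> 0" using assms by (simp add: pcompose_eq_0_iff)
  then show ?thesis unfolding poly_shifted_X using fps_of_poly_eq_iff[of _ 0] by simp
qed

lemma poly_over_image:
  assumes "p \<in> polys_over (h ` K)" "h 0 = 0" "0 \<in> K" "inj h"
  shows "\<exists>q\<in>polys_over K. p = map_poly h q"
proof -
  have inv0: "inv_into UNIV h 0 = 0" using assms(2,4) inv_into_f_f[of h UNIV 0] by simp
  have "inv_into UNIV h (coeff p i) \<in> K" "h (inv_into UNIV h (coeff p i)) = coeff p i" for i
    using coeff_polys_over[OF assms(1), of i] assms(4) by (auto simp: inv_into_f_f)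
  then show ?thesis using inv0 assms(2)
    by (intro bexI[of _ "map_poly (inv_into UNIV h) p"]) (auto simp: polys_over_def poly_eq_iff coeff_map_poly)
qed

lemma inj_fls_const: "inj (fls_const :: 'a::field \<Rightarrow> 'a fls)"
proof (rule injI)
  fix x y :: 'a assume "fls_const x = fls_const y"
  then have "fls_nth (fls_const x) 0 = fls_nth (fls_const y) 0" by simp
  then show "x = y" by simp
qed

lemma shifted_X_transcendental: "\<not> alg_over (range fls_const) (fls_const c + fls_X :: 'a::field fls)"
proof
  assume "alg_over (range fls_const) (fls_const c + fls_X :: 'a fls)"
  then obtain p where p: "p \<in> polys_over (range fls_const)" "p \<noteq> 0" "poly p (fls_const c + fls_X :: 'a fls) = 0"
    by (auto simp: alg_over_def)
  obtain q where "p = map_poly fls_const q" using poly_over_image[OF p(1)] inj_fls_const by auto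
  then show False using p poly_shifted_X_nonzero[of q c] by auto
qed

lemma is_subfield_image_fls_const:
  fixes K :: "'a::field set"
  assumes K: "is_subfield K" shows "is_subfield (fls_const ` K)"
proof -
  have "inverse (fls_const x) = fls_const (inverse x)" for x :: 'a
  proof (cases "x = 0")
    case False
    then have "fls_const x * fls_const (inverse x) = 1" by (simp add: fls_const_mult_const)
    then show ?thesis by (rule inverse_unique)
  qed simp
  note inv = this
  have neg: "- fls_const x = fls_const (- x)" for x :: 'a by (intro fls_eqI) simp
  show ?thesis
    unfolding is_subfield_def
  proof (intro conjI ballI)
    show "0 \<in> fls_const ` K" "1 \<in> fls_const ` K"
      using is_subfieldD(1,2)[OF K] imageI[of _ K fls_const] by force+
    fix x assume "x \<in> fls_const ` K"
    then obtain a where a: "x = fls_const a" "a \<in> K" by blast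
    show "- x \<in> fls_const ` K"
      unfolding a(1) neg by (rule imageI[OF is_subfieldD(5)[OF K a(2)]])
    show "inverse x \<in> fls_const ` K"
      unfolding a(1) inv by (rule imageI[OF is_subfieldD(6)[OF K a(2)]])
    fix y assume "y \<in> fls_const ` K"
    then obtain b where b: "y = fls_const b" "b \<in> K" by blast
    show "x + y \<in> fls_const ` K" "x * y \<in> fls_const ` K"
      unfolding a(1) b(1) fls_plus_const fls_const_mult_const
      using is_subfieldD(3,4)[OF K a(2) b(2)] by simp_all
  qed
qed

text \<open>With \<open>x0 + t\<close> in place of the inner variable, \<open>g\<close> becomes a
  polynomial over power series whose reduction at \<open>t = 0\<close> is \<open>g(x0, .)\<close>,
  with simple root \<open>w0\<close>.\<close>

lemma hensel_bpoly:
  fixes g :: "'a::field poly poly"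
  assumes g: "bpoly g x0 w0 = 0" "bpoly (pderiv g) x0 w0 \<noteq> 0"
  shows "\<exists>f. bpoly (map_poly (map_poly fls_const) g) (fls_const x0 + fls_X) f = 0 \<and>
    (\<forall>K. is_subfield K \<longrightarrow> x0 \<in> K \<longrightarrow> w0 \<in> K \<longrightarrow> g \<in> polys_over (polys_over K) \<longrightarrow> f \<in> laurent K)"
proof -
  define e where "e = (\<lambda>q::'a poly. fps_of_poly (pcompose q [:x0, 1:]))"
  have e0: "e 0 = 0" by (simp add: e_def)
  have ering: "e (p + q) = e p + e q" "e (p * q) = e p * e q" for p q
    by (simp_all add: e_def pcompose_add pcompose_mult fps_of_poly_add fps_of_poly_mult)
  have nth0: "fps_nth (e q) 0 = poly q x0" for q
    by (simp add: e_def)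
  define P where "P = map_poly e g"
  have ev: "fps_nth (poly (map_poly e h) (fps_const w0)) 0 = bpoly h x0 w0" for h
    unfolding fps_poly_nth_0 bpoly_altdef by (subst map_poly_map_poly) (simp_all add: e0 o_def nth0)
  have dP: "pderiv P = map_poly e (pderiv g)"
  proof -
    have "e (of_nat n * q) = of_nat n * e q" for n q
      by (induction n) (simp_all add: e0 ering algebra_simps)
    then show ?thesis
      by (intro poly_eqI) (simp add: P_def coeff_pderiv coeff_map_poly e0 del: of_nat_Suc)
  qed
  obtain f where f: "poly P f = 0" "\<And>K. is_subfield K \<Longrightarrow> w0 \<in> K \<Longrightarrow>
    P \<in> polys_over {f. \<forall>n. fps_nth f n \<in> K} \<Longrightarrow> (\<forall>n. fps_nth f n \<in> K)"
    using fps_hensel[of P w0] ev[of g] ev[of "pderiv g"] g unfolding dP by (auto simp: P_def)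
  have "bpoly (map_poly (map_poly fls_const) g) (fls_const x0 + fls_X) (fps_to_fls f)
      = poly (map_poly fps_to_fls P) (fps_to_fls f)"
    unfolding bpoly_altdef P_def
    by (simp add: map_poly_map_poly o_def e_def poly_shifted_X)
  also have "\<dots> = 0" using f(1) by (simp flip: fps_to_fls_poly)
  finally have 1: "bpoly (map_poly (map_poly fls_const) g) (fls_const x0 + fls_X) (fps_to_fls f) = 0" .
  have "fps_to_fls f \<in> laurent K"
    if K: "is_subfield K" "x0 \<in> K" "w0 \<in> K" and gK: "g \<in> polys_over (polys_over K)" for K
  proof -
    note sK = subfield_imp_subring[OF K(1)]
    note PK = is_subring_polys_over[OF sK]
    have "pcompose q [:x0, 1:] \<in> polys_over K" if q: "q \<in> polys_over K" for q
    proof -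
      have "[:coeff q i:] \<in> polys_over K" for i
        using coeff_polys_over[OF q] is_subringD(1)[OF PK] by (simp add: polys_over_pCons sK)
      then have "map_poly (\<lambda>x. [:x:]) q \<in> polys_over (polys_over K)"
        unfolding polys_over_def[of "polys_over K"] by (simp add: coeff_map_poly)
      moreover have "[:x0, 1:] \<in> polys_over K" using K(2) is_subringD(2)[OF sK] is_subringD(1)[OF PK]
        by (simp add: polys_over_pCons sK)
      ultimately show ?thesis unfolding pcompose_altdef by (intro poly_in_subring PK)
    qed
    then have "e (coeff g i) \<in> {f. \<forall>n. fps_nth f n \<in> K}" for i
      using coeff_polys_over[OF gK, of i] by (simp add: e_def coeff_polys_over)
    then have "P \<in> polys_over {f. \<forall>n. fps_nth f n \<in> K}"
      unfolding polys_over_def[of "{f. \<forall>n. fps_nth f n \<in> K}"] by (simp add: P_def coeff_map_poly e0)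
    then have "\<forall>n. fps_nth f n \<in> K" using f(2) K by blast
    then show ?thesis using is_subringD(1)[OF sK] by (simp add: laurent_def)
  qed
  then show ?thesis using 1 by blast
qed

section \<open>Transfer of quantifier-free formulas\<close>

lemma rterm_transfer:
  fixes h :: "'n \<Rightarrow> 'a::field \<Rightarrow> 'b::field"
  assumes h: "eventually_hom F L h" and L: "is_subfield L"
    and c: "\<And>a. a \<in> rterm_params t \<Longrightarrow> c a \<in> L \<and> (\<forall>\<^sub>F n in F. h n (c a) = c' a)"
    and v: "\<And>i. i \<in> rterm_vars t \<Longrightarrow> v i \<in> L \<and> (\<forall>\<^sub>F n in F. h n (v i) = v' n i)"
  shows "rterm_val v (map_rterm c t) \<in> L \<and>
    (\<forall>\<^sub>F n in F. h n (rterm_val v (map_rterm c t)) = rterm_val (v' n) (map_rterm c' t))"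
  using c v
proof (induction t)
  case Zero
  then show ?case using is_subfieldD(1)[OF L] eventually_homD(1)[OF h] by simp
next
  case One
  then show ?case using is_subfieldD(2)[OF L] eventually_homD(2)[OF h] by simp
next
  case (Plus s t)
  have s: "rterm_val v (map_rterm c s) \<in> L"
    "\<forall>\<^sub>F n in F. h n (rterm_val v (map_rterm c s)) = rterm_val (v' n) (map_rterm c' s)" using Plus by auto
  have t: "rterm_val v (map_rterm c t) \<in> L"
    "\<forall>\<^sub>F n in F. h n (rterm_val v (map_rterm c t)) = rterm_val (v' n) (map_rterm c' t)" using Plus by auto
  from eventually_homD(3)[OF h s(1) t(1)] s(2) t(2)
  have "\<forall>\<^sub>F n in F. h n (rterm_val v (map_rterm c (Plus s t))) = rterm_val (v' n) (map_rterm c' (Plus s t))"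
    by eventually_elim simp
  then show ?case using s(1) t(1) is_subfieldD(3)[OF L] by simp
next
  case (Minus t)
  have t: "rterm_val v (map_rterm c t) \<in> L"
    "\<forall>\<^sub>F n in F. h n (rterm_val v (map_rterm c t)) = rterm_val (v' n) (map_rterm c' t)" using Minus by auto
  from eventually_hom_uminus[OF h subfield_imp_subring[OF L] t(1)] t(2)
  have "\<forall>\<^sub>F n in F. h n (rterm_val v (map_rterm c (Minus t))) = rterm_val (v' n) (map_rterm c' (Minus t))"
    by eventually_elim simp
  then show ?case using t(1) is_subfieldD(5)[OF L] by simp
next
  case (Times s t)
  have s: "rterm_val v (map_rterm c s) \<in> L"
    "\<forall>\<^sub>F n in F. h n (rterm_val v (map_rterm c s)) = rterm_val (v' n) (map_rterm c' s)" using Times by auto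
  have t: "rterm_val v (map_rterm c t) \<in> L"
    "\<forall>\<^sub>F n in F. h n (rterm_val v (map_rterm c t)) = rterm_val (v' n) (map_rterm c' t)" using Times by auto
  from eventually_homD(4)[OF h s(1) t(1)] s(2) t(2)
  have "\<forall>\<^sub>F n in F. h n (rterm_val v (map_rterm c (Times s t))) = rterm_val (v' n) (map_rterm c' (Times s t))"
    by eventually_elim simp
  then show ?case using s(1) t(1) is_subfieldD(4)[OF L] by simp
qed auto

text \<open>Negated equations survive too, because in a field a nonzero difference eventually has
  nonzero image; hence an equivalence. The formula keeps its own parameters, and \<open>c\<close>
  and \<open>c'\<close> interpret them in the two fields.\<close>

lemma qf_transfer:
  fixes h :: "'n \<Rightarrow> 'a::field \<Rightarrow> 'b::field"
  assumes h: "eventually_hom F L h" and L: "is_subfield L"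
    and c: "\<And>a. a \<in> qf_params \<phi> \<Longrightarrow> c a \<in> L \<and> (\<forall>\<^sub>F n in F. h n (c a) = c' a)"
    and v: "\<And>i. i \<in> qf_vars \<phi> \<Longrightarrow> v i \<in> L \<and> (\<forall>\<^sub>F n in F. h n (v i) = v' n i)"
  shows "\<forall>\<^sub>F n in F. qf_sat (v' n) (map_qf_formula c' \<phi>) \<longleftrightarrow> qf_sat v (map_qf_formula c \<phi>)"
  using c v
proof (induction \<phi>)
  case (Eq s t)
  define a b where "a = rterm_val v (map_rterm c s)" and "b = rterm_val v (map_rterm c t)"
  have s: "a \<in> L" "\<forall>\<^sub>F n in F. h n a = rterm_val (v' n) (map_rterm c' s)"
    using rterm_transfer[OF h L, of s c c' v v'] Eq unfolding a_def by auto
  have t: "b \<in> L" "\<forall>\<^sub>F n in F. h n b = rterm_val (v' n) (map_rterm c' t)"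
    using rterm_transfer[OF h L, of t c c' v v'] Eq unfolding b_def by auto
  have "\<forall>\<^sub>F n in F. h n a = h n b \<longleftrightarrow> a = b"
  proof (cases "a = b")
    case False
    have nb: "- b \<in> L" using t is_subfieldD(5)[OF L] by blast
    have d: "a + - b \<in> L" "a + - b \<noteq> 0" using s t False is_subfieldD(3)[OF L s(1) nb] by auto
    from eventually_hom_nonzero[OF h L d] eventually_homD(3)[OF h s(1) nb]
      eventually_hom_uminus[OF h subfield_imp_subring[OF L] t(1)]
    show ?thesis by eventually_elim (use False in auto)
  qed simp
  with s(2) t(2) show ?case
    by eventually_elim (simp add: a_def b_def)
next
  case (Neg \<phi>)
  then have "\<forall>\<^sub>F n in F. qf_sat (v' n) (map_qf_formula c' \<phi>) \<longleftrightarrow> qf_sat v (map_qf_formula c \<phi>)" by auto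
  then show ?case by eventually_elim simp
next
  case (Conj \<phi> \<psi>)
  then have "\<forall>\<^sub>F n in F. qf_sat (v' n) (map_qf_formula c' \<phi>) \<longleftrightarrow> qf_sat v (map_qf_formula c \<phi>)"
    "\<forall>\<^sub>F n in F. qf_sat (v' n) (map_qf_formula c' \<psi>) \<longleftrightarrow> qf_sat v (map_qf_formula c \<psi>)" by auto
  then show ?case by eventually_elim simp
next
  case (Disj \<phi> \<psi>)
  then have "\<forall>\<^sub>F n in F. qf_sat (v' n) (map_qf_formula c' \<phi>) \<longleftrightarrow> qf_sat v (map_qf_formula c \<phi>)"
    "\<forall>\<^sub>F n in F. qf_sat (v' n) (map_qf_formula c' \<psi>) \<longleftrightarrow> qf_sat v (map_qf_formula c \<psi>)" by auto
  then show ?case by eventually_elim simp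
qed

lemma eventually_hom_bpoly:
  assumes h: "eventually_hom F K h" and K: "is_subring K" and P: "P \<in> polys_over (polys_over K)" and x: "x \<in> K" "w \<in> K"
  shows "\<forall>\<^sub>F n in F. h n (bpoly P x w) = bpoly (map_poly (map_poly (h n)) P) (h n x) (h n w)"
proof -
  note PK = is_subring_polys_over[OF K]
  have W: "[:w:] \<in> polys_over K" using x is_subringD(1)[OF PK] by (simp add: polys_over_pCons K)
  have PW: "poly P [:w:] \<in> polys_over K" by (rule poly_in_subring[OF PK P W])
  from eventually_hom_poly[OF h K PW x(1)] eventually_hom_poly[OF eventually_hom_map_poly[OF h K] PK P W]
  show ?thesis unfolding bpoly_def
    by eventually_elim (simp add: Polynomial.map_poly_pCons eventually_homD(1)[OF h])
qed

lemma eventually_hom_pderiv: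
  assumes h: "eventually_hom F K h" and K: "is_subring K" and P: "p \<in> polys_over K"
  shows "\<forall>\<^sub>F n in F. map_poly (h n) (pderiv p) = pderiv (map_poly (h n) (p :: 'a::idom poly) :: 'b::idom poly)"
  using P
proof (induction p)
  case (pCons a p)
  note h0 = eventually_homD(1)[OF h]
  have p: "p \<in> polys_over K" using pCons.prems by (simp add: polys_over_pCons K)
  have q: "pCons 0 (pderiv p) \<in> polys_over K"
    using polys_over_pderiv[OF K p] is_subringD(1)[OF K] by (simp add: polys_over_pCons K)
  from pCons.IH[OF p] eventually_homD(3)[OF eventually_hom_map_poly[OF h K] p q]
  show ?case by eventually_elim (simp add: pderiv_pCons Polynomial.map_poly_pCons h0)
qed simp

section \<open>Exchange\<close>

text \<open>The old inner variable becomes the outer one, as its coefficients are made constant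
  polynomials; the old outer variable is evaluated at \<open>[:[:0, 1:]:]\<close>, the new inner
  variable.\<close>

definition swap_poly :: "'a::comm_ring_1 poly poly \<Rightarrow> 'a poly poly" where
  "swap_poly P = poly (map_poly (map_poly (\<lambda>c. [:c:])) P) [:[:0, 1:]:]"

lemma bpoly_map_const: "bpoly (map_poly (\<lambda>c. [:c:]) q) x y = poly q y"
  by (induction q) (simp_all add: Polynomial.map_poly_pCons)

lemma bpoly_swap: "bpoly (swap_poly P) x y = bpoly P y x"
  unfolding swap_poly_def
proof (induction P)
  case (pCons q P)
  then show ?case by (simp add: Polynomial.map_poly_pCons bpoly_map_const)
qed simp

lemma swap_poly_over:
  assumes K: "is_subring K" and P: "P \<in> polys_over (polys_over K)"
  shows "swap_poly P \<in> polys_over (polys_over K)"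
proof -
  note PK = is_subring_polys_over[OF K]
  note PPK = is_subring_polys_over[OF PK]
  have "map_poly (\<lambda>c. [:c:]) q \<in> polys_over (polys_over K)" if q: "q \<in> polys_over K" for q
  proof -
    have "[:coeff q i:] \<in> polys_over K" for i
      using coeff_polys_over[OF q] is_subringD(1)[OF PK] by (simp add: polys_over_pCons K)
    then show ?thesis unfolding polys_over_def[of "polys_over K"] by (simp add: coeff_map_poly)
  qed
  then have "map_poly (\<lambda>c. [:c:]) (coeff P i) \<in> polys_over (polys_over K)" for i
    using coeff_polys_over[OF P] by blast
  then have "map_poly (map_poly (\<lambda>c. [:c:])) P \<in> polys_over (polys_over (polys_over K))"
    unfolding polys_over_def[of "polys_over (polys_over K)"] by (simp add: coeff_map_poly)
  moreover have "[:[:0, 1:]:] \<in> polys_over (polys_over K)"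
    using is_subringD(1)[OF PPK] is_subringD(1)[OF PK] is_subringD(1,2)[OF K] by (simp add: polys_over_pCons PK K)
  ultimately show ?thesis unfolding swap_poly_def by (intro poly_in_subring PPK)
qed

text \<open>A relation between \<open>X\<close> and \<open>y\<close> with denominators cleared can
  be read in either variable. That it stays nontrivial over \<open>K(X)\<close> uses the
  transcendence of \<open>X\<close>.\<close>

lemma algebraic_exchange:
  fixes X y :: "'a::field_char_0"
  assumes K: "is_subring K" and X: "\<not> alg_over K X" and alg: "alg_over (adjoin K y) X"
  shows "alg_over (adjoin K X) y"
proof -
  obtain p where p: "p \<in> polys_over (adjoin K y)" "p \<noteq> 0" "poly p X = 0" using alg by (auto simp: alg_over_def)
  obtain d P where d: "P \<in> polys_over (polys_over K)" "poly d y \<noteq> 0"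
    "map_poly (\<lambda>q. poly q y) P = smult (poly d y) p" using clear_denominators[OF K p(1)] by blast
  define Q where "Q = swap_poly P"
  have Q: "Q \<in> polys_over (polys_over K)" unfolding Q_def by (rule swap_poly_over[OF K d(1)])
  have "Q \<noteq> 0"
  proof
    assume "Q = 0"
    then have "bpoly P y x = 0" for x using bpoly_swap[of P x y] by (simp add: Q_def)
    then have "poly p x = 0" for x using d(2,3) by (simp add: bpoly_altdef)
    then show False using p(2) using poly_all_0_iff_0[of p] by blast
  qed
  moreover have "bpoly Q X y = 0" using bpoly_swap[of P X y] d(2,3) p(3) by (simp add: Q_def bpoly_altdef)
  ultimately show ?thesis unfolding alg_over_def
    using map_poly_eval_in_adjoin[OF K Q, of X] map_poly_eval_nonzero[OF X Q]
    by (intro bexI[of _ "map_poly (\<lambda>q. poly q X) Q"]) (auto simp: bpoly_altdef)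
qed

section \<open>An ultrapower of the complex numbers\<close>

text \<open>Zorn's lemma for proper filters below \<open>cofinite\<close>: if a minimal one does not
  exclude \<open>P\<close>, restricting it to \<open>P\<close> changes nothing.\<close>

lemma ultrafilter_exists:
  "\<exists>U :: nat filter. U \<noteq> bot \<and> U \<le> cofinite \<and> (\<forall>P. eventually P U \<or> eventually (\<lambda>n. \<not> P n) U)"
proof -
  define A where "A = {F :: nat filter. F \<noteq> bot \<and> F \<le> cofinite}"
  have "\<exists>M\<in>A. \<forall>F\<in>A. M \<ge> F \<longrightarrow> F = M"
  proof (rule predicate_Zorn)
    show "partial_order_on A (relation_of (\<ge>) A)" by (rule partial_order_on_relation_ofI) auto
    fix C assume C: "C \<in> Chains (relation_of (\<ge>) A)"
    then have CA: "C \<subseteq> A" and ch: "\<And>F G. F \<in> C \<Longrightarrow> G \<in> C \<Longrightarrow> F \<le> G \<or> G \<le> F"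
      by (auto simp: Chains_def relation_of_def)
    show "\<exists>u\<in>A. \<forall>a\<in>C. u \<le> a"
    proof (cases "C = {}")
      case True
      have "(cofinite :: nat filter) \<in> A" unfolding A_def using cofinite_bot[where ?'a = nat] by simp
      then show ?thesis using True by blast
    next
      case False
      have "Inf C \<noteq> bot"
      proof
        assume "Inf C = bot"
        then have "eventually (\<lambda>_. False) (Inf C)" by simp
        moreover have "\<exists>x\<in>C. x \<le> inf F G" if "F \<in> C" "G \<in> C" for F G
          using ch[OF that] that by (auto simp: inf.absorb1 inf.absorb2)
        ultimately have "\<exists>F\<in>C. eventually (\<lambda>_. False) F" by (subst (asm) eventually_Inf_base[OF False]) auto
        then show False using CA by (auto simp: A_def eventually_False)
      qed
      moreover have "Inf C \<le> cofinite" using False CA unfolding A_def by (metis (no_types, lifting) Inf_lower2 ex_in_conv mem_Collect_eq subset_iff)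
      ultimately show ?thesis by (intro bexI[of _ "Inf C"]) (auto simp: A_def Inf_lower)
    qed
  qed
  then obtain M where "M \<in> A" "\<forall>F\<in>A. F \<le> M \<longrightarrow> F = M" by blast
  then have M: "M \<noteq> bot" "M \<le> cofinite" "F \<noteq> bot \<Longrightarrow> F \<le> cofinite \<Longrightarrow> F \<le> M \<Longrightarrow> F = M" for F
    unfolding A_def by simp_all
  have "eventually P M \<or> eventually (\<lambda>n. \<not> P n) M" for P
  proof (cases "inf M (principal {n. P n}) = bot")
    case True
    then have "eventually (\<lambda>_. False) (inf M (principal {n. P n}))" by simp
    then show ?thesis by (simp add: eventually_inf_principal)
  next
    case False
    then have "inf M (principal {n. P n}) = M" using M(2,3) by (meson inf.cobounded1 le_infI1)
    moreover have "eventually P (inf M (principal {n. P n}))" by (simp add: eventually_inf_principal)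
    ultimately show ?thesis by simp
  qed
  then show ?thesis using M by blast
qed

definition ultra :: "nat filter" where
  "ultra = (SOME U. U \<noteq> bot \<and> U \<le> cofinite \<and> (\<forall>P. eventually P U \<or> eventually (\<lambda>n. \<not> P n) U))"

lemma ultra: "ultra \<noteq> bot" "ultra \<le> cofinite" "eventually P ultra \<or> eventually (\<lambda>n. \<not> P n) ultra"
  using someI_ex[OF ultrafilter_exists] unfolding ultra_def by blast+

lemma eventually_eq_op2:
  assumes "\<forall>\<^sub>F n in F. f n = f' n" "\<forall>\<^sub>F n in F. g n = g' n"
  shows "\<forall>\<^sub>F n in F. c (f n) (g n) = c (f' n) (g' n)"
  using assms by eventually_elim simp

\<comment> \<open>A type cannot depend on a subfield, so the ultrapower is formed from all complex
  numbers; that of \<open>K\<close> is the subset \<open>internal K\<close>.\<close>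
quotient_type hyper = "nat \<Rightarrow> complex" / "\<lambda>f g. \<forall>\<^sub>F n in ultra. f n = g n"
proof (rule equivpI)
  show "transp (\<lambda>f g :: nat \<Rightarrow> complex. \<forall>\<^sub>F n in ultra. f n = g n)"
  proof (rule transpI)
    fix f g k :: "nat \<Rightarrow> complex"
    assume "\<forall>\<^sub>F n in ultra. f n = g n" "\<forall>\<^sub>F n in ultra. g n = k n"
    then show "\<forall>\<^sub>F n in ultra. f n = k n" by eventually_elim simp
  qed
qed (auto intro!: reflpI sympI elim: eventually_mono)

instantiation hyper :: field
begin

lift_definition zero_hyper :: hyper is "\<lambda>_. 0" .
lift_definition one_hyper :: hyper is "\<lambda>_. 1" .
lift_definition plus_hyper :: "hyper \<Rightarrow> hyper \<Rightarrow> hyper" is "\<lambda>f g n. f n + g n"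
  by (rule eventually_eq_op2)
lift_definition minus_hyper :: "hyper \<Rightarrow> hyper \<Rightarrow> hyper" is "\<lambda>f g n. f n - g n"
  by (rule eventually_eq_op2)
lift_definition times_hyper :: "hyper \<Rightarrow> hyper \<Rightarrow> hyper" is "\<lambda>f g n. f n * g n"
  by (rule eventually_eq_op2)
lift_definition uminus_hyper :: "hyper \<Rightarrow> hyper" is "\<lambda>f n. - f n"
  by (elim eventually_mono) simp
lift_definition inverse_hyper :: "hyper \<Rightarrow> hyper" is "\<lambda>f n. inverse (f n)"
  by (elim eventually_mono) simp
definition divide_hyper :: "hyper \<Rightarrow> hyper \<Rightarrow> hyper" where "x div y = x * inverse y" for x y :: hyper

instance
proof
  fix a b c :: hyper
  show "a + b + c = a + (b + c)" by transfer (simp add: algebra_simps)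
  show "a + b = b + a" by transfer (simp add: algebra_simps)
  show "0 + a = a" by transfer simp
  show "- a + a = 0" by transfer simp
  show "a - b = a + - b" by transfer simp
  show "a * b * c = a * (b * c)" by transfer (simp add: algebra_simps)
  show "a * b = b * a" by transfer (simp add: algebra_simps)
  show "1 * a = a" by transfer simp
  show "(a + b) * c = a * c + b * c" by transfer (simp add: algebra_simps)
  show "(0::hyper) \<noteq> 1" by transfer (simp add: ultra(1))
  show "inverse (0::hyper) = 0" by transfer simp
  show "a div b = a * inverse b" by (simp add: divide_hyper_def)
  assume "a \<noteq> 0"
  then show "inverse a * a = 1"
  proof transfer
    fix f :: "nat \<Rightarrow> complex" assume "\<not> (\<forall>\<^sub>F n in ultra. f n = 0)"
    then have "\<forall>\<^sub>F n in ultra. f n \<noteq> 0" using ultra(3) by blast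
    then show "\<forall>\<^sub>F n in ultra. inverse (f n) * f n = 1" by eventually_elim simp
  qed
qed

end

lemma of_nat_hyper: "of_nat k = abs_hyper (\<lambda>_. of_nat k)"
  by (induction k) (simp_all add: zero_hyper_def one_hyper_def plus_hyper.abs_eq)

instance hyper :: field_char_0
proof
  show "inj (of_nat :: nat \<Rightarrow> hyper)"
  proof (rule injI)
    fix a b :: nat assume "(of_nat a :: hyper) = of_nat b"
    then have "\<forall>\<^sub>F n in ultra. (of_nat a :: complex) = of_nat b"
      by (simp add: of_nat_hyper hyper.abs_eq_iff)
    then show "a = b" using ultra(1) by (simp add: eventually_const)
  qed
qed

text \<open>Among the intermediate fields over which \<open>X\<close> stays transcendental take a
  maximal one. Adjoining a further \<open>y\<close> makes \<open>X\<close> algebraic, and exchange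
  then makes \<open>y\<close> algebraic over \<open>K(X)\<close>.\<close>

lemma maximal_transcendental_base:
  fixes X :: "'a::field_char_0"
  assumes k0: "is_subfield k0" "k0 \<subseteq> E" "\<not> alg_over k0 X" and E: "is_subfield E"
  shows "\<exists>K. is_subfield K \<and> k0 \<subseteq> K \<and> K \<subseteq> E \<and> \<not> alg_over K X \<and> (\<forall>y\<in>E. alg_over (adjoin K X) y)"
proof -
  define \<A> where "\<A> = {K. is_subfield K \<and> k0 \<subseteq> K \<and> K \<subseteq> E \<and> \<not> alg_over K X}"
  have "\<exists>M\<in>\<A>. \<forall>K\<in>\<A>. M \<subseteq> K \<longrightarrow> K = M"
  proof (rule subset_Zorn_nonempty)
    show "\<A> \<noteq> {}" using k0 by (auto simp: \<A>_def)
    fix C assume C: "C \<noteq> {}" "subset.chain \<A> C"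
    have CA: "C \<subseteq> \<A>" and ch: "\<And>K L. K \<in> C \<Longrightarrow> L \<in> C \<Longrightarrow> K \<subseteq> L \<or> L \<subseteq> K"
      using C(2) by (auto simp: subset.chain_def)
    have common: "\<exists>M\<in>C. x \<in> M \<and> y \<in> M" if "x \<in> \<Union>C" "y \<in> \<Union>C" for x y
      using that ch by blast
    have sub: "is_subfield M" if "M \<in> C" for M using that CA by (auto simp: \<A>_def)
    have "is_subfield (\<Union>C)"
      unfolding is_subfield_def
    proof (intro conjI ballI)
      obtain M where M: "M \<in> C" using C(1) by blast
      show "0 \<in> \<Union>C" "1 \<in> \<Union>C" using is_subfieldD(1,2)[OF sub[OF M]] M by blast+
      fix x assume x: "x \<in> \<Union>C"
      show "- x \<in> \<Union>C" "inverse x \<in> \<Union>C" using x is_subfieldD(5,6)[OF sub] by blast+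
      fix y assume y: "y \<in> \<Union>C"
      obtain M where M: "M \<in> C" "x \<in> M" "y \<in> M" using common[OF x y] by blast
      show "x + y \<in> \<Union>C" "x * y \<in> \<Union>C" using is_subfieldD(3,4)[OF sub[OF M(1)] M(2,3)] M(1) by blast+
    qed
    \<comment> \<open>The finitely many coefficients of a relation already lie in one member of the
      chain.\<close>
    moreover have "\<not> alg_over (\<Union>C) X"
    proof
      assume "alg_over (\<Union>C) X"
      then obtain p where p: "p \<in> polys_over (\<Union>C)" "p \<noteq> 0" "poly p X = 0" by (auto simp: alg_over_def)
      have "finite (coeff p ` {..degree p})" "coeff p ` {..degree p} \<subseteq> \<Union>C"
        using coeff_polys_over[OF p(1)] by auto
      from finite_subset_Union_chain[OF this C] obtain M where M: "M \<in> C" "coeff p ` {..degree p} \<subseteq> M" .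
      have "coeff p i \<in> M" for i
        using M(2) is_subfieldD(1)[OF sub[OF M(1)]] by (cases "i \<le> degree p") (auto simp: coeff_eq_0)
      then have "alg_over M X" using p by (auto simp: alg_over_def polys_over_def)
      then show False using M(1) CA by (auto simp: \<A>_def)
    qed
    moreover have "k0 \<subseteq> \<Union>C" "\<Union>C \<subseteq> E" using C(1) CA by (auto simp: \<A>_def)
    ultimately show "\<Union>C \<in> \<A>" by (simp add: \<A>_def)
  qed
  then obtain M where M: "M \<in> \<A>" "\<And>K. K \<in> \<A> \<Longrightarrow> M \<subseteq> K \<Longrightarrow> K = M" by blast
  have M': "is_subfield M" "k0 \<subseteq> M" "M \<subseteq> E" "\<not> alg_over M X" using M(1) by (auto simp: \<A>_def)
  note sM = subfield_imp_subring[OF M'(1)]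
  have "alg_over (adjoin M X) y" if y: "y \<in> E" for y
  proof (cases "y \<in> M")
    case True
    then show ?thesis using base_alg[OF is_subfield_adjoin[OF sM]] base_in_adjoin[OF sM] by blast
  next
    case False
    have sub: "M \<subseteq> adjoin M y" using base_in_adjoin[OF sM] by blast
    have "adjoin M y \<noteq> M" using gen_in_adjoin[OF sM, of y] False by auto
    then have "adjoin M y \<notin> \<A>" using M(2) sub by blast
    moreover have "adjoin M y \<subseteq> E" using adjoin_subset[OF E M'(3) y] .
    ultimately have "alg_over (adjoin M y) X"
      using M'(2) sub is_subfield_adjoin[OF sM] by (auto simp: \<A>_def)
    then show ?thesis by (rule algebraic_exchange[OF sM M'(4)])
  qed
  with M' show ?thesis by blast
qed

definition internal :: "complex set \<Rightarrow> hyper set" where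
  "internal K = {abs_hyper f |f. \<forall>n. f n \<in> K}"

definition hconst :: "complex \<Rightarrow> hyper" where
  "hconst c = abs_hyper (\<lambda>_. c)"

lemmas hyper_abs = plus_hyper.abs_eq times_hyper.abs_eq uminus_hyper.abs_eq inverse_hyper.abs_eq

lemma is_subfield_internal:
  assumes K: "is_subfield K" shows "is_subfield (internal K)"
  unfolding is_subfield_def
proof (intro conjI ballI)
  have I: "abs_hyper f \<in> internal K" if "\<And>n. f n \<in> K" for f using that by (auto simp: internal_def)
  show "0 \<in> internal K" "1 \<in> internal K"
    unfolding zero_hyper_def one_hyper_def using is_subfieldD(1,2)[OF K] by (intro I; simp)+
  fix x assume "x \<in> internal K"
  then obtain f where x: "x = abs_hyper f" "\<And>n. f n \<in> K" by (auto simp: internal_def)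
  show "- x \<in> internal K" "inverse x \<in> internal K"
    unfolding x(1) hyper_abs by (intro I is_subfieldD(5,6)[OF K] x(2))+
  fix y assume "y \<in> internal K"
  then obtain g where y: "y = abs_hyper g" "\<And>n. g n \<in> K" by (auto simp: internal_def)
  show "x + y \<in> internal K" "x * y \<in> internal K"
    unfolding x(1) y(1) hyper_abs by (intro I is_subfieldD(3,4)[OF K] x(2) y(2))+
qed

lemma hconst_0: "hconst 0 = 0" by (simp add: hconst_def zero_hyper_def)

lemma hconst_eq_iff: "hconst a = hconst b \<longleftrightarrow> a = b"
  using ultra(1) by (simp add: hconst_def hyper.abs_eq_iff eventually_const)

lemma is_subfield_image_hconst:
  assumes K: "is_subfield K" shows "is_subfield (hconst ` K)"
  unfolding is_subfield_def
proof (intro conjI ballI)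
  have I: "abs_hyper (\<lambda>_. c) \<in> hconst ` K" if "c \<in> K" for c using that by (auto simp: hconst_def)
  show "0 \<in> hconst ` K" "1 \<in> hconst ` K"
    unfolding zero_hyper_def one_hyper_def using is_subfieldD(1,2)[OF K] by (intro I; simp)+
  fix x assume "x \<in> hconst ` K"
  then obtain a where x: "x = abs_hyper (\<lambda>_. a)" "a \<in> K" by (auto simp: hconst_def)
  show "- x \<in> hconst ` K" "inverse x \<in> hconst ` K"
    unfolding x(1) hyper_abs by (intro I is_subfieldD(5,6)[OF K] x(2))+
  fix y assume "y \<in> hconst ` K"
  then obtain b where y: "y = abs_hyper (\<lambda>_. b)" "b \<in> K" by (auto simp: hconst_def)
  show "x + y \<in> hconst ` K" "x * y \<in> hconst ` K"
    unfolding x(1) y(1) hyper_abs by (intro I is_subfieldD(3,4)[OF K] x(2) y(2))+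
qed

lemma poly_hyper: "poly (map_poly hconst q) (abs_hyper \<sigma>) = abs_hyper (\<lambda>n. poly q (\<sigma> n))"
proof (induction q)
  case (pCons a q)
  then show ?case by (simp add: Polynomial.map_poly_pCons hconst_0 hconst_def hyper_abs)
qed (simp add: zero_hyper_def)

text \<open>A nonzero polynomial vanishes at finitely many terms of an injective sequence, and the
  ultrafilter contains no finite set.\<close>

lemma hyper_transcendental:
  assumes "inj \<sigma>" shows "\<not> alg_over (range hconst) (abs_hyper \<sigma>)"
proof
  assume "alg_over (range hconst) (abs_hyper \<sigma>)"
  then obtain p where p: "p \<in> polys_over (range hconst)" "p \<noteq> 0" "poly p (abs_hyper \<sigma>) = 0"
    by (auto simp: alg_over_def)
  have "inj hconst" by (simp add: inj_on_def hconst_eq_iff)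
  then obtain q where q: "p = map_poly hconst q" using poly_over_image[OF p(1)] hconst_0 by auto
  then have "q \<noteq> 0" using p(2) by auto
  have "\<forall>\<^sub>F n in ultra. poly q (\<sigma> n) = 0"
    using p(3) unfolding q poly_hyper by (simp add: zero_hyper_def hyper.abs_eq_iff)
  moreover have "finite {n. \<not> poly q (\<sigma> n) \<noteq> 0}"
    using finite_vimageI[OF poly_roots_finite[OF \<open>q \<noteq> 0\<close>] assms] by (simp add: vimage_def)
  then have "\<forall>\<^sub>F n in ultra. poly q (\<sigma> n) \<noteq> 0"
    using ultra(2) by (auto simp: le_filter_def eventually_cofinite)
  ultimately have "\<forall>\<^sub>F n in ultra. False" by eventually_elim simp
  then show False using ultra(1) by (simp add: eventually_False)
qed

text \<open>Choosing one sequence per class gives an eventual homomorphism. Internal elements get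
  sequences with all values in \<open>K\<close>, so that membership holds at every index and not
  just eventually.\<close>

lemma representatives:
  obtains r :: "nat \<Rightarrow> hyper \<Rightarrow> complex" where
    "eventually_hom ultra UNIV r" "\<And>f. \<forall>\<^sub>F n in ultra. r n (abs_hyper f) = f n"
    "\<And>z n. z \<in> internal K \<Longrightarrow> 0 \<in> K \<Longrightarrow> r n z \<in> K"
proof -
  define R where "R z = (if z = 0 then (\<lambda>_. 0) else if z \<in> internal K
    then (SOME f. (\<forall>n. f n \<in> K) \<and> abs_hyper f = z) else (SOME f. abs_hyper f = z))" for z
  have in_int: "(\<forall>n. R z n \<in> K) \<and> abs_hyper (R z) = z" if "z \<in> internal K" "z \<noteq> 0" for z
  proof -
    have "\<exists>f. (\<forall>n. f n \<in> K) \<and> abs_hyper f = z" using that by (auto simp: internal_def)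
    from someI_ex[OF this] show ?thesis using that by (simp add: R_def)
  qed
  have abs: "abs_hyper (R z) = z" for z
  proof -
    consider "z = 0" | "z \<in> internal K" "z \<noteq> 0" | "z \<notin> internal K" "z \<noteq> 0" by blast
    then show ?thesis
    proof cases
      case 3
      have "\<exists>f. abs_hyper f = z" by (metis Quotient_abs_rep Quotient_hyper)
      from someI_ex[OF this] show ?thesis using 3 by (simp add: R_def)
    qed (use in_int in \<open>auto simp: R_def zero_hyper_def\<close>)
  qed
  have ev: "\<forall>\<^sub>F n in ultra. R (abs_hyper f) n = f n" for f
    using abs[of "abs_hyper f"] by (simp add: hyper.abs_eq_iff)
  have add: "\<forall>\<^sub>F n in ultra. R (a + b) n = R a n + R b n" for a b
    using ev[of "\<lambda>n. R a n + R b n"] by (simp add: plus_hyper.abs_eq[symmetric] abs)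
  have mult: "\<forall>\<^sub>F n in ultra. R (a * b) n = R a n * R b n" for a b
    using ev[of "\<lambda>n. R a n * R b n"] by (simp add: times_hyper.abs_eq[symmetric] abs)
  have one: "\<forall>\<^sub>F n in ultra. R 1 n = 1" using ev[of "\<lambda>_. 1"] by (simp add: one_hyper_def)
  show ?thesis
  proof (rule that[of "\<lambda>n z. R z n"])
    show "eventually_hom ultra UNIV (\<lambda>n z. R z n)"
      unfolding eventually_hom_def using add mult one by (simp add: R_def)
    show "R z n \<in> K" if "z \<in> internal K" "0 \<in> K" for z n
      using in_int[OF that(1)] that(2) by (cases "z = 0") (auto simp: R_def)
  qed (rule ev)
qed

lemma map_poly_map_poly_fls_const_nonzero:
  "P \<noteq> 0 \<Longrightarrow> map_poly (map_poly fls_const) (P :: 'a::field poly poly) \<noteq> 0"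
proof
  assume P: "P \<noteq> 0" and z: "map_poly (map_poly fls_const) P = 0"
  have "coeff (coeff P i) j = 0" for i j
  proof -
    have "coeff (coeff (map_poly (map_poly fls_const) P) i) j = 0" using z by simp
    then have "fls_const (coeff (coeff P i) j) = 0" by (simp add: coeff_map_poly)
    then show ?thesis using fls_const_nonzero by blast
  qed
  then have "P = 0" by (intro poly_eqI) (simp add: poly_eq_iff)
  then show False using P by simp
qed

text \<open>In the ultrapower the solution becomes a point on a curve: \<open>X\<close> is a
  parameter, \<open>w\<close> a simple root of \<open>g\<close> above it. At almost every index
  \<open>g\<close> turns into a relation over \<open>K0\<close> with the simple root
  \<open>r n w\<close> above \<open>\<sigma> n\<close>, which Hensel's lemma deforms along
  \<open>\<sigma> n + t\<close>.\<close>

theorem laurent_point: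
  fixes K0 :: "complex set" and \<sigma> :: "nat \<Rightarrow> complex"
  assumes K0: "is_subfield K0" and \<phi>: "qf_params \<phi> \<subseteq> K0" "qf_vars \<phi> \<subseteq> {..m}" and \<kappa>: "\<kappa> \<in> K0"
    and \<sigma>: "inj \<sigma>" "\<And>n. \<sigma> n \<in> K0" and ys: "\<And>n. length (ys n) = m" "\<And>n. set (ys n) \<subseteq> K0"
    and sat: "\<And>n. qf_sat (nth ((\<sigma> n + \<kappa>) # ys n)) \<phi>"
  shows "\<exists>n f Y. length Y = m \<and> f \<in> laurent K0 \<and>
    alg_over (adjoin (fls_const ` K0) (fls_const (\<sigma> n) + fls_X)) f \<and>
    set Y \<subseteq> adjoin (adjoin (fls_const ` K0) (fls_const (\<sigma> n) + fls_X)) f \<and>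
    qf_sat (nth ((fls_const (\<sigma> n) + fls_X + fls_const \<kappa>) # Y)) (map_qf_formula fls_const \<phi>)"
proof -
  note sK0 = subfield_imp_subring[OF K0]
  have H: "is_subfield (internal K0)" by (rule is_subfield_internal[OF K0])
  define X where "X = abs_hyper \<sigma>"
  define Yh where "Yh = map (\<lambda>j. abs_hyper (\<lambda>n. ys n ! j)) [0..<m]"
  have X_int: "X \<in> internal K0" unfolding X_def internal_def mem_Collect_eq using \<sigma>(2) by (intro exI[of _ \<sigma>]) simp
  have Yh_int: "Yh ! j \<in> internal K0" if "j < m" for j
  proof -
    have "ys n ! j \<in> K0" for n using ys(2)[of n] nth_mem[of j "ys n"] ys(1)[of n] that by auto
    then have "abs_hyper (\<lambda>n. ys n ! j) \<in> internal K0"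
      unfolding internal_def mem_Collect_eq by (intro exI[of _ "\<lambda>n. ys n ! j"]) simp
    then show ?thesis using that by (simp add: Yh_def)
  qed
  have const_int: "hconst ` K0 \<subseteq> internal K0" by (auto simp: hconst_def internal_def)
  have Xt: "\<not> alg_over (hconst ` K0) X"
    using hyper_transcendental[OF \<sigma>(1)] alg_over_mono[of "hconst ` K0" "range hconst" X] unfolding X_def by blast
  \<comment> \<open>The coordinates need not be algebraic over \<open>K0(X)\<close>; enlarging the
    constants to \<open>K1\<close> makes them so and leaves \<open>X\<close> transcendental.\<close>
  obtain K1 where K1: "is_subfield K1" "hconst ` K0 \<subseteq> K1" "K1 \<subseteq> internal K0" "\<not> alg_over K1 X"
    "\<And>y. y \<in> internal K0 \<Longrightarrow> alg_over (adjoin K1 X) y"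
    using maximal_transcendental_base[OF is_subfield_image_hconst[OF K0] const_int Xt H] by blast
  note sK1 = subfield_imp_subring[OF K1(1)]
  have k: "is_subfield (adjoin K1 X)" by (rule is_subfield_adjoin[OF sK1])
  have "length Yh = m" by (simp add: Yh_def)
  then have Yh_set: "set Yh \<subseteq> internal K0" using Yh_int by (metis in_set_conv_nth subsetI)
  have "\<exists>w. alg_over (adjoin K1 X) w \<and> set Yh \<subseteq> adjoin (adjoin K1 X) w \<and>
      (\<forall>E. is_subring E \<and> set Yh \<subseteq> E \<longrightarrow> w \<in> E)"
    using Yh_set K1(5) by (intro primitive_element_finite k) auto
  then obtain w where w: "alg_over (adjoin K1 X) w" "set Yh \<subseteq> adjoin (adjoin K1 X) w" "w \<in> internal K0"
    using Yh_set subfield_imp_subring[OF H] by blast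
  obtain g where g: "min_rel K1 X w g" using min_rel_exists[OF sK1 w(1)] by blast
  then have gK: "g \<in> polys_over (polys_over K1)" and g0: "bpoly g X w = 0" by (auto simp: min_rel_def)
  obtain r where r: "eventually_hom ultra UNIV r" "\<And>f. \<forall>\<^sub>F n in ultra. r n (abs_hyper f) = f n"
    "\<And>z n. z \<in> internal K0 \<Longrightarrow> r n z \<in> K0"
    using representatives[of K0 thesis] is_subfieldD(1)[OF K0] by blast
  note r0 = eventually_homD(1)[OF r(1)]
  have U: "is_subfield (UNIV :: hyper set)" by (simp add: is_subfield_def)
  note sU = subfield_imp_subring[OF U]
  define v where "v i = nth ((X + hconst \<kappa>) # Yh) i" for i
  have Xk: "X + hconst \<kappa> = abs_hyper (\<lambda>n. \<sigma> n + \<kappa>)" by (simp add: X_def hconst_def hyper_abs)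
  have v_r: "\<forall>\<^sub>F n in ultra. r n (v i) = nth ((\<sigma> n + \<kappa>) # ys n) i" if "i \<in> qf_vars \<phi>" for i
  proof (cases i)
    case 0
    then show ?thesis using r(2)[of "\<lambda>n. \<sigma> n + \<kappa>"] by (simp add: v_def Xk)
  next
    case (Suc j)
    then have "j < m" using that \<phi>(2) by auto
    then show ?thesis using r(2)[of "\<lambda>n. ys n ! j"] by (simp add: v_def Suc Yh_def)
  qed
  have "\<forall>\<^sub>F n in ultra. qf_sat (nth ((\<sigma> n + \<kappa>) # ys n)) (map_qf_formula (\<lambda>a. a) \<phi>) \<longleftrightarrow> qf_sat v (map_qf_formula hconst \<phi>)"
    using v_r r(2) by (intro qf_transfer[OF r(1) U]) (auto simp: hconst_def)
  then have "\<forall>\<^sub>F n in ultra. qf_sat v (map_qf_formula hconst \<phi>)"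
    using sat by (simp add: qf_formula.map_ident)
  then have sat_h: "qf_sat v (map_qf_formula hconst \<phi>)" using ultra(1) by (simp add: eventually_const)
  define gn where "gn n = map_poly (map_poly (r n)) g" for n
  define S where "S n = (fls_const (\<sigma> n) + fls_X :: complex fls)" for n
  \<comment> \<open>The two conditions are the hypotheses of \<open>hensel_bpoly\<close>; they hold
    at almost every index because their analogues hold for \<open>g\<close>, \<open>X\<close> and
    \<open>w\<close>.\<close>
  define good where "good n \<longleftrightarrow> bpoly (gn n) (\<sigma> n) (r n w) = 0 \<and> bpoly (pderiv (gn n)) (\<sigma> n) (r n w) \<noteq> 0" for n
  have gnK: "gn n \<in> polys_over (polys_over K0)" for n
  proof -
    have "coeff (coeff g i) j \<in> internal K0" for i j
      using coeff_polys_over[OF coeff_polys_over[OF gK]] K1(3) by blast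
    then show ?thesis using r(3) by (simp add: gn_def polys_over_def coeff_map_poly r0)
  qed
  have "\<exists>f. good n \<longrightarrow> bpoly (map_poly (map_poly fls_const) (gn n)) (S n) f = 0 \<and> f \<in> laurent K0" for n
    using hensel_bpoly[of "gn n" "\<sigma> n" "r n w"] K0 \<sigma>(2)[of n] r(3)[OF w(3)] gnK
    unfolding good_def S_def by blast
  then obtain f where f: "\<And>n. good n \<Longrightarrow> bpoly (map_poly (map_poly fls_const) (gn n)) (S n) (f n) = 0"
    "\<And>n. good n \<Longrightarrow> f n \<in> laurent K0" by metis
  have gU: "g \<in> polys_over (polys_over UNIV)" by (simp add: polys_over_def)
  have dgU: "pderiv g \<in> polys_over (polys_over UNIV)" by (simp add: polys_over_def)
  have rX: "\<forall>\<^sub>F n in ultra. r n X = \<sigma> n" using r(2) by (simp add: X_def)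
  have dg: "bpoly (pderiv g) X w \<noteq> 0" by (rule min_rel_pderiv[OF sK1 K1(4) g])
  from eventually_hom_bpoly[OF r(1) sU gU UNIV_I UNIV_I, of X w]
    eventually_hom_bpoly[OF r(1) sU dgU UNIV_I UNIV_I, of X w] rX
    eventually_hom_nonzero[OF r(1) U UNIV_I dg]
    eventually_hom_pderiv[OF eventually_hom_map_poly[OF r(1) sU] is_subring_polys_over[OF sU] gU]
  have ev_good: "\<forall>\<^sub>F n in ultra. good n"
    by eventually_elim (simp add: good_def g0 r0 gn_def)
  \<comment> \<open>On the constants \<open>K1\<close> this follows the representatives, but the
    extension will send \<open>X\<close> to \<open>S n\<close> instead of \<open>\<sigma> n\<close>;
    the transcendence of \<open>X\<close> over \<open>K1\<close> leaves this freedom.\<close>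
  define h where "h n z = fls_const (r n z)" for n z
  have h: "eventually_hom ultra K1 h"
    unfolding eventually_hom_def h_def
  proof (intro conjI allI ballI)
    show "\<forall>\<^sub>F n in ultra. fls_const (r n 1) = 1" using eventually_homD(2)[OF r(1)] by eventually_elim simp
    fix a b
    show "\<forall>\<^sub>F n in ultra. fls_const (r n (a + b)) = fls_const (r n a) + fls_const (r n b)"
      using eventually_homD(3)[OF r(1) UNIV_I UNIV_I, of a b] by eventually_elim (simp add: fls_plus_const)
    show "\<forall>\<^sub>F n in ultra. fls_const (r n (a * b)) = fls_const (r n a) * fls_const (r n b)"
      using eventually_homD(4)[OF r(1) UNIV_I UNIV_I, of a b] by eventually_elim (simp add: fls_const_mult_const)
  qed (simp add: r0)
  have mm: "map_poly (h n) q = map_poly fls_const (map_poly (r n) q)" for n q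
    unfolding h_def by (subst map_poly_map_poly) (simp_all add: r0 o_def)
  have mmm: "map_poly (map_poly (h n)) P = map_poly (map_poly fls_const) (map_poly (map_poly (r n)) P)" for n P
    by (subst map_poly_map_poly) (simp_all add: mm[symmetric] o_def)
  have "hom_extension ultra K1 h X w g S f"
  proof
    show "\<forall>\<^sub>F n in ultra. poly (map_poly (h n) p) (S n) \<noteq> 0" if p: "p \<in> polys_over K1" "p \<noteq> 0" for p
    proof -
      \<comment> \<open>The leading coefficient survives at almost every index, and
        \<open>S n\<close> is a root of no nonzero polynomial over the constants.\<close>
      have "lead_coeff p \<noteq> 0" using p by simp
      from eventually_hom_nonzero[OF r(1) U UNIV_I this] show ?thesis
      proof eventually_elim
        case (elim n)
        then have "coeff (map_poly (r n) p) (degree p) \<noteq> 0" by (simp add: coeff_map_poly r0)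
        then have "map_poly (r n) p \<noteq> 0" by (metis coeff_0)
        then show ?case unfolding mm S_def by (rule poly_shifted_X_nonzero)
      qed
    qed
    show "\<forall>\<^sub>F n in ultra. bpoly (map_poly (map_poly (h n)) g) (S n) (f n) = 0"
      using ev_good by eventually_elim (use f(1) in \<open>simp add: mmm gn_def\<close>)
  qed (fact K1(1) h K1(4) g)+
  then interpret hom_extension ultra K1 h X w g S f .
  obtain h' where h'1: "eventually_hom ultra (adjoin (adjoin K1 X) w) h'"
    and h'2: "\<forall>a\<in>K1. \<forall>\<^sub>F n in ultra. h' n a = h n a" and h'3: "\<forall>\<^sub>F n in ultra. h' n X = S n"
    and h'4: "\<forall>n E. is_subfield E \<longrightarrow> h n ` K1 \<subseteq> E \<longrightarrow> S n \<in> E \<longrightarrow> f n \<in> E \<longrightarrow>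
      h' n ` adjoin (adjoin K1 X) w \<subseteq> E"
    using extension by (elim exE conjE)
  note h' = h'1 bspec[OF h'2] h'3 h'4[rule_format]
  let ?L = "adjoin (adjoin K1 X) w"
  have L: "is_subfield ?L" by (rule is_subfield_adjoin[OF subfield_imp_subring[OF k]])
  have K1L: "K1 \<subseteq> ?L" using base_in_adjoin[OF sK1] base_in_adjoin[OF subfield_imp_subring[OF k]] by blast
  have XL: "X \<in> ?L" using gen_in_adjoin[OF sK1] base_in_adjoin[OF subfield_imp_subring[OF k]] by blast
  have cK1: "hconst a \<in> K1" if "a \<in> K0" for a using K1(2) that by blast
  have hc: "\<forall>\<^sub>F n in ultra. h' n (hconst a) = fls_const a" if "a \<in> K0" for a
    using h'(2)[OF cK1[OF that]] r(2)[of "\<lambda>_. a"] by eventually_elim (simp add: h_def hconst_def)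
  define V where "V n i = nth ((S n + fls_const \<kappa>) # map (h' n) Yh) i" for n i
  have vL: "v i \<in> ?L \<and> (\<forall>\<^sub>F n in ultra. h' n (v i) = V n i)" if "i \<in> qf_vars \<phi>" for i
  proof (cases i)
    case 0
    have kL: "hconst \<kappa> \<in> ?L" using cK1[OF \<kappa>] K1L by blast
    have "\<forall>\<^sub>F n in ultra. h' n (X + hconst \<kappa>) = S n + fls_const \<kappa>"
      using eventually_homD(3)[OF h'(1) XL kL] h'(3) hc[OF \<kappa>] by eventually_elim simp
    then show ?thesis using is_subfieldD(3)[OF L XL kL] by (simp add: 0 v_def V_def)
  next
    case (Suc j)
    then have "j < length Yh" using that \<phi>(2) by (auto simp: Yh_def)
    then show ?thesis using w(2) nth_mem[of j Yh] by (auto simp: Suc v_def V_def)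
  qed
  have "\<forall>\<^sub>F n in ultra. qf_sat (V n) (map_qf_formula fls_const \<phi>) \<longleftrightarrow> qf_sat v (map_qf_formula hconst \<phi>)"
  proof (rule qf_transfer[OF h'(1) L _ vL])
    show "hconst a \<in> ?L \<and> (\<forall>\<^sub>F n in ultra. h' n (hconst a) = fls_const a)" if "a \<in> qf_params \<phi>" for a
      using that \<phi>(1) hc cK1 K1L by blast
  qed
  with ev_good have "\<forall>\<^sub>F n in ultra. good n \<and> qf_sat (V n) (map_qf_formula fls_const \<phi>)"
    by eventually_elim (use sat_h in simp)
  then obtain n where n: "good n" "qf_sat (V n) (map_qf_formula fls_const \<phi>)"
    using eventually_happens'[OF ultra(1)] by blast
  have C0: "is_subfield (fls_const ` K0)" by (rule is_subfield_image_fls_const[OF K0])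
  note sC0 = subfield_imp_subring[OF C0]
  have C1: "is_subfield (adjoin (fls_const ` K0) (S n))" by (rule is_subfield_adjoin[OF sC0])
  note sC1 = subfield_imp_subring[OF C1]
  define E where "E = adjoin (adjoin (fls_const ` K0) (S n)) (f n)"
  have E: "is_subfield E" unfolding E_def by (rule is_subfield_adjoin[OF sC1])
  have "h' n ` ?L \<subseteq> E"
  proof (rule h'(4)[OF E])
    have "r n ` K1 \<subseteq> K0" using K1(3) r(3) by blast
    then have "h n ` K1 \<subseteq> fls_const ` K0" by (auto simp: h_def)
    then show "h n ` K1 \<subseteq> E" unfolding E_def using base_in_adjoin[OF sC0] base_in_adjoin[OF sC1] by blast
    show "S n \<in> E" unfolding E_def using gen_in_adjoin[OF sC0] base_in_adjoin[OF sC1] by blast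
    show "f n \<in> E" unfolding E_def by (rule gen_in_adjoin[OF sC1])
  qed
  then have YE: "set (map (h' n) Yh) \<subseteq> E" using w(2) by auto
  have alg: "alg_over (adjoin (fls_const ` K0) (S n)) (f n)"
  proof -
    define Q where "Q = map_poly (map_poly fls_const) (gn n)"
    have "gn n \<noteq> 0" using n(1) by (auto simp: good_def)
    then have Q0: "Q \<noteq> 0" unfolding Q_def by (rule map_poly_map_poly_fls_const_nonzero)
    have QK: "Q \<in> polys_over (polys_over (fls_const ` K0))"
      using coeff_polys_over[OF coeff_polys_over[OF gnK]] by (simp add: Q_def polys_over_def coeff_map_poly)
    have St: "\<not> alg_over (fls_const ` K0) (S n)"
      using shifted_X_transcendental alg_over_mono[of "fls_const ` K0" "range fls_const"] unfolding S_def by blast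
    show ?thesis unfolding alg_over_def
      using map_poly_eval_in_adjoin[OF sC0 QK] map_poly_eval_nonzero[OF St QK Q0] f(1)[OF n(1)]
      by (intro bexI[of _ "map_poly (\<lambda>q. poly q (S n)) Q"]) (simp_all add: Q_def bpoly_altdef)
  qed
  have "V n = nth ((S n + fls_const \<kappa>) # map (h' n) Yh)" by (rule ext) (simp add: V_def)
  then show ?thesis
    using n(2) f(2)[OF n(1)] alg YE unfolding E_def S_def
    by (intro exI[of _ n] exI[of _ "f n"] exI[of _ "map (h' n) Yh"]) (simp add: Yh_def)
qed

section \<open>Rational polynomials in two variables and integral generators\<close>

lemma rbpoly_simps [simp]:
  "rbpoly 0 x w = 0" "rbpoly (pCons B G) x w = rpoly B x + w * rbpoly G x w"
  "rbpoly (P * Q) x w = rbpoly P x w * rbpoly Q x w" "rbpoly (P + Q) x w = rbpoly P x w + rbpoly Q x w"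
  by (simp_all add: rbpoly_def Polynomial.map_poly_pCons map_poly_rpoly_ring)

lemma rbpoly_smult [simp]: "rbpoly (smult B G) x w = rpoly B x * rbpoly G x w"
  by (induction G) (simp_all add: algebra_simps)

lemma rbpoly_monom [simp]: "rbpoly (monom B n) x w = rpoly B x * w ^ n"
  by (induction n) (simp_all add: monom_Suc monom_0)

lemma rbpoly_sum: "rbpoly (\<Sum>i\<in>I. f i) x w = (\<Sum>i\<in>I. rbpoly (f i) x w)"
  by (induction I rule: infinite_finite_induct) simp_all

lemma rbpoly_altdef: "rbpoly G x w = (\<Sum>j\<le>degree G. rpoly (coeff G j) x * w ^ j)"
  by (subst poly_as_sum_of_monoms[of G, symmetric]) (simp add: rbpoly_sum)

lemma rbpoly_in_subfield:
  assumes E: "is_subfield E" "x \<in> E" "w \<in> E"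
  shows "rpoly B x \<in> E" "rbpoly G x w \<in> E"
proof -
  note sE = subfield_imp_subring[OF E(1)]
  have q: "of_rat r \<in> E" for r
  proof (cases r)
    case (Fract a b)
    then show ?thesis using subfield_divide[OF E(1) subring_of_int[OF sE, of a] subring_of_int[OF sE, of b]]
      by (simp add: of_rat_rat)
  qed
  show r: "rpoly B x \<in> E" for B
    by (induction B) (auto intro!: is_subringD[OF sE] q E)
  show "rbpoly G x w \<in> E"
    by (induction G) (auto intro!: is_subringD[OF sE] r E)
qed

lemma Rats_subset_subfield: "is_subfield E \<Longrightarrow> (\<rat> :: 'a::field_char_0 set) \<subseteq> E"
  using rbpoly_in_subfield(1)[of E 0 0 "[:_:]"] is_subfieldD(1)[of E] by (auto elim!: Rats_cases)

lemma eventually_hom_rpoly: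
  fixes h :: "'n \<Rightarrow> 'a::field_char_0 \<Rightarrow> 'b::field_char_0"
  assumes h: "eventually_hom F L h" and L: "is_subfield L" and x: "x \<in> L"
  shows "\<forall>\<^sub>F n in F. h n (rpoly B x) = rpoly B (h n x)"
proof (induction B)
  case (pCons a B)
  have B: "rpoly B x \<in> L" and a: "of_rat a \<in> L"
    using rbpoly_in_subfield(1)[OF L x x, of B] rbpoly_in_subfield(1)[OF L x x, of "[:a:]"] by simp_all
  from eventually_homD(3)[OF h a is_subfieldD(4)[OF L x B]] eventually_homD(4)[OF h x B]
    eventually_hom_of_rat[OF h L, of a] pCons.IH
  show ?case by eventually_elim simp
qed (use eventually_homD(1)[OF h] in simp)

lemma eventually_hom_rbpoly:
  fixes h :: "'n \<Rightarrow> 'a::field_char_0 \<Rightarrow> 'b::field_char_0"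
  assumes h: "eventually_hom F L h" and L: "is_subfield L" and x: "x \<in> L" "w \<in> L"
  shows "\<forall>\<^sub>F n in F. h n (rbpoly G x w) = rbpoly G (h n x) (h n w)"
proof (induction G)
  case (pCons B G)
  have B: "rpoly B x \<in> L" and G: "rbpoly G x w \<in> L"
    using rbpoly_in_subfield[OF L x] by simp_all
  from eventually_homD(3)[OF h B is_subfieldD(4)[OF L x(2) G]] eventually_homD(4)[OF h x(2) G]
    eventually_hom_rpoly[OF h L x(1), of B] pCons.IH
  show ?case by eventually_elim simp
qed (use eventually_homD(1)[OF h] in simp)

text \<open>Clearing denominators turns a relation over \<rat>(S) into one with coefficients of type
  \<open>rat poly\<close>, of the same degree because \<open>S\<close> is transcendental.\<close>

lemma rational_lift:
  fixes S :: "'a::field_char_0"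
  assumes S: "\<not> alg_over \<rat> S" and p: "p \<in> polys_over (adjoin \<rat> S)" "p \<noteq> 0"
  shows "\<exists>H d. H \<noteq> 0 \<and> degree H = degree p \<and> d \<noteq> 0 \<and> (\<forall>w. rbpoly H S w = d * poly p w)"
proof -
  have Q: "is_subring (\<rat> :: 'a set)" by (rule subfield_imp_subring[OF is_subfield_Rats])
  obtain d P where d: "P \<in> polys_over (polys_over \<rat>)" "poly d S \<noteq> 0"
    "map_poly (\<lambda>q. poly q S) P = smult (poly d S) p" using clear_denominators[OF Q p(1)] by blast
  define c where "c = (map_poly of_rat :: rat poly \<Rightarrow> 'a poly)"
  have c0: "c 0 = 0" by (simp add: c_def)
  have injc: "inj c" unfolding c_def by (intro injI poly_eqI) (metis coeff_map_poly of_rat_0 of_rat_eq_iff)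
  have "polys_over \<rat> \<subseteq> range c" using polys_over_Rats unfolding c_def by blast
  then have "P \<in> polys_over (c ` UNIV)" using polys_over_mono[of "polys_over \<rat>" "range c"] d(1) by blast
  then obtain H where H: "P = map_poly c H" using poly_over_image[of P c UNIV] c0 injc by auto
  have rb: "rbpoly H S w = poly d S * poly p w" for w
  proof -
    have "rbpoly H S w = poly (map_poly (\<lambda>q. poly q S) P) w"
      unfolding rbpoly_def H by (subst map_poly_map_poly) (simp_all add: c0 o_def c_def rpoly_def[abs_def])
    then show ?thesis by (simp add: d(3))
  qed
  have P0: "P \<noteq> 0" using d(2,3) p(2) by auto
  have "lead_coeff P \<in> polys_over \<rat>" "lead_coeff P \<noteq> 0" using d(1) P0 by (auto simp: coeff_polys_over)
  then have "poly (lead_coeff P) S \<noteq> 0" using S by (auto simp: alg_over_def)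
  then have "coeff (map_poly (\<lambda>q. poly q S) P) (degree P) \<noteq> 0" by (simp add: coeff_map_poly)
  then have "degree P = degree (map_poly (\<lambda>q. poly q S) P)"
    using degree_map_poly_le[of "\<lambda>q. poly q S" P] le_degree by (metis le_antisym)
  then have "degree P = degree p" using d(2,3) by simp
  moreover have "c q = 0 \<longleftrightarrow> q = 0" for q using injD[OF injc, of q 0] c0 by auto
  then have "degree H = degree P" unfolding H by (intro degree_map_poly[symmetric]) auto
  moreover have "H \<noteq> 0" using P0 H by auto
  ultimately show ?thesis using rb d(2) by (intro exI[of _ H] exI[of _ "poly d S"]) auto
qed

lemma integral_multiple:
  fixes H :: "rat poly poly"
  shows "\<exists>d::int. d \<noteq> 0 \<and> smult [:of_int d:] H \<in> polys_over (polys_over \<int>)"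
proof (induction H)
  case 0
  show ?case by (intro exI[of _ 1]) (auto simp: polys_over_def)
next
  case (pCons B H)
  then obtain d where d: "d \<noteq> 0" "smult [:of_int d:] H \<in> polys_over (polys_over \<int>)" by blast
  obtain e Q where e: "e \<noteq> 0" "smult (of_int e) B = map_poly rat_of_int Q" using common_denominator by blast
  note P = is_subring_polys_over[OF is_subring_Ints]
  have "smult [:of_int (d * e):] (pCons B H)
      = pCons (smult (of_int d) (smult (of_int e) B)) (smult [:of_int e:] (smult [:of_int d:] H))"
    by (simp add: mult.commute)
  moreover have 1: "smult (of_int d) (smult (of_int e) B) \<in> polys_over \<int>"
    unfolding e(2) by (simp add: polys_over_def coeff_map_poly)
  moreover have "[:of_int e:] \<in> polys_over (\<int> :: rat set)" by (auto simp: polys_over_def coeff_pCons split: nat.split)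
  then have 2: "smult [:of_int e:] (smult [:of_int d:] H) \<in> polys_over (polys_over \<int>)"
    by (intro polys_over_smult P d)
  have "pCons (smult (of_int d) (smult (of_int e) B)) (smult [:of_int e:] (smult [:of_int d:] H))
      \<in> polys_over (polys_over \<int>)"
    unfolding polys_over_pCons[OF P] using 1 2 by blast
  ultimately have "smult [:of_int (d * e):] (pCons B H) \<in> polys_over (polys_over \<int>)"
    by (simp only:)
  then show ?case using d e by (intro exI[of _ "d * e"]) auto
qed

text \<open>The minimal polynomial of \<open>w\<close> over \<rat>(S) in the case where it is monic
  over \<int>[S], which is the form that \<open>hilbert_irreducibility_root\<close> accepts.\<close>

definition minimal_integral :: "'a::field_char_0 \<Rightarrow> 'a \<Rightarrow> rat poly poly \<Rightarrow> bool" where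
  "minimal_integral S w G \<longleftrightarrow> G \<in> polys_over (polys_over \<int>) \<and> lead_coeff G = 1 \<and> rbpoly G S w = 0 \<and>
     (\<forall>H. H \<noteq> 0 \<longrightarrow> degree H < degree G \<longrightarrow> rbpoly H S w \<noteq> 0)"

text \<open>If \<open>c\<close> is the leading coefficient of a minimal relation of degree
  \<open>n\<close>, multiplying it by \<open>c ^ (n - 1)\<close> makes it monic in
  \<open>c * w\<close>.\<close>

lemma minimal_integral_exists:
  fixes S :: "'a::field_char_0"
  assumes S: "\<not> alg_over \<rat> S" and w: "alg_over (adjoin \<rat> S) w"
  shows "\<exists>l\<in>adjoin \<rat> S. l \<noteq> 0 \<and> (\<exists>G. minimal_integral S (l * w) G)"
proof -
  obtain p where p: "p \<in> polys_over (adjoin \<rat> S)" "p \<noteq> 0" "poly p w = 0" using w by (auto simp: alg_over_def)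
  obtain H0 where H0: "H0 \<noteq> 0" "rbpoly H0 S w = 0" using rational_lift[OF S p(1,2)] p(3) by auto
  define \<H> where "\<H> = {H. H \<noteq> 0 \<and> rbpoly H S w = 0}"
  have "H0 \<in> \<H>" using H0 by (simp add: \<H>_def)
  then obtain H where H: "H \<in> \<H>" "\<And>H'. H' \<in> \<H> \<Longrightarrow> degree H \<le> degree H'"
    using ex_has_least_nat[of "\<lambda>H. H \<in> \<H>" H0 degree] by blast
  obtain d :: int where d: "d \<noteq> 0" "smult [:of_int d:] H \<in> polys_over (polys_over \<int>)" using integral_multiple by blast
  define I where "I = smult [:of_int d:] H"
  have I: "I \<in> polys_over (polys_over \<int>)" "I \<noteq> 0" "rbpoly I S w = 0" "degree I = degree H"
    using H(1) d by (auto simp: I_def \<H>_def)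
  define n where "n = degree I"
  define c where "c = lead_coeff I"
  have c: "c \<noteq> 0" unfolding c_def leading_coeff_0_iff by (rule I(2))
  have cI: "c \<in> polys_over \<int>" unfolding c_def by (rule coeff_polys_over[OF I(1)])
  define l where "l = rpoly c S"
  have l: "l \<noteq> 0" using S c map_poly_of_rat_over[of c] unfolding l_def rpoly_def alg_over_def
    by (metis map_poly_eq_0_iff of_rat_0 of_rat_eq_0_iff)
  have n0: "n \<noteq> 0"
  proof
    assume "n = 0"
    then obtain q where "I = [:q:]" unfolding n_def by (metis degree_eq_zeroE)
    then show False using I(2,3) l by (auto simp: l_def c_def)
  qed
  note P = is_subring_polys_over[OF is_subring_Ints]
  note PP = is_subring_polys_over[OF P]
  define G where "G = monom 1 n + (\<Sum>j<n. monom (coeff I j * c ^ (n - 1 - j)) j)"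
  have cG: "coeff G j = (if j = n then 1 else if j < n then coeff I j * c ^ (n - 1 - j) else 0)" for j
    by (auto simp: G_def coeff_sum)
  have "degree G \<le> n" by (intro degree_le) (simp add: cG)
  moreover have "coeff G n = 1" by (simp add: cG)
  ultimately have dG: "degree G = n" by (metis le_degree le_antisym zero_neq_one)
  have GI: "G \<in> polys_over (polys_over \<int>)" unfolding G_def
    by (intro is_subringD(3)[OF PP] subring_sum[OF PP] polys_over_monom[OF P] is_subringD(2)[OF P]
        is_subringD(4)[OF P] subring_power[OF P] cI coeff_polys_over[OF I(1)])
  have "rbpoly G S (l * w) = (l * w) ^ n + (\<Sum>j<n. rpoly (coeff I j * c ^ (n - 1 - j)) S * (l * w) ^ j)"
    by (simp add: G_def rbpoly_sum)
  also have "(\<Sum>j<n. rpoly (coeff I j * c ^ (n - 1 - j)) S * (l * w) ^ j)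
      = (\<Sum>j<n. l ^ (n - 1) * (rpoly (coeff I j) S * w ^ j))"
  proof (rule sum.cong[OF refl])
    fix j assume "j \<in> {..<n}"
    then have e: "l ^ (n - 1) = l ^ (n - 1 - j) * l ^ j" by (simp flip: power_add)
    have "rpoly (c ^ m) S = l ^ m" for m by (induction m) (simp_all add: l_def)
    then show "rpoly (coeff I j * c ^ (n - 1 - j)) S * (l * w) ^ j = l ^ (n - 1) * (rpoly (coeff I j) S * w ^ j)"
      unfolding e by (simp add: power_mult_distrib)
  qed
  also have "(l * w) ^ n = l ^ (n - 1) * (rpoly (coeff I n) S * w ^ n)"
    using n0 by (cases n) (simp_all add: l_def c_def n_def[symmetric] power_mult_distrib)
  also have "l ^ (n - 1) * (rpoly (coeff I n) S * w ^ n) + (\<Sum>j<n. l ^ (n - 1) * (rpoly (coeff I j) S * w ^ j))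
      = l ^ (n - 1) * rbpoly I S w"
    unfolding rbpoly_altdef n_def[symmetric] lessThan_Suc_atMost[symmetric]
    by (simp add: sum_distrib_left distrib_left add.commute)
  finally have Gz: "rbpoly G S (l * w) = 0" using I(3) by simp
  have "rbpoly H' S (l * w) \<noteq> 0" if H': "H' \<noteq> 0" "degree H' < degree G" for H'
  proof
    assume z: "rbpoly H' S (l * w) = 0"
    \<comment> \<open>Substituting \<open>c * w\<close> into \<open>H'\<close> gives a relation for
      \<open>w\<close> itself of no larger degree.\<close>
    define J where "J = (\<Sum>j\<le>degree H'. monom (coeff H' j * c ^ j) j)"
    have cJ: "coeff J j = (if j \<le> degree H' then coeff H' j * c ^ j else 0)" for j
      by (simp add: J_def coeff_sum)
    have "coeff J (degree H') \<noteq> 0" using H' c by (simp add: cJ)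
    then have "J \<noteq> 0" by (metis coeff_0)
    have pc: "rpoly (c ^ m) S = l ^ m" for m by (induction m) (simp_all add: l_def)
    have "rbpoly J S w = rbpoly H' S (l * w)"
      unfolding rbpoly_altdef[of H'] J_def rbpoly_sum
      by (intro sum.cong refl) (simp add: pc power_mult_distrib)
    then have "J \<in> \<H>" using z \<open>J \<noteq> 0\<close> by (simp add: \<H>_def)
    moreover have "degree J \<le> degree H'" by (intro degree_le) (simp add: cJ)
    ultimately show False using H(2)[of J] H'(2) dG I(4) by (simp add: n_def)
  qed
  moreover have "l \<in> adjoin \<rat> S" unfolding l_def by (rule rpoly_in_adjoin)
  ultimately show ?thesis using l Gz GI dG \<open>coeff G n = 1\<close>
    by (intro bexI[of _ l] conjI exI[of _ G]) (auto simp: minimal_integral_def)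
qed

lemma minimal_integral_irreducible:
  assumes G: "minimal_integral S w G" and f: "lead_coeff A = 1" "lead_coeff A' = 1" "G = A * A'"
  shows "degree A = 0 \<or> degree A' = 0"
proof (rule ccontr)
  assume n: "\<not> ?thesis"
  have A0: "A \<noteq> 0" "A' \<noteq> 0" using f by auto
  then have "degree G = degree A + degree A'" using f by (simp add: degree_mult_eq)
  then have "degree A < degree G" "degree A' < degree G" using n by auto
  then have "rbpoly A S w \<noteq> 0" "rbpoly A' S w \<noteq> 0" using G A0 by (auto simp: minimal_integral_def)
  then show False using G f by (auto simp: minimal_integral_def)
qed

lemma minimal_integral_poly:
  fixes S :: "'a::field_char_0"
  assumes G: "minimal_integral S w G" and S: "\<not> alg_over \<rat> S"
    and p: "p \<in> polys_over (adjoin \<rat> S)" "p \<noteq> 0" "degree p < degree G"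
  shows "poly p w \<noteq> 0"
proof -
  obtain H d where H: "H \<noteq> 0" "degree H = degree p" "d \<noteq> 0" "\<And>w. rbpoly H S w = d * poly p w"
    using rational_lift[OF S p(1,2)] by blast
  then show ?thesis using G p(3) by (auto simp: minimal_integral_def)
qed

section \<open>Specialization to number fields\<close>

lemma fls_const_of_rat: "fls_const (of_rat q) = (of_rat q :: 'a::field_char_0 fls)"
proof -
  \<comment> \<open>Over a one-point principal filter an eventual homomorphism is an ordinary
    one.\<close>
  have "eventually_hom (principal {()}) UNIV (\<lambda>_. fls_const :: 'a \<Rightarrow> 'a fls)"
    by (simp add: eventually_hom_def eventually_principal fls_plus_const fls_const_mult_const)
  moreover have "is_subfield (UNIV :: 'a set)" by (simp add: is_subfield_def)
  ultimately have "\<forall>\<^sub>F n in principal {()}. fls_const (of_rat q :: 'a) = of_rat q"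
    by (rule eventually_hom_of_rat)
  then show ?thesis by (simp add: eventually_principal)
qed

lemma poly_fls_const: "poly (map_poly fls_const p) (fls_const c) = fls_const (poly p c :: 'a::field)"
  by (induction p) (simp_all add: Polynomial.map_poly_pCons fls_plus_const fls_const_mult_const)

lemma alg_over_Rats_iff: "alg_over \<rat> (z :: 'a::field_char_0) \<longleftrightarrow> algebraic z"
  unfolding alg_over_def algebraic_altdef polys_over_def by auto

lemma fls_const_alg:
  fixes c :: "'a::field_char_0"
  assumes "algebraic c" shows "alg_over \<rat> (fls_const c)"
proof -
  obtain p where p: "\<And>i. coeff p i \<in> \<rat>" "p \<noteq> 0" "poly p c = 0" using assms by (auto simp: algebraic_altdef)
  have "fls_const (coeff p i) \<in> \<rat>" for i
    using p(1)[of i] by (auto elim!: Rats_cases simp: fls_const_of_rat)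
  then have "map_poly fls_const p \<in> polys_over \<rat>" by (simp add: polys_over_def coeff_map_poly)
  moreover have "fls_const (lead_coeff p) \<noteq> 0" using p(2) by (intro fls_const_nonzero) simp
  then have "coeff (map_poly fls_const p) (degree p) \<noteq> 0" by (simp add: coeff_map_poly)
  then have "map_poly fls_const p \<noteq> 0" by (metis coeff_0)
  moreover have "poly (map_poly fls_const p) (fls_const c) = 0" using p(3) by (simp add: poly_fls_const)
  ultimately show ?thesis unfolding alg_over_def by blast
qed

lemma finite_rterm_params: "finite (rterm_params t)"
  by (induction t) auto

lemma finite_qf_params: "finite (qf_params \<phi>)"
  by (induction \<phi>) (auto simp: finite_rterm_params)

lemma monic_map_rpoly:
  fixes x :: "'a::field_char_0"
  assumes "lead_coeff L = 1"
  shows "map_poly (\<lambda>B. rpoly B x) L \<in> polys_over (adjoin \<rat> x)" "map_poly (\<lambda>B. rpoly B x) L \<noteq> 0"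
    "degree (map_poly (\<lambda>B. rpoly B x) L) = degree L"
proof -
  show "degree (map_poly (\<lambda>B. rpoly B x) L) = degree L" by (rule lead_coeff_map_rpoly(2)[OF assms])
  show "map_poly (\<lambda>B. rpoly B x) L \<noteq> 0" using lead_coeff_map_rpoly(1)[OF assms, of x] by auto
  show "map_poly (\<lambda>B. rpoly B x) L \<in> polys_over (adjoin \<rat> x)"
    by (simp add: polys_over_def coeff_map_poly rpoly_in_adjoin)
qed

text \<open>\<open>S\<close> is transcendental over the constants, so it may be sent to almost any
  complex \<open>s\<close> with the constants fixed; \<open>f\<close> then goes to a root of its
  specialized relation, which exists over the complex numbers.\<close>

lemma specialization:
  fixes f :: "complex fls" and s0 :: complex
  defines "S \<equiv> fls_const s0 + fls_X" and "C \<equiv> range fls_const"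
  assumes f: "alg_over (adjoin C S) f"
  shows "\<exists>h'. eventually_hom cofinite (adjoin (adjoin C S) f) h' \<and>
    (\<forall>c. \<forall>\<^sub>F s in cofinite. h' s (fls_const c) = c) \<and> (\<forall>\<^sub>F s in cofinite. h' s S = s)"
proof -
  have U: "is_subfield (UNIV :: complex set)" by (simp add: is_subfield_def)
  have C: "is_subfield C" unfolding C_def by (rule is_subfield_image_fls_const[OF U])
  note sC = subfield_imp_subring[OF C]
  have St: "\<not> alg_over C S" unfolding C_def S_def by (rule shifted_X_transcendental)
  \<comment> \<open>On constant series, taking the coefficient at 0 inverts
    \<open>fls_const\<close>.\<close>
  define h :: "complex \<Rightarrow> complex fls \<Rightarrow> complex" where "h s z = fls_nth z 0" for s z
  have h: "eventually_hom cofinite C h"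
    unfolding eventually_hom_def C_def h_def by (auto simp: fls_plus_const fls_const_mult_const)
  obtain g where g: "min_rel C S f g" using min_rel_exists[OF sC f] by blast
  have X': "\<forall>\<^sub>F s in cofinite. poly (map_poly (h s) p) s \<noteq> 0" if p: "p \<in> polys_over C" "p \<noteq> 0" for p
  proof -
    obtain q where q: "p = map_poly fls_const q" using poly_over_image[of p fls_const UNIV] p inj_fls_const by (auto simp: C_def)
    have "map_poly (h s) p = q" for s
      unfolding q by (intro poly_eqI) (simp add: coeff_map_poly h_def)
    moreover have "finite {s. poly q s = 0}" using p q by (intro poly_roots_finite) auto
    ultimately show ?thesis by (simp add: eventually_cofinite)
  qed
  define w' where "w' s = (SOME w. bpoly (map_poly (map_poly (h s)) g) s w = 0)" for s
  have w': "\<forall>\<^sub>F s in cofinite. bpoly (map_poly (map_poly (h s)) g) s (w' s) = 0"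
  proof -
    \<comment> \<open>Away from the roots of the leading coefficient the degree does not drop, so a
      root exists.\<close>
    have l: "lead_coeff g \<in> polys_over C" "lead_coeff g \<noteq> 0" using g by (auto simp: min_rel_def coeff_polys_over)
    from X'[OF l] show ?thesis
    proof eventually_elim
      case (elim s)
      define q where "q = map_poly (\<lambda>q. poly q s) (map_poly (map_poly (h s)) g)"
      have "coeff q (degree g) = poly (map_poly (h s) (lead_coeff g)) s"
        by (simp add: q_def coeff_map_poly h_def)
      then have "degree q \<ge> degree g" using elim by (intro le_degree) simp
      then have "degree q \<noteq> 0" using min_rel_degree_pos[OF St g] by simp
      then obtain w where "poly q w = 0" using fundamental_theorem_of_algebra[of q] constant_degree[of q] by metis
      then have "bpoly (map_poly (map_poly (h s)) g) s w = 0" by (simp add: bpoly_altdef q_def)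
      then show ?case unfolding w'_def by (rule someI)
    qed
  qed
  interpret hom_extension cofinite C h S f g "\<lambda>s. s" w'
    by (intro hom_extension.intro C h St g X' w')
  obtain h' where 1: "eventually_hom cofinite (adjoin (adjoin C S) f) h'"
    and 2: "\<forall>a\<in>C. \<forall>\<^sub>F n in cofinite. h' n a = h n a" and 3: "\<forall>\<^sub>F n in cofinite. h' n S = n"
    using extension by (elim exE conjE)
  have "\<forall>\<^sub>F s in cofinite. h' s (fls_const c) = c" for c
    using bspec[OF 2, of "fls_const c"] by (simp add: C_def h_def)
  with 1 3 show ?thesis by blast
qed

text \<open>Membership of \<beta> in \<open>E s\<close> is excluded by degrees: every element of
  \<open>E s\<close> has degree at most \<open>degree G\<close> over \<rat>(s), whereas Hilbert
  irreducibility gives \<open>h s (w \<beta>)\<close> at least the larger degree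
  \<open>degree (G' \<beta>)\<close>.\<close>

theorem number_field_point:
  fixes K0 :: "complex set" and s0 \<kappa> :: complex
  defines "S \<equiv> fls_const s0 + fls_X"
  assumes K0: "is_subfield K0" "K0 \<subseteq> Qbar" and \<phi>: "qf_params \<phi> \<subseteq> K0" "qf_vars \<phi> \<subseteq> {..m}"
    and s0: "s0 \<in> \<rat>" and Y: "length Y = m" "set Y \<subseteq> adjoin (adjoin (fls_const ` K0) S) f"
    and f: "f \<in> laurent K0" "alg_over (adjoin (fls_const ` K0) S) f"
    and sat: "qf_sat (nth ((S + fls_const \<kappa>) # Y)) (map_qf_formula fls_const \<phi>)"
    and a: "finite a" "a \<subseteq> K0" and b: "finite b" "b \<subseteq> Qbar" "b \<inter> K0 = {}"
  shows "\<exists>E s ys. is_subfield E \<and> E \<subseteq> Qbar \<and> a \<union> qf_params \<phi> \<subseteq> E \<and> b \<inter> E = {} \<and> s \<in> E \<and>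
    algebraic_int s \<and> length ys = m \<and> set ys \<subseteq> E \<and> qf_sat (nth ((s + \<kappa>) # ys)) \<phi>"
proof -
  have U: "is_subfield (UNIV :: complex set)" by (simp add: is_subfield_def)
  define C where "C = range (fls_const :: complex \<Rightarrow> complex fls)"
  have C: "is_subfield C" unfolding C_def by (rule is_subfield_image_fls_const[OF U])
  note sC = subfield_imp_subring[OF C]
  have C0: "is_subfield (fls_const ` K0)" by (rule is_subfield_image_fls_const[OF K0(1)])
  note sC0 = subfield_imp_subring[OF C0]
  have Q: "is_subfield (\<rat> :: complex fls set)" by (rule is_subfield_Rats)
  note sQ = subfield_imp_subring[OF Q]
  have QC: "(\<rat> :: complex fls set) \<subseteq> C" by (rule Rats_subset_subfield[OF C])
  have StC: "\<not> alg_over C S" unfolding C_def S_def by (rule shifted_X_transcendental)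
  then have St: "\<not> alg_over \<rat> S" using alg_over_mono[OF QC] by blast
  \<comment> \<open>The base is \<rat>(S) and not \<open>K0(S)\<close>, since Hilbert irreducibility
    is available for rational coefficients; the constants from \<open>a\<close> and \<phi> join the
    coordinates in \<open>Z\<close>.\<close>
  define k where "k = adjoin \<rat> S"
  have k: "is_subfield k" unfolding k_def by (rule is_subfield_adjoin[OF sQ])
  note sk = subfield_imp_subring[OF k]
  have Sk: "S \<in> k" unfolding k_def by (rule gen_in_adjoin[OF sQ])
  have Qk: "\<rat> \<subseteq> k" by (rule Rats_subset_subfield[OF k])
  have const_alg: "alg_over k (fls_const c)" if "c \<in> Qbar" for c
    using that fls_const_alg[of c] alg_over_mono[OF Qk] by (simp add: Qbar_def)
  define A where "A = {z. alg_over k z}"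
  have A: "is_subfield A" unfolding A_def by (rule is_subfield_alg[OF k])
  note sA = subfield_imp_subring[OF A]
  have "fls_const ` K0 \<subseteq> A" using const_alg K0(2) by (auto simp: A_def)
  moreover have "S \<in> A" using base_alg[OF k Sk] by (simp add: A_def)
  ultimately have A1: "adjoin (fls_const ` K0) S \<subseteq> A" by (intro adjoin_subset A)
  have "f \<in> A" using alg_trans[OF k] alg_over_mono[OF A1 f(2)] unfolding A_def by simp
  then have A2: "adjoin (adjoin (fls_const ` K0) S) f \<subseteq> A" by (intro adjoin_subset A A1)
  have M: "is_subfield (laurent K0)" by (rule is_subfield_laurent[OF K0(1)])
  note sM = subfield_imp_subring[OF M]
  have s0K: "s0 \<in> K0" using s0 Rats_subset_subfield[OF K0(1)] by blast
  have SM: "S \<in> laurent K0" unfolding S_def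
    by (intro is_subfieldD(3)[OF M]) (simp_all add: fls_const_in_laurent fls_X_in_laurent K0 s0K)
  have cM: "fls_const ` K0 \<subseteq> laurent K0" using fls_const_in_laurent[OF K0(1)] by auto
  have M2: "adjoin (adjoin (fls_const ` K0) S) f \<subseteq> laurent K0"
    by (intro adjoin_subset M cM SM f)
  have kM: "k \<subseteq> laurent K0" unfolding k_def by (intro adjoin_subset M Rats_subset_subfield SM)
  define L where "L = adjoin (adjoin C S) f"
  have CS: "is_subfield (adjoin C S)" by (rule is_subfield_adjoin[OF sC])
  note sCS = subfield_imp_subring[OF CS]
  have L: "is_subfield L" unfolding L_def by (rule is_subfield_adjoin[OF sCS])
  note sL = subfield_imp_subring[OF L]
  have CSL: "adjoin C S \<subseteq> L" unfolding L_def using base_in_adjoin[OF sCS] by blast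
  have CL: "C \<subseteq> L" using base_in_adjoin[OF sC] CSL by blast
  have SL: "S \<in> L" using gen_in_adjoin[OF sC] CSL by blast
  have kL: "k \<subseteq> L" unfolding k_def by (intro adjoin_subset L SL Rats_subset_subfield)
  have C0C: "fls_const ` K0 \<subseteq> C" by (auto simp: C_def)
  have C0S: "adjoin (fls_const ` K0) S \<subseteq> adjoin C S"
    by (intro adjoin_subset CS gen_in_adjoin[OF sC] subset_trans[OF C0C]) (use base_in_adjoin[OF sC] in blast)
  have YL: "adjoin (adjoin (fls_const ` K0) S) f \<subseteq> L"
    by (intro adjoin_subset L subset_trans[OF C0S CSL]) (simp add: L_def gen_in_adjoin[OF sCS])
  \<comment> \<open>\<open>v\<close> generates the function field of the solution, \<open>w \<beta>\<close> its extension by \<open>\<beta>\<close>\<close>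
  define Z where "Z = set Y \<union> fls_const ` (a \<union> qf_params \<phi>)"
  have Zc: "fls_const ` (a \<union> qf_params \<phi>) \<subseteq> fls_const ` K0" using a(2) \<phi>(1) by blast
  have Z: "finite Z" "Z \<subseteq> A" "Z \<subseteq> laurent K0" "Z \<subseteq> L"
  proof -
    show "finite Z" unfolding Z_def using a(1) finite_qf_params by blast
    show "Z \<subseteq> A" unfolding Z_def using Y(2) A2 Zc \<open>fls_const ` K0 \<subseteq> A\<close> by blast
    show "Z \<subseteq> laurent K0" unfolding Z_def using Y(2) M2 Zc cM by blast
    show "Z \<subseteq> L" unfolding Z_def using Y(2) YL Zc C0C CL by blast
  qed
  have "\<exists>v0. alg_over k v0 \<and> Z \<subseteq> adjoin k v0 \<and> (\<forall>E. is_subring E \<and> Z \<subseteq> E \<longrightarrow> v0 \<in> E)"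
    using Z(2) by (intro primitive_element_finite k Z(1)) (auto simp: A_def)
  then obtain v0 where v0: "alg_over k v0" "Z \<subseteq> adjoin k v0" "v0 \<in> laurent K0" "v0 \<in> L"
    using Z(3,4) sM sL by blast
  \<comment> \<open>Scaling by \<open>l\<close> makes the generator integral over \<int>[S] without
    changing the field that it generates over \<open>k\<close>.\<close>
  obtain l G where l: "l \<in> k" "l \<noteq> 0" and G: "minimal_integral S (l * v0) G"
    using minimal_integral_exists[OF St, of v0] v0(1) unfolding k_def by blast
  define v where "v = l * v0"
  have v: "v \<in> laurent K0" "v \<in> L" "v \<in> A"
    unfolding v_def using l v0 kM kL base_alg[OF k] is_subringD(4)[OF sM] is_subringD(4)[OF sL] is_subringD(4)[OF sA]
    by (auto simp: A_def)
  have kv: "is_subfield (adjoin k v)" by (rule is_subfield_adjoin[OF sk])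
  have kkv: "k \<subseteq> adjoin k v" using base_in_adjoin[OF sk] by blast
  have "v / l \<in> adjoin k v" using l kkv by (intro subfield_divide kv gen_in_adjoin[OF sk]) blast
  then have "v0 \<in> adjoin k v" using l by (simp add: v_def)
  then have Zv: "Z \<subseteq> adjoin k v" using adjoin_subset[OF kv kkv] v0(2) by blast
  have kvM: "adjoin k v \<subseteq> laurent K0" by (intro adjoin_subset M kM v)
  have "\<exists>c l G. l \<in> k \<and> l \<noteq> 0 \<and> minimal_integral S (l * (v + of_nat c * fls_const \<beta>)) G \<and>
      v \<in> adjoin k (v + of_nat c * fls_const \<beta>) \<and> fls_const \<beta> \<in> adjoin k (v + of_nat c * fls_const \<beta>)"
    if \<beta>: "\<beta> \<in> b" for \<beta>
  proof -
    have al: "alg_over k v" "alg_over k (fls_const \<beta>)" using v(3) const_alg \<beta> b(2) by (auto simp: A_def)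
    obtain c :: nat where c: "v \<in> adjoin k (v + of_nat c * fls_const \<beta>)" "fls_const \<beta> \<in> adjoin k (v + of_nat c * fls_const \<beta>)"
      using primitive_element[OF k al] .
    have "v + of_nat c * fls_const \<beta> \<in> A"
      using al by (intro is_subringD(3,4)[OF sA] subring_of_nat[OF sA]) (simp_all add: A_def)
    then have "alg_over (adjoin \<rat> S) (v + of_nat c * fls_const \<beta>)" by (simp add: A_def k_def)
    from minimal_integral_exists[OF St this] c show ?thesis unfolding k_def by blast
  qed
  then obtain c l' G' where w0: "\<And>\<beta>. \<beta> \<in> b \<Longrightarrow> l' \<beta> \<in> k" "\<And>\<beta>. \<beta> \<in> b \<Longrightarrow> l' \<beta> \<noteq> 0"
    "\<And>\<beta>. \<beta> \<in> b \<Longrightarrow> minimal_integral S (l' \<beta> * (v + of_nat (c \<beta>) * fls_const \<beta>)) (G' \<beta>)"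
    "\<And>\<beta>. \<beta> \<in> b \<Longrightarrow> v \<in> adjoin k (v + of_nat (c \<beta>) * fls_const \<beta>)"
    "\<And>\<beta>. \<beta> \<in> b \<Longrightarrow> fls_const \<beta> \<in> adjoin k (v + of_nat (c \<beta>) * fls_const \<beta>)"
    by metis
  define w where "w \<beta> = l' \<beta> * (v + of_nat (c \<beta>) * fls_const \<beta>)" for \<beta>
  have G': "minimal_integral S (w \<beta>) (G' \<beta>)" if "\<beta> \<in> b" for \<beta> using w0(3)[OF that] by (simp add: w_def)
  have wL: "w \<beta> \<in> L" if "\<beta> \<in> b" for \<beta>
  proof -
    have "fls_const \<beta> \<in> L" "l' \<beta> \<in> L" using CL w0(1)[OF that] kL by (auto simp: C_def)
    then show ?thesis unfolding w_def
      by (intro is_subringD(3,4)[OF sL] v subring_of_nat[OF sL])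
  qed
  \<comment> \<open>\<beta> is not in \<open>adjoin k v\<close>, because that field consists of
    Laurent series over \<open>K0\<close>, whose constants lie in \<open>K0\<close>.\<close>
  have degree: "degree G < degree (G' \<beta>)" if \<beta>: "\<beta> \<in> b" for \<beta>
  proof -
    have m: "lead_coeff (G' \<beta>) = 1" "rbpoly (G' \<beta>) S (w \<beta>) = 0" using G'[OF \<beta>] by (auto simp: minimal_integral_def)
    have kw: "is_subfield (adjoin k (w \<beta>))" by (rule is_subfield_adjoin[OF sk])
    have kkw: "k \<subseteq> adjoin k (w \<beta>)" using base_in_adjoin[OF sk] by blast
    have "w \<beta> / l' \<beta> \<in> adjoin k (w \<beta>)" using w0(1)[OF \<beta>] kkw by (intro subfield_divide kw gen_in_adjoin[OF sk]) blast
    then have "v + of_nat (c \<beta>) * fls_const \<beta> \<in> adjoin k (w \<beta>)" using w0(2)[OF \<beta>] by (simp add: w_def)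
    then have sub: "adjoin k (v + of_nat (c \<beta>) * fls_const \<beta>) \<subseteq> adjoin k (w \<beta>)" by (intro adjoin_subset kw kkw)
    have nb: "fls_const \<beta> \<notin> adjoin k v"
      using kvM fls_const_in_laurent[OF K0(1), of \<beta>] \<beta> b(3) by blast
    have "degree G < degree (map_poly (\<lambda>B. rpoly B S) (G' \<beta>))"
    proof (rule degree_less_of_not_in_adjoin[OF k _ _ _ _ _ nb])
      show "map_poly (\<lambda>B. rpoly B S) (G' \<beta>) \<in> polys_over k" "map_poly (\<lambda>B. rpoly B S) (G' \<beta>) \<noteq> 0"
        unfolding k_def by (rule monic_map_rpoly[OF m(1)])+
      show "poly (map_poly (\<lambda>B. rpoly B S) (G' \<beta>)) (w \<beta>) = 0" using m(2) by (simp add: rbpoly_def)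
      show "v \<in> adjoin k (w \<beta>)" "fls_const \<beta> \<in> adjoin k (w \<beta>)" using sub w0(4,5)[OF \<beta>] by auto
      show "poly p v \<noteq> 0" if "p \<in> polys_over k" "p \<noteq> 0" "degree p < degree G" for p
        using minimal_integral_poly[OF G St] that unfolding v_def k_def by blast
    qed
    then show ?thesis using monic_map_rpoly(3)[OF m(1), of S] by simp
  qed
  have Gm: "lead_coeff G = 1" "rbpoly G S v = 0" using G by (auto simp: minimal_integral_def v_def)
  have "alg_over (adjoin C S) f" using alg_over_mono[OF C0S f(2)] .
  then obtain h where h: "eventually_hom cofinite L h" and hc: "\<And>c. \<forall>\<^sub>F s in cofinite. h s (fls_const c) = c"
    and hS: "\<forall>\<^sub>F s in cofinite. h s S = s"
    using specialization[of s0 f] unfolding L_def C_def S_def by blast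
  define E where "E s = adjoin (adjoin \<rat> s) (h s v)" for s
  have Qc: "is_subring (\<rat> :: complex set)" by (rule subfield_imp_subring[OF is_subfield_Rats])
  have ks: "is_subfield (adjoin \<rat> s)" for s :: complex by (rule is_subfield_adjoin[OF Qc])
  have E: "is_subfield (E s)" for s unfolding E_def by (intro is_subfield_adjoin subfield_imp_subring ks)
  have sE: "s \<in> E s" for s
    unfolding E_def by (intro base_in_adjoin subfield_imp_subring ks gen_in_adjoin Qc)
  have vE: "h s v \<in> E s" for s
    unfolding E_def by (intro gen_in_adjoin subfield_imp_subring ks)
  \<comment> \<open>\<open>T\<close> is a field; once it contains \<open>S\<close> and
    \<open>v\<close>, it contains \<open>adjoin k v\<close> and with it \<open>Z\<close>.\<close>
  define T where "T = {z \<in> L. \<forall>\<^sub>F s in cofinite. h s z \<in> E s}"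
  have T: "is_subfield T" unfolding T_def by (rule eventually_hom_preimage_subfield[OF h L E])
  have "\<forall>\<^sub>F s in cofinite. h s S \<in> E s" using hS by eventually_elim (simp add: sE)
  then have "S \<in> T" using SL by (simp add: T_def)
  then have kT: "k \<subseteq> T" unfolding k_def by (intro adjoin_subset T Rats_subset_subfield)
  have "v \<in> T" using v vE by (simp add: T_def)
  then have kvT: "adjoin k v \<subseteq> T" by (intro adjoin_subset T kT)
  have e1: "\<forall>\<^sub>F s in cofinite. \<forall>z\<in>Z. h s z \<in> E s"
    using Zv kvT Z(1) by (intro eventually_ball_finite) (auto simp: T_def)
  have e2: "\<forall>\<^sub>F s in cofinite. \<forall>c\<in>a \<union> qf_params \<phi>. h s (fls_const c) = c"
    using a(1) finite_qf_params hc by (intro eventually_ball_finite) auto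
  have e3: "\<forall>\<^sub>F s in cofinite. rbpoly G s (h s v) = 0"
    using eventually_hom_rbpoly[OF h L SL v(2), of G] hS
    by eventually_elim (use Gm(2) eventually_homD(1)[OF h] in simp)
  have e4: "\<forall>\<^sub>F s in cofinite. \<forall>\<beta>\<in>b. rbpoly (G' \<beta>) s (h s (w \<beta>)) = 0"
  proof (intro eventually_ball_finite b(1) ballI)
    fix \<beta> assume \<beta>: "\<beta> \<in> b"
    have 0: "rbpoly (G' \<beta>) S (w \<beta>) = 0" using G'[OF \<beta>] by (simp add: minimal_integral_def)
    from eventually_hom_rbpoly[OF h L SL wL[OF \<beta>], of "G' \<beta>"] hS
    show "\<forall>\<^sub>F s in cofinite. rbpoly (G' \<beta>) s (h s (w \<beta>)) = 0"
      by eventually_elim (use 0 eventually_homD(1)[OF h] in simp)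
  qed
  \<comment> \<open>\<open>w \<beta>\<close> is built from \<open>v\<close>, \<beta> and elements of
    \<open>k\<close>; so if \<beta> itself lies in \<open>E s\<close>, the specialization of
    \<open>w \<beta>\<close> does as well.\<close>
  have e5: "\<forall>\<^sub>F s in cofinite. \<forall>\<beta>\<in>b. \<beta> \<in> E s \<longrightarrow> h s (w \<beta>) \<in> E s"
  proof (intro eventually_ball_finite b(1) ballI)
    fix \<beta> assume \<beta>: "\<beta> \<in> b"
    have \<beta>L: "fls_const \<beta> \<in> L" using CL by (auto simp: C_def)
    have lL: "l' \<beta> \<in> L" using w0(1)[OF \<beta>] kL by blast
    have lE: "\<forall>\<^sub>F s in cofinite. h s (l' \<beta>) \<in> E s" using w0(1)[OF \<beta>] kT by (auto simp: T_def)
    have cL: "of_nat (c \<beta>) \<in> L" by (rule subring_of_nat[OF sL])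
    have cbL: "of_nat (c \<beta>) * fls_const \<beta> \<in> L" by (rule is_subringD(4)[OF sL cL \<beta>L])
    from eventually_homD(4)[OF h lL is_subringD(3)[OF sL v(2) cbL]] eventually_homD(3)[OF h v(2) cbL]
      eventually_homD(4)[OF h cL \<beta>L] eventually_hom_of_nat[OF h sL, of "c \<beta>"] hc[of \<beta>] lE
    show "\<forall>\<^sub>F s in cofinite. \<beta> \<in> E s \<longrightarrow> h s (w \<beta>) \<in> E s"
    proof eventually_elim
      case (elim s)
      note sEs = subfield_imp_subring[OF E[of s]]
      have "h s (w \<beta>) = h s (l' \<beta>) * (h s v + of_nat (c \<beta>) * \<beta>)" unfolding w_def using elim(1-5) by simp
      then show ?case using elim(6) vE[of s]
        by (auto intro!: is_subringD(3,4)[OF sEs] subring_of_nat[OF sEs])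
    qed
  qed
  have e6: "\<forall>\<^sub>F s in cofinite. qf_sat (nth ((s + \<kappa>) # map (h s) Y)) \<phi>"
  proof -
    define x where "x i = nth ((S + fls_const \<kappa>) # Y) i" for i
    define x' where "x' s i = nth ((s + \<kappa>) # map (h s) Y) i" for s i
    have \<kappa>L: "fls_const \<kappa> \<in> L" using CL by (auto simp: C_def)
    have x: "x i \<in> L \<and> (\<forall>\<^sub>F s in cofinite. h s (x i) = x' s i)" if "i \<in> qf_vars \<phi>" for i
    proof (cases i)
      case 0
      have "\<forall>\<^sub>F s in cofinite. h s (S + fls_const \<kappa>) = s + \<kappa>"
        using eventually_homD(3)[OF h SL \<kappa>L] hS hc[of \<kappa>] by eventually_elim simp
      then show ?thesis using is_subringD(3)[OF sL SL \<kappa>L] by (simp add: 0 x_def x'_def)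
    next
      case (Suc j)
      then have "j < length Y" using that \<phi>(2) Y(1) by auto
      then have "Y ! j \<in> L" using Y(2) YL nth_mem[of j Y] by blast
      then show ?thesis using \<open>j < length Y\<close> by (simp add: Suc x_def x'_def)
    qed
    have "\<forall>\<^sub>F s in cofinite. qf_sat (x' s) (map_qf_formula (\<lambda>c. c) \<phi>) \<longleftrightarrow> qf_sat x (map_qf_formula fls_const \<phi>)"
      by (rule qf_transfer[OF h L _ x]) (use CL hc in \<open>auto simp: C_def\<close>)
    moreover have "x = nth ((S + fls_const \<kappa>) # Y)" by (rule ext) (simp add: x_def)
    moreover have "x' s = nth ((s + \<kappa>) # map (h s) Y)" for s by (rule ext) (simp add: x'_def)
    ultimately show ?thesis using sat by (simp add: qf_formula.map_ident)
  qed
  define good where "good s \<longleftrightarrow> (\<forall>z\<in>Z. h s z \<in> E s) \<and> (\<forall>c\<in>a \<union> qf_params \<phi>. h s (fls_const c) = c) \<and>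
    rbpoly G s (h s v) = 0 \<and> (\<forall>\<beta>\<in>b. rbpoly (G' \<beta>) s (h s (w \<beta>)) = 0) \<and>
    (\<forall>\<beta>\<in>b. \<beta> \<in> E s \<longrightarrow> h s (w \<beta>) \<in> E s) \<and> qf_sat (nth ((s + \<kappa>) # map (h s) Y)) \<phi>" for s
  have ev_good: "\<forall>\<^sub>F s in cofinite. good s"
    using e1 e2 e3 e4 e5 e6 by eventually_elim (simp add: good_def)
  define hil where "hil \<beta> N p \<longleftrightarrow> (prime p \<longrightarrow> (\<forall>w. rbpoly (G' \<beta>) (complex_of_real (root N (real p))) w = 0 \<longrightarrow>
     (\<forall>H\<in>polys_over (adjoin \<rat> (complex_of_real (root N (real p)))). H \<noteq> 0 \<longrightarrow> degree H < degree (G' \<beta>) \<longrightarrow> poly H w \<noteq> 0)))" for \<beta> N p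
  have "\<forall>\<^sub>F N in sequentially. \<forall>\<beta>\<in>b. \<forall>\<^sub>F p in sequentially. hil \<beta> N p"
  proof (intro eventually_ball_finite b(1) ballI)
    fix \<beta> assume \<beta>: "\<beta> \<in> b"
    have "lead_coeff (G' \<beta>) = 1" "G' \<beta> \<in> polys_over (polys_over \<int>)"
      using G'[OF \<beta>] by (auto simp: minimal_integral_def)
    from hilbert_irreducibility_root[OF this minimal_integral_irreducible[OF G'[OF \<beta>]]]
    show "\<forall>\<^sub>F N in sequentially. \<forall>\<^sub>F p in sequentially. hil \<beta> N p"
      unfolding eventually_sequentially hil_def Let_def by blast
  qed
  then have "\<forall>\<^sub>F N in sequentially. N > 0 \<and> (\<forall>\<beta>\<in>b. \<forall>\<^sub>F p in sequentially. hil \<beta> N p)"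
    using eventually_gt_at_top[of 0] by eventually_elim simp
  then obtain N where N: "N > 0" "\<forall>\<beta>\<in>b. \<forall>\<^sub>F p in sequentially. hil \<beta> N p"
    using eventually_happens'[OF sequentially_bot] by blast
  \<comment> \<open>By injectivity the finitely many bad \<open>s\<close> exclude only finitely many
    \<open>p\<close>; \<open>N\<close> was fixed before, uniformly for the finite set
    \<open>b\<close>.\<close>
  have "inj (\<lambda>p::nat. complex_of_real (root N (real p)))"
    using N(1) by (intro injI) simp
  then have "finite ((\<lambda>p::nat. complex_of_real (root N (real p))) -` {s. \<not> good s})"
    using ev_good unfolding eventually_cofinite by (intro finite_vimageI)
  then have "\<forall>\<^sub>F p in sequentially. good (complex_of_real (root N (real p)))"
    unfolding cofinite_eq_sequentially[symmetric] eventually_cofinite by (simp add: vimage_def)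
  moreover have "\<forall>\<^sub>F p in sequentially. \<forall>\<beta>\<in>b. hil \<beta> N p" using N(2) b(1) by (intro eventually_ball_finite)
  ultimately have "\<forall>\<^sub>F p in sequentially. good (complex_of_real (root N (real p))) \<and> (\<forall>\<beta>\<in>b. hil \<beta> N p)"
    by (rule eventually_conj)
  then obtain P where P: "\<And>p. p \<ge> P \<Longrightarrow> good (complex_of_real (root N (real p))) \<and> (\<forall>\<beta>\<in>b. hil \<beta> N p)"
    unfolding eventually_sequentially by blast
  obtain p where p: "prime p" "p > P" using bigger_prime by blast
  define s where "s = complex_of_real (root N (real p))"
  have good: "good s" and hil: "\<And>\<beta>. \<beta> \<in> b \<Longrightarrow> hil \<beta> N p" using P[of p] p(2) by (simp_all add: s_def)
  interpret prime_root p N s by unfold_locales (use p(1) N(1) in \<open>simp_all add: s_def\<close>)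
  have sI: "algebraic_int s" by (rule alg_int_root[OF s_power])
  have gE: "map_poly (\<lambda>B. rpoly B s) G \<in> polys_over (adjoin \<rat> s)" "map_poly (\<lambda>B. rpoly B s) G \<noteq> 0"
    "poly (map_poly (\<lambda>B. rpoly B s) G) (h s v) = 0" "degree (map_poly (\<lambda>B. rpoly B s) G) = degree G"
    using monic_map_rpoly[OF Gm(1), of s] good by (simp_all add: good_def rbpoly_def)
  have "b \<inter> E s = {}"
  proof (rule ccontr)
    assume "b \<inter> E s \<noteq> {}"
    then obtain \<beta> where \<beta>: "\<beta> \<in> b" "\<beta> \<in> E s" by blast
    then have wE: "h s (w \<beta>) \<in> adjoin (adjoin \<rat> s) (h s v)" using good unfolding good_def E_def by blast
    obtain q where q: "q \<in> polys_over (adjoin \<rat> s)" "q \<noteq> 0" "degree q \<le> degree G" "poly q (h s (w \<beta>)) = 0"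
      using degree_bound_adjoin[OF ks gE(1-3) wE] gE(4) by auto
    have "rbpoly (G' \<beta>) s (h s (w \<beta>)) = 0" using good \<beta>(1) by (simp add: good_def)
    moreover have "degree q < degree (G' \<beta>)" using q(3) degree[OF \<beta>(1)] by simp
    ultimately show False using hil[OF \<beta>(1)] p(1) q unfolding hil_def s_def by blast
  qed
  moreover have "E s \<subseteq> Qbar"
  proof -
    have B: "is_subfield {z::complex. alg_over \<rat> z}" by (rule is_subfield_alg[OF is_subfield_Rats])
    have "alg_over \<rat> s" using sI algebraic_int_imp_algebraic[of s] alg_over_Rats_iff[of s] by blast
    then have 1: "adjoin \<rat> s \<subseteq> {z. alg_over \<rat> z}"
      by (intro adjoin_subset B Rats_subset_subfield) simp
    have "alg_over (adjoin \<rat> s) (h s v)" using gE unfolding alg_over_def by blast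
    then have "alg_over \<rat> (h s v)" using alg_trans[OF is_subfield_Rats] alg_over_mono[OF 1] by blast
    then have "E s \<subseteq> {z. alg_over \<rat> z}" unfolding E_def by (intro adjoin_subset B 1) simp
    then show ?thesis by (simp add: Qbar_def alg_over_Rats_iff)
  qed
  moreover have "a \<union> qf_params \<phi> \<subseteq> E s"
  proof
    fix c assume c: "c \<in> a \<union> qf_params \<phi>"
    then have "h s (fls_const c) = c" using good unfolding good_def by blast
    moreover have "h s (fls_const c) \<in> E s" using good c unfolding good_def Z_def by blast
    ultimately show "c \<in> E s" by simp
  qed
  moreover have "set (map (h s) Y) \<subseteq> E s" using good by (auto simp: good_def Z_def)
  moreover have "qf_sat (nth ((s + \<kappa>) # map (h s) Y)) \<phi>" using good by (simp add: good_def)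
  ultimately show ?thesis using E[of s] sE[of s] sI Y(1)
    by (intro exI[of _ "E s"] exI[of _ s] exI[of _ "map (h s) Y"]) simp
qed

section \<open>Meagerness\<close>

text \<open>Keeping \<kappa> apart lets one statement serve both cases: only
  \<open>\<sigma> n\<close> is replaced by the integral \<open>s\<close>, and \<kappa> decides
  whether the new first coordinate is integral.\<close>

lemma ring_of_integers_approximation:
  fixes K0 :: "complex set" and \<sigma> :: "nat \<Rightarrow> complex"
  assumes K0: "K0 \<in> Sub_Qbar" and \<phi>: "qf_params \<phi> \<subseteq> K0" "qf_vars \<phi> \<subseteq> {..m}" and \<kappa>: "\<kappa> \<in> \<rat>"
    and \<sigma>: "inj \<sigma>" "\<And>n. \<sigma> n \<in> \<rat>"
    and sat: "\<And>n. \<exists>ys. length ys = m \<and> set ys \<subseteq> K0 \<and> qf_sat (nth ((\<sigma> n + \<kappa>) # ys)) \<phi>"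
    and P: "finite P" "P \<subseteq> K0" and N: "finite N" "N \<subseteq> Qbar" "N \<inter> K0 = {}"
  shows "\<exists>E s ys. E \<in> Sub_Qbar \<and> P \<union> qf_params \<phi> \<subseteq> E \<and> N \<inter> E = {} \<and> s \<in> E \<and>
    algebraic_int s \<and> length ys = m \<and> set ys \<subseteq> E \<and> qf_sat (nth ((s + \<kappa>) # ys)) \<phi>"
proof -
  have K: "is_subfield K0" "K0 \<subseteq> Qbar" using K0 by (auto simp: Sub_Qbar_def)
  then have Q: "\<rat> \<subseteq> K0" by (intro Rats_subset_subfield)
  have "\<forall>n. \<exists>ys. length ys = m \<and> set ys \<subseteq> K0 \<and> qf_sat (nth ((\<sigma> n + \<kappa>) # ys)) \<phi>"
    using sat by (rule allI)
  from choice[OF this] obtain ys where ys: "\<forall>n. length (ys n) = m \<and> set (ys n) \<subseteq> K0 \<and>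
    qf_sat (nth ((\<sigma> n + \<kappa>) # ys n)) \<phi>" ..
  have ys: "length (ys n) = m" "set (ys n) \<subseteq> K0" "qf_sat (nth ((\<sigma> n + \<kappa>) # ys n)) \<phi>" for n
    using ys by simp_all
  have "\<kappa> \<in> K0" "\<And>n. \<sigma> n \<in> K0" using \<kappa> \<sigma>(2) Q by auto
  from laurent_point[OF K(1) \<phi> this(1) \<sigma>(1) this(2) ys]
  obtain n f Y where Y: "length Y = m" "f \<in> laurent K0"
    "alg_over (adjoin (fls_const ` K0) (fls_const (\<sigma> n) + fls_X)) f"
    "set Y \<subseteq> adjoin (adjoin (fls_const ` K0) (fls_const (\<sigma> n) + fls_X)) f"
    "qf_sat (nth ((fls_const (\<sigma> n) + fls_X + fls_const \<kappa>) # Y)) (map_qf_formula fls_const \<phi>)"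
    by (elim exE conjE)
  from number_field_point[OF K \<phi> \<sigma>(2) Y(1,4,2,3,5) P N]
  show ?thesis unfolding Sub_Qbar_def mem_Collect_eq
    by (elim exE conjE) (intro exI conjI)
qed

section \<open>Basic open sets and a criterion for nowhere dense sets of subfields\<close>

lemma openin_Sub_Qbar_basic:
  assumes "finite P" "finite N" "P \<subseteq> Qbar" "N \<subseteq> Qbar"
  shows "openin Sub_Qbar_topology {K \<in> Sub_Qbar. P \<subseteq> K \<and> N \<inter> K = {}}"
proof -
  have "openin (powerset_topology Qbar) {K. K \<subseteq> Qbar \<and> P \<subseteq> K \<and> N \<inter> K = {}}"
    unfolding openin_powerset_topology_iff
    by (intro conjI ballI exI[of _ P] exI[of _ N]) (use assms in auto)
  then show ?thesis
    unfolding Sub_Qbar_topology_def openin_subtopology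
    by (intro exI[of _ "{K. K \<subseteq> Qbar \<and> P \<subseteq> K \<and> N \<inter> K = {}}"]) (auto simp: Sub_Qbar_def)
qed

lemma openin_Sub_Qbar_nbhd:
  assumes "openin Sub_Qbar_topology U" "K \<in> U"
  shows "\<exists>P N. finite P \<and> finite N \<and> P \<subseteq> K \<and> N \<subseteq> Qbar \<and> N \<inter> K = {} \<and>
    {L \<in> Sub_Qbar. P \<subseteq> L \<and> N \<inter> L = {}} \<subseteq> U"
proof -
  obtain V where V: "openin (powerset_topology Qbar) V" "U = V \<inter> Sub_Qbar"
    using assms(1) unfolding Sub_Qbar_topology_def openin_subtopology by blast
  then have "K \<in> V" using assms(2) by simp
  from conjunct2[OF V(1)[unfolded openin_powerset_topology_iff], rule_format, OF this]
  obtain P N where PN: "finite P \<and> finite N \<and> P \<subseteq> Qbar \<and> N \<subseteq> Qbar \<and> P \<subseteq> K \<and> N \<inter> K = {} \<and>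
    {T. T \<subseteq> Qbar \<and> P \<subseteq> T \<and> N \<inter> T = {}} \<subseteq> V"
    by (elim exE)
  then have "{L \<in> Sub_Qbar. P \<subseteq> L \<and> N \<inter> L = {}} \<subseteq> U" using V(2) by (auto simp: Sub_Qbar_def)
  then show ?thesis using PN by (intro exI[of _ P] exI[of _ N] conjI) simp_all
qed

text \<open>A nonempty open set inside the closure of \<open>A\<close> meets \<open>A\<close> in
  some \<open>K\<close>. A basic neighbourhood of \<open>K\<close> in it contains \<open>E\<close>,
  so \<open>E\<close> is in the closure; but the open set of fields containing \<open>P'\<close>
  separates \<open>E\<close> from \<open>A\<close>.\<close>

lemma nowhere_dense_Sub_QbarI:
  assumes A: "A \<subseteq> Sub_Qbar"
    and avoid: "\<And>K P N. \<lbrakk>K \<in> A; finite P; finite N; P \<subseteq> K; N \<subseteq> Qbar; N \<inter> K = {}\<rbrakk> \<Longrightarrow>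
      \<exists>E P'. E \<in> Sub_Qbar \<and> finite P' \<and> P \<union> P' \<subseteq> E \<and> N \<inter> E = {} \<and>
        (\<forall>L\<in>Sub_Qbar. P' \<subseteq> L \<longrightarrow> L \<notin> A)"
  shows "nowhere_dense_in Sub_Qbar_topology A"
proof -
  define U where "U = Sub_Qbar_topology interior_of (Sub_Qbar_topology closure_of A)"
  have U: "openin Sub_Qbar_topology U" "U \<subseteq> Sub_Qbar_topology closure_of A"
    unfolding U_def by (simp_all add: interior_of_subset)
  have "U = {}"
  proof (rule ccontr)
    assume "U \<noteq> {}"
    then obtain K1 where "K1 \<in> U" by blast
    then obtain K where K: "K \<in> A" "K \<in> U" using U unfolding in_closure_of subset_eq by blast
    obtain P N where PN: "finite P \<and> finite N \<and> P \<subseteq> K \<and> N \<subseteq> Qbar \<and> N \<inter> K = {} \<and>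
      {L \<in> Sub_Qbar. P \<subseteq> L \<and> N \<inter> L = {}} \<subseteq> U"
      using openin_Sub_Qbar_nbhd[OF U(1) K(2)] by (elim exE)
    then have PN: "finite P" "finite N" "P \<subseteq> K" "N \<subseteq> Qbar" "N \<inter> K = {}"
      "{L \<in> Sub_Qbar. P \<subseteq> L \<and> N \<inter> L = {}} \<subseteq> U" by simp_all
    from avoid[OF K(1) PN(1-5)] obtain E P' where E: "E \<in> Sub_Qbar" "finite P'" "P \<union> P' \<subseteq> E" "N \<inter> E = {}"
      "\<forall>L\<in>Sub_Qbar. P' \<subseteq> L \<longrightarrow> L \<notin> A" by (elim exE conjE)
    have "openin Sub_Qbar_topology {L \<in> Sub_Qbar. P' \<subseteq> L \<and> {} \<inter> L = {}}"
      using E(1-3) by (intro openin_Sub_Qbar_basic) (auto simp: Sub_Qbar_def)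
    moreover have "E \<in> Sub_Qbar_topology closure_of A" using PN(6) E(1,3,4) U(2) by blast
    moreover have "E \<in> {L \<in> Sub_Qbar. P' \<subseteq> L \<and> {} \<inter> L = {}}" using E(1,3) by simp
    ultimately have "\<exists>L\<in>A. L \<in> {L \<in> Sub_Qbar. P' \<subseteq> L \<and> {} \<inter> L = {}}"
      unfolding in_closure_of by (metis (no_types))
    then show False using E(5) by auto
  qed
  then show ?thesis using A by (simp add: nowhere_dense_in_def U_def)
qed

lemma not_algebraic_int_half: "\<not> algebraic_int (of_int k + 1 / 2 :: complex)"
proof
  assume "algebraic_int (of_int k + 1 / 2 :: complex)"
  moreover have "(of_int k + 1 / 2 :: complex) \<in> \<rat>" by (intro Rats_add Rats_divide) auto
  ultimately have "(of_int k + 1 / 2 :: complex) \<in> \<int>" by (rule rational_algebraic_int_is_int)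
  then obtain l where "(of_int k + 1 / 2 :: complex) = of_int l" by (elim Ints_cases)
  then have "(of_int (2 * k + 1) :: complex) = of_int (2 * l)" by (simp add: field_simps)
  then have "2 * k + 1 = 2 * l" by (simp only: of_int_eq_iff)
  then show False by presburger
qed

text \<open>Existential truth passes to every field containing the witnesses, so a field
  \<open>L\<close> of the set that contains \<open>s + 1/2\<close> and \<open>ys\<close> would have
  \<open>s + 1/2\<close> integral.\<close>

lemma nowhere_dense_existential:
  "nowhere_dense_in Sub_Qbar_topology {K \<in> Sub_Qbar. qf_params \<phi> \<subseteq> K \<and> qf_vars \<phi> \<subseteq> {..m} \<and>
     ring_of_integers K = {x \<in> K. \<exists>ys. length ys = m \<and> set ys \<subseteq> K \<and> qf_sat (nth (x # ys)) \<phi>}}"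
  (is "nowhere_dense_in _ ?A")
proof (rule nowhere_dense_Sub_QbarI)
  fix K P N assume K: "K \<in> ?A" and PN: "finite P" "finite N" "P \<subseteq> K" "N \<subseteq> Qbar" "N \<inter> K = {}"
  \<comment> \<open>The formula holds at the natural numbers \<open>\<sigma> n + 1/2\<close>. Once
    \<open>\<sigma> n\<close> is replaced by an integral \<open>s\<close>, the same shift produces a
    point that is not integral.\<close>
  define \<sigma> where "\<sigma> n = of_nat n - (1/2 :: complex)" for n
  have "of_nat n \<in> ring_of_integers K" for n
  proof -
    have "is_subfield K" using K by (auto simp: Sub_Qbar_def)
    then show ?thesis by (simp add: ring_of_integers_def subring_of_nat subfield_imp_subring)
  qed
  then have sat: "\<exists>ys. length ys = m \<and> set ys \<subseteq> K \<and> qf_sat (nth ((\<sigma> n + 1/2) # ys)) \<phi>" for n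
  proof -
    have "of_nat n \<in> {x \<in> K. \<exists>ys. length ys = m \<and> set ys \<subseteq> K \<and> qf_sat (nth (x # ys)) \<phi>}"
      using \<open>of_nat n \<in> ring_of_integers K\<close> K by blast
    then show ?thesis by (simp add: \<sigma>_def)
  qed
  have "inj \<sigma>" by (auto simp: inj_def \<sigma>_def)
  have "\<sigma> n \<in> \<rat>" for n unfolding \<sigma>_def by (intro Rats_diff Rats_divide) auto
  have "(1/2 :: complex) \<in> \<rat>" by (intro Rats_divide) auto
  have "K \<in> Sub_Qbar" "qf_params \<phi> \<subseteq> K" "qf_vars \<phi> \<subseteq> {..m}" using K by auto
  from ring_of_integers_approximation[OF this \<open>1/2 \<in> \<rat>\<close> \<open>inj \<sigma>\<close> \<open>\<And>n. \<sigma> n \<in> \<rat>\<close> sat PN(1,3,2,4,5)]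
  obtain E s ys where E: "E \<in> Sub_Qbar" "P \<union> qf_params \<phi> \<subseteq> E" "N \<inter> E = {}" "s \<in> E" "algebraic_int s"
    "length ys = m" "set ys \<subseteq> E" "qf_sat (nth ((s + 1/2) # ys)) \<phi>"
    by (elim exE conjE)
  have "L \<notin> ?A" if L: "L \<in> Sub_Qbar" "insert (s + 1/2) (set ys) \<subseteq> L" for L
  proof
    assume "L \<in> ?A"
    then have "s + 1/2 \<in> ring_of_integers L" using L(2) E(6,8) by auto
    then have "s + 1/2 \<in> {z. algebraic_int z}" "s \<in> {z. algebraic_int z}"
      using E(5) by (simp_all add: ring_of_integers_def)
    from subring_diff[OF is_subring_algebraic_int this] show False using not_algebraic_int_half[of 0] by simp
  qed
  moreover have "s + 1/2 \<in> E"
  proof -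
    have "is_subfield E" using E(1) by (simp add: Sub_Qbar_def)
    moreover from this have "1/2 \<in> E" using Rats_subset_subfield \<open>1/2 \<in> \<rat>\<close> by blast
    ultimately show ?thesis using E(4) by (simp add: is_subfield_def)
  qed
  ultimately show "\<exists>E P'. E \<in> Sub_Qbar \<and> finite P' \<and> P \<union> P' \<subseteq> E \<and> N \<inter> E = {} \<and>
        (\<forall>L\<in>Sub_Qbar. P' \<subseteq> L \<longrightarrow> L \<notin> ?A)"
    using E by (intro exI[of _ E] exI[of _ "insert (s + 1/2) (set ys)"]) simp
qed blast

text \<open>A universal formula fails as soon as one witness for \<open>Neg \<phi>\<close> is
  present, so a field \<open>L\<close> of the set that contains \<open>s\<close> and
  \<open>ys\<close> would have to exclude the algebraic integer \<open>s\<close> from its ring of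
  integers.\<close>

lemma nowhere_dense_universal:
  "nowhere_dense_in Sub_Qbar_topology {K \<in> Sub_Qbar. qf_params \<phi> \<subseteq> K \<and> qf_vars \<phi> \<subseteq> {..m} \<and>
     ring_of_integers K = {x \<in> K. \<forall>ys. length ys = m \<and> set ys \<subseteq> K \<longrightarrow> qf_sat (nth (x # ys)) \<phi>}}"
  (is "nowhere_dense_in _ ?A")
proof (rule nowhere_dense_Sub_QbarI)
  fix K P N assume K: "K \<in> ?A" and PN: "finite P" "finite N" "P \<subseteq> K" "N \<subseteq> Qbar" "N \<inter> K = {}"
  \<comment> \<open>Half-integers are never integral, so the formula fails at each of these
    infinitely many points.\<close>
  define \<sigma> where "\<sigma> n = of_nat n + (1/2 :: complex)" for n
  have \<sigma>: "\<sigma> n \<in> \<rat>" for n unfolding \<sigma>_def by (intro Rats_add Rats_divide) auto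
  have "\<sigma> n \<in> K" for n using \<sigma>[of n] Rats_subset_subfield[of K] K by (auto simp: Sub_Qbar_def)
  moreover have "\<sigma> n \<notin> ring_of_integers K" for n
    using not_algebraic_int_half[of "int n"] by (simp add: ring_of_integers_def \<sigma>_def)
  ultimately have sat: "\<exists>ys. length ys = m \<and> set ys \<subseteq> K \<and> qf_sat (nth ((\<sigma> n + 0) # ys)) (Neg \<phi>)" for n
    using K by auto
  have "inj \<sigma>" by (auto simp: inj_def \<sigma>_def)
  have "K \<in> Sub_Qbar" "qf_params (Neg \<phi>) \<subseteq> K" "qf_vars (Neg \<phi>) \<subseteq> {..m}" using K by auto
  from ring_of_integers_approximation[OF this Rats_0 \<open>inj \<sigma>\<close> \<sigma> sat PN(1,3,2,4,5)]
  obtain E s ys where E: "E \<in> Sub_Qbar" "P \<union> qf_params (Neg \<phi>) \<subseteq> E" "N \<inter> E = {}" "s \<in> E" "algebraic_int s"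
    "length ys = m" "set ys \<subseteq> E" "qf_sat (nth ((s + 0) # ys)) (Neg \<phi>)"
    by (elim exE conjE)
  have "L \<notin> ?A" if L: "L \<in> Sub_Qbar" "insert s (set ys) \<subseteq> L" for L
  proof
    assume "L \<in> ?A"
    moreover have "s \<in> ring_of_integers L" using L(2) E(5) by (simp add: ring_of_integers_def)
    ultimately show False using L(2) E(6,8) by auto
  qed
  then show "\<exists>E P'. E \<in> Sub_Qbar \<and> finite P' \<and> P \<union> P' \<subseteq> E \<and> N \<inter> E = {} \<and>
        (\<forall>L\<in>Sub_Qbar. P' \<subseteq> L \<longrightarrow> L \<notin> ?A)"
    using E by (intro exI[of _ E] exI[of _ "insert s (set ys)"]) simp
qed blast

section \<open>Countability and the final union\<close>

lemma countable_Qbar: "countable Qbar"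
proof -
  have "Qbar \<subseteq> (\<Union>l \<in> {l :: int list. map_poly of_int (Poly l) \<noteq> (0 :: complex poly)}.
    {z. poly (map_poly of_int (Poly l)) z = 0})"
  proof
    fix z assume "z \<in> Qbar"
    then obtain p where p: "\<And>i. coeff p i \<in> \<int>" "p \<noteq> 0" "poly p z = 0"
      by (auto simp: Qbar_def algebraic_def)
    from p(1) have "\<forall>i. \<exists>c. coeff p i = of_int c" by (auto simp: Ints_def)
    from choice[OF this] obtain c where c: "\<forall>i. coeff p i = of_int (c i)" ..
    have "map_poly of_int (Poly (map c [0..<Suc (degree p)])) = p"
      by (intro poly_eqI)
        (auto simp: coeff_map_poly nth_default_def c[rule_format, symmetric] coeff_eq_0 simp del: upt_Suc)
    then show "z \<in> (\<Union>l \<in> {l :: int list. map_poly of_int (Poly l) \<noteq> (0 :: complex poly)}.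
      {z. poly (map_poly of_int (Poly l)) z = 0})"
      using p(2,3) by (intro UN_I[of "map c [0..<Suc (degree p)]"]; simp only: mem_Collect_eq)

  qed
  then show ?thesis
    by (rule countable_subset) (intro countable_UN countableI_type countable_finite poly_roots_finite; simp)
qed

instance rterm :: (countable) countable by countable_datatype

instance qf_formula :: (countable) countable by countable_datatype

text \<open>Every such formula arises by decoding from one with natural numbers as parameters, and
  those form a countable type.\<close>

lemma countable_formulas:
  assumes "countable C"
  shows "countable {\<phi>. qf_params \<phi> \<subseteq> C}"
proof -
  have "{\<phi>. qf_params \<phi> \<subseteq> C} \<subseteq> range (map_qf_formula (from_nat_into C))"
  proof
    fix \<phi> assume "\<phi> \<in> {\<phi>. qf_params \<phi> \<subseteq> C}"
    then have "map_qf_formula (from_nat_into C \<circ> to_nat_on C) \<phi> = map_qf_formula (\<lambda>c. c) \<phi>"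
      using assms by (intro qf_formula.map_cong[OF refl]) auto
    then have "\<phi> = map_qf_formula (from_nat_into C) (map_qf_formula (to_nat_on C) \<phi>)"
      by (simp add: qf_formula.map_comp qf_formula.map_ident)
    then show "\<phi> \<in> range (map_qf_formula (from_nat_into C))" by blast
  qed
  then show ?thesis by (rule countable_subset) simp
qed

theorem theorem1p3:
  shows "meager_in Sub_Qbar_topology
           {K \<in> Sub_Qbar. existentially_definable K (ring_of_integers K) \<or>
                          universally_definable K (ring_of_integers K)}"
proof -
  define A where "A m \<phi> = {K \<in> Sub_Qbar. qf_params \<phi> \<subseteq> K \<and> qf_vars \<phi> \<subseteq> {..m} \<and>
     ring_of_integers K = {x \<in> K. \<exists>ys. length ys = m \<and> set ys \<subseteq> K \<and> qf_sat (nth (x # ys)) \<phi>}}" for m \<phi>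
  define B where "B m \<phi> = {K \<in> Sub_Qbar. qf_params \<phi> \<subseteq> K \<and> qf_vars \<phi> \<subseteq> {..m} \<and>
     ring_of_integers K = {x \<in> K. \<forall>ys. length ys = m \<and> set ys \<subseteq> K \<longrightarrow> qf_sat (nth (x # ys)) \<phi>}}" for m \<phi>
  define \<A> where "\<A> = (\<Union>m. A m ` {\<phi>. qf_params \<phi> \<subseteq> Qbar} \<union> B m ` {\<phi>. qf_params \<phi> \<subseteq> Qbar})"
  have "countable \<A>"
    unfolding \<A>_def by (intro countable_UN countable_Un countable_image countable_formulas countable_Qbar) simp
  moreover have "nowhere_dense_in Sub_Qbar_topology (A m \<phi>)" "nowhere_dense_in Sub_Qbar_topology (B m \<phi>)" for m \<phi>
    unfolding A_def B_def by (rule nowhere_dense_existential nowhere_dense_universal)+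
  then have "\<forall>S\<in>\<A>. nowhere_dense_in Sub_Qbar_topology S" by (auto simp: \<A>_def)
  moreover have "K \<in> \<Union>\<A> \<longleftrightarrow> (\<exists>m \<phi>. K \<in> A m \<phi>) \<or> (\<exists>m \<phi>. K \<in> B m \<phi>)" for K
  proof -
    have "qf_params \<phi> \<subseteq> Qbar" if "K \<in> A m \<phi> \<or> K \<in> B m \<phi>" for m \<phi>
      using that unfolding A_def B_def Sub_Qbar_def by blast
    moreover have "K \<in> \<Union>\<A> \<longleftrightarrow> (\<exists>m \<phi>. qf_params \<phi> \<subseteq> Qbar \<and> (K \<in> A m \<phi> \<or> K \<in> B m \<phi>))"
      unfolding \<A>_def by blast
    ultimately show ?thesis by meson
  qed
  moreover have "(\<exists>m \<phi>. K \<in> A m \<phi>) \<longleftrightarrow> K \<in> Sub_Qbar \<and> existentially_definable K (ring_of_integers K)"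
    "(\<exists>m \<phi>. K \<in> B m \<phi>) \<longleftrightarrow> K \<in> Sub_Qbar \<and> universally_definable K (ring_of_integers K)" for K
    unfolding existentially_definable_def universally_definable_def A_def B_def mem_Collect_eq by simp_all
  ultimately have "{K \<in> Sub_Qbar. existentially_definable K (ring_of_integers K) \<or>
    universally_definable K (ring_of_integers K)} = \<Union>\<A>" by (simp only: set_eq_iff mem_Collect_eq conj_disj_distribL simp_thms)
  with \<open>countable \<A>\<close> \<open>\<forall>S\<in>\<A>. nowhere_dense_in Sub_Qbar_topology S\<close> show ?thesis
    unfolding meager_in_def by (intro exI[of _ \<A>] conjI)
qed

end
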